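(* Let $p\ge1$, $m=2p$. The set of Weyl functions on the semiaxis (see context) of all systems $W_{k+1}(\lambda)-W_k(\lambda)=-\frac{i}{\lambda}jC_kW_k(\lambda)$, $k\ge0$, with $C_k=2K^*\beta(k)^*\beta(k)K-j$ for $p\times m$ matrices $\beta(k)$ satisfying $\beta(k)J\beta(k)^*=I_p$, coincides with the set of $p\times p$ matrix functions $\varphi$ such that $$i\varphi\Big(i\frac{z+1}{z-1}\Big)=\alpha_0+\sum_{k=1}^\infty s_{-k}z^k$$ is a Carath\'eodory matrix function in the unit disc and the block Toeplitz matrices $\{s_{j-k}\}_{k,j=0}^N$ are positive definite for all $0\le N<\infty$, where $s_0:=\alpha_0+\alpha_0^*$ and $s_k:=s_{-k}^*$. Moreover, such a system is uniquely determined by its Weyl function: for every $N\ge0$, with $\alpha_k:=s_{-k}$ ($1\le k\le N$), $\Phi_1$ the $(N+1)p\times p$ block column of identities, $\Phi_2$ the block column with blocks $\alpha_0,\alpha_0+\alpha_1,\dots,\alpha_0+\dots+\alpha_N$, $\Pi=[\Phi_1\ \Phi_2]$, $A=\{a_{j-k}\}_{k,j=0}^N$ with $a_r=0$ ($r>0$), $a_0=\frac i2I_p$, $a_r=iI_p$ ($r<0$), the identity $AS-SA^*=i\Pi J\Pi^*$ has a unique solution $S>0$ and $\Pi^*S^{-1}\Pi=\sum_{k=0}^N\beta(k)^*\beta(k)$.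
   Context: $j=\mathrm{diag}(I_p,-I_p)$, $J=\begin{bmatrix}0&I_p\\ I_p&0\end{bmatrix}$, $K=\frac1{\sqrt2}\begin{bmatrix}I_p&-I_p\\ I_p&I_p\end{bmatrix}$, $\mathbb C_-$ the open lower half-plane, $q(\lambda)=|\lambda|^2(|\lambda|^2+1)^{-1}$, $W_k$ the solution with $W_0=I_m$. A Weyl function on the semiaxis is a $p\times p$ matrix function $\varphi$ holomorphic in $\mathbb C_-$ such that for every $\lambda\in\mathbb C_-$ the series $\sum_{k=0}^\infty[i\varphi(\lambda)^*\ \ I_p]q(\lambda)^kKW_k(\lambda)^*C_kW_k(\lambda)K^*\begin{bmatrix}-i\varphi(\lambda)\\ I_p\end{bmatrix}$ converges. A Carath\'eodory matrix function in the unit disc is a matrix function $F$ holomorphic in $|z|<1$ with $F(z)+F(z)^*\ge0$ there. *)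

theory Defs
  imports "HOL-Analysis.Analysis" "Jordan_Normal_Form.Gauss_Jordan_Elimination"
begin

definition adj :: "complex mat \<Rightarrow> complex mat" where
  "adj A = mat (dim_col A) (dim_row A) (\<lambda>(i,j). cnj (A $$ (j,i)))"

definition blockmat :: "nat \<Rightarrow> nat \<Rightarrow> nat \<Rightarrow> nat \<Rightarrow> (nat \<Rightarrow> nat \<Rightarrow> complex mat) \<Rightarrow> complex mat" where
  "blockmat r c bp bq B = mat (r*bp) (c*bq) (\<lambda>(a,b). B (a div bp) (b div bq) $$ (a mod bp, b mod bq))"

definition msum :: "nat \<Rightarrow> ('i \<Rightarrow> complex mat) \<Rightarrow> 'i set \<Rightarrow> complex mat" where
  "msum n f I = mat n n (\<lambda>(a,b). \<Sum>k\<in>I. f k $$ (a,b))"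

definition herm :: "complex mat \<Rightarrow> bool" where
  "herm A \<longleftrightarrow> square_mat A \<and> adj A = A"

definition qform :: "complex mat \<Rightarrow> (nat \<Rightarrow> complex) \<Rightarrow> complex" where
  "qform A v = (\<Sum>a<dim_row A. \<Sum>b<dim_row A. cnj (v a) * A $$ (a,b) * v b)"

definition pos_semidef :: "complex mat \<Rightarrow> bool" where
  "pos_semidef A \<longleftrightarrow> herm A \<and> (\<forall>v. 0 \<le> Re (qform A v))"

definition pos_def :: "complex mat \<Rightarrow> bool" where
  "pos_def A \<longleftrightarrow> herm A \<and> (\<forall>v. (\<exists>a<dim_row A. v a \<noteq> 0) \<longrightarrow> 0 < Re (qform A v))"

definition minv :: "complex mat \<Rightarrow> complex mat" where
  "minv S = the (mat_inverse S)"

definition jmat :: "nat \<Rightarrow> complex mat" where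
  "jmat p = mat (2*p) (2*p) (\<lambda>(a,b). if a = b then (if a < p then 1 else -1) else 0)"

definition Jmat :: "nat \<Rightarrow> complex mat" where
  "Jmat p = mat (2*p) (2*p) (\<lambda>(a,b). if (a < p \<and> b = a + p) \<or> (b < p \<and> a = b + p) then 1 else 0)"

definition Kmat :: "nat \<Rightarrow> complex mat" where
  "Kmat p = mat (2*p) (2*p) (\<lambda>(a,b). if a mod p = b mod p
      then (if a < p \<and> p \<le> b then - 1 / complex_of_real (sqrt 2) else 1 / complex_of_real (sqrt 2))
      else 0)"

definition admissible :: "nat \<Rightarrow> (nat \<Rightarrow> complex mat) \<Rightarrow> bool" where
  "admissible p \<beta> \<longleftrightarrow> (\<forall>k. \<beta> k \<in> carrier_mat p (2*p) \<and> \<beta> k * Jmat p * adj (\<beta> k) = 1\<^sub>m p)"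

definition Cmat :: "nat \<Rightarrow> (nat \<Rightarrow> complex mat) \<Rightarrow> nat \<Rightarrow> complex mat" where
  "Cmat p \<beta> k = 2 \<cdot>\<^sub>m (adj (Kmat p) * adj (\<beta> k) * \<beta> k * Kmat p) - jmat p"

fun Wsol :: "nat \<Rightarrow> (nat \<Rightarrow> complex mat) \<Rightarrow> complex \<Rightarrow> nat \<Rightarrow> complex mat" where
  "Wsol p \<beta> l 0 = 1\<^sub>m (2*p)"
| "Wsol p \<beta> l (Suc k) = Wsol p \<beta> l k - (\<i> / l) \<cdot>\<^sub>m (jmat p * Cmat p \<beta> k * Wsol p \<beta> l k)"

definition qfun :: "complex \<Rightarrow> real" where
  "qfun l = (cmod l)^2 / ((cmod l)^2 + 1)"

definition colvec :: "nat \<Rightarrow> complex mat \<Rightarrow> complex mat" where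
  "colvec p F = mat (2*p) p (\<lambda>(a,b). if a < p then - \<i> * F $$ (a,b) else (if a - p = b then 1 else 0))"

definition weyl_term :: "nat \<Rightarrow> (nat \<Rightarrow> complex mat) \<Rightarrow> (complex \<Rightarrow> complex mat) \<Rightarrow> complex \<Rightarrow> nat \<Rightarrow> complex mat" where
  "weyl_term p \<beta> \<phi> l k = complex_of_real (qfun l ^ k) \<cdot>\<^sub>m
     (adj (colvec p (\<phi> l)) * Kmat p * adj (Wsol p \<beta> l k) * Cmat p \<beta> k * Wsol p \<beta> l k
        * adj (Kmat p) * colvec p (\<phi> l))"

definition lower_hp :: "complex set" where
  "lower_hp = {z. Im z < 0}"

definition is_weyl :: "nat \<Rightarrow> (nat \<Rightarrow> complex mat) \<Rightarrow> (complex \<Rightarrow> complex mat) \<Rightarrow> bool" where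
  "is_weyl p \<beta> \<phi> \<longleftrightarrow>
     (\<forall>l\<in>lower_hp. \<phi> l \<in> carrier_mat p p) \<and>
     (\<forall>a<p. \<forall>b<p. (\<lambda>l. \<phi> l $$ (a,b)) holomorphic_on lower_hp) \<and>
     (\<forall>l\<in>lower_hp. \<forall>a<p. \<forall>b<p. summable (\<lambda>k. weyl_term p \<beta> \<phi> l k $$ (a,b)))"

definition Ftrans :: "(complex \<Rightarrow> complex mat) \<Rightarrow> complex \<Rightarrow> complex mat" where
  "Ftrans \<phi> z = \<i> \<cdot>\<^sub>m \<phi> (\<i> * (z + 1) / (z - 1))"

definition caratheodory :: "nat \<Rightarrow> (complex \<Rightarrow> complex mat) \<Rightarrow> bool" where
  "caratheodory p F \<longleftrightarrow>
     (\<forall>z\<in>ball 0 1. F z \<in> carrier_mat p p) \<and>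
     (\<forall>a<p. \<forall>b<p. (\<lambda>z. F z $$ (a,b)) holomorphic_on ball 0 1) \<and>
     (\<forall>z\<in>ball 0 1. pos_semidef (F z + adj (F z)))"

text \<open>F(z) = sum c_k z^k on the unit disc, so c 0 = alpha_0 and c k = s_{-k} for k >= 1.\<close>
definition expansion :: "nat \<Rightarrow> (complex \<Rightarrow> complex mat) \<Rightarrow> (nat \<Rightarrow> complex mat) \<Rightarrow> bool" where
  "expansion p F c \<longleftrightarrow> (\<forall>k. c k \<in> carrier_mat p p) \<and>
     (\<forall>z\<in>ball 0 1. \<forall>a<p. \<forall>b<p. (\<lambda>k. c k $$ (a,b) * z ^ k) sums (F z $$ (a,b)))"

definition sseq :: "(nat \<Rightarrow> complex mat) \<Rightarrow> int \<Rightarrow> complex mat" where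
  "sseq c r = (if r < 0 then c (nat (- r)) else if r = 0 then c 0 + adj (c 0) else adj (c (nat r)))"

definition toeplitz :: "nat \<Rightarrow> (nat \<Rightarrow> complex mat) \<Rightarrow> nat \<Rightarrow> complex mat" where
  "toeplitz p c N = blockmat (Suc N) (Suc N) p p (\<lambda>k j. sseq c (int j - int k))"

definition Pimat :: "nat \<Rightarrow> (nat \<Rightarrow> complex mat) \<Rightarrow> nat \<Rightarrow> complex mat" where
  "Pimat p c N = blockmat (Suc N) 2 p p (\<lambda>k l. if l = 0 then 1\<^sub>m p else msum p c {..k})"

definition Amat :: "nat \<Rightarrow> nat \<Rightarrow> complex mat" where
  "Amat p N = blockmat (Suc N) (Suc N) p p
     (\<lambda>k j. if k < j then 0\<^sub>m p p else if j = k then (\<i> / 2) \<cdot>\<^sub>m 1\<^sub>m p else \<i> \<cdot>\<^sub>m 1\<^sub>m p)"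

end

theory Submission
  imports Defs "Jordan_Normal_Form.Determinant" "HOL-Complex_Analysis.Complex_Analysis"
begin

text \<open>
  In the variable z with l = i(z+1)/(z-1) the system is t_(k+1) = (P_k + z(1 - P_k)) t_k with the
  J-orthogonal projections P_k = J beta(k)^* beta(k). The summands of the Weyl series telescope, and
  phi is a Weyl function iff all t_k started at [-F(z); I], F = i phi, are J-nonpositive.

  The solution of the displacement equation is the block Toeplitz matrix T itself. The theorem rests on
  a matrix M with M T M^* = 1 and M Pi = B, where B stacks the beta(k): then T > 0, T^-1 = M^* M and
  Pi^* T^-1 Pi = B^* B. Given a system, M is built from the coefficients of the polynomials
  beta(k) (P_(k-1) + z(1 - P_(k-1))) ... (P_0 + z(1 - P_0)), it intertwines the two triangular
  displacement operators, and M Pi = B follows from boundedness at z = 0; uniqueness in the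
  displacement equation yields M T M^* = 1. Given T > 0, M is the inverse Cholesky factor, which
  defines B := M Pi, and J-nonpositivity of t_(N+1) is Potapov's inequality
  (1 - |z|^2) h^* T^-1 h \<le> F + F^*, a limit of the positivity of larger Toeplitz forms.
\<close>

section \<open>The indefinite form and the rows of the coefficient matrices\<close>

text \<open>The Toeplitz matrix satisfies T + A0 T + T A0^* = Pi J Pi^*, while \<beta>(k) J
  \<beta>(k)^* = I says that 1 + L + L^* = B J B^*, where L is the strictly block lower part of the
  Gram matrix of all rows. If M Pi = B and M A0 = L M, then M T M^* and 1 solve the same equation;
  so the intertwining M A0 = L M is wanted in both directions. For v = [-F; I] x and the block
  vector h of backward shifts of F applied to x, Pi v = ((1 - z) A0 - z) h. Hence s = -M h obeys the
  triangular recursion of the numbers \<beta>(k) t_k / z^(k+1), and |s|^2 = h^* T^-1 h. This ties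
  the sign of the form at t_(N+1) to Potapov's inequality. Convergence of the Weyl series carries
  sign information only because its summands are nonnegative. That rests on the signature of J: the
  range of P_k is a maximal positive subspace, so J is nonpositive on the kernel of \<beta>(k). One
  \<beta> has to serve every N. Therefore all entries are indexed by natural numbers independently
  of N, and the Cholesky rows are built one scalar row at a time.\<close>

declare assoc_mult_mat[simp del]

text \<open>The rows of all the matrices beta(k) are numbered consecutively, row i of beta(k) having the
  index k*p+i. The matrix J acts on coordinates by swap_half.\<close>

definition swap_half :: "nat \<Rightarrow> nat \<Rightarrow> nat" where
  "swap_half p c = (if c < p then c + p else c - p)"

lemma swap_half_lt: "c < 2*p \<Longrightarrow> swap_half p c < 2*p"
  by (auto simp: swap_half_def)

lemma swap_half_swap_half: "c < 2*p \<Longrightarrow> swap_half p (swap_half p c) = c"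
  by (auto simp: swap_half_def)

lemma sum_swap_half': "(\<Sum>c<2*p. f (swap_half p c) c) = (\<Sum>c<2*p. f c (swap_half p c))"
  by (rule sum.reindex_bij_witness[of _ "swap_half p" "swap_half p"])
     (auto simp: swap_half_lt swap_half_swap_half)

lemma sum_lessThan_double:
  fixes f :: "nat \<Rightarrow> 'a::comm_monoid_add"
  shows "(\<Sum>c<2*p. f c) = (\<Sum>c<p. f c) + (\<Sum>c<p. f (c + p))"
proof -
  have "(\<Sum>c<2*p. f c) = (\<Sum>c<p. f c) + (\<Sum>c=p..<2*p. f c)"
    by (subst sum.union_disjoint[symmetric]) (auto intro!: sum.cong)
  also have "(\<Sum>c=p..<2*p. f c) = (\<Sum>c<p. f (c + p))"
    using sum.shift_bounds_nat_ivl[of f 0 p p] by (simp add: lessThan_atLeast0 mult_2)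
  finally show ?thesis .
qed

text \<open>The indefinite inner product y^* J x.\<close>

definition Jform :: "nat \<Rightarrow> (nat \<Rightarrow> complex) \<Rightarrow> (nat \<Rightarrow> complex) \<Rightarrow> complex" where
  "Jform p x y = (\<Sum>c<2*p. x (swap_half p c) * cnj (y c))"

abbreviation Jnorm :: "nat \<Rightarrow> (nat \<Rightarrow> complex) \<Rightarrow> real" where
  "Jnorm p x \<equiv> Re (Jform p x x)"

lemma Jform_cnj: "cnj (Jform p x y) = Jform p y x"
  unfolding Jform_def sum_swap_half'[of "\<lambda>c d. y c * cnj (x d)"]
  by (simp add: mult.commute)

lemma Jform_cong: "(\<And>c. c < 2*p \<Longrightarrow> x c = x' c) \<Longrightarrow> (\<And>c. c < 2*p \<Longrightarrow> y c = y' c) \<Longrightarrow> Jform p x y = Jform p x' y'"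
  unfolding Jform_def by (intro sum.cong) (auto simp: swap_half_lt)

lemma Jform_lincomb_left:
  "Jform p (\<lambda>c. \<mu> * x c + \<nu> * y c) w = \<mu> * Jform p x w + \<nu> * Jform p y w"
  unfolding Jform_def by (simp add: sum_distrib_left sum.distrib algebra_simps)

lemma Jform_lincomb_right:
  "Jform p w (\<lambda>c. \<mu> * x c + \<nu> * y c) = cnj \<mu> * Jform p w x + cnj \<nu> * Jform p w y"
  unfolding Jform_def by (simp add: sum_distrib_left sum.distrib algebra_simps)

lemma Jform_real: "Jform p x x = of_real (Jnorm p x)"
  using Jform_cnj[of p x x] by (metis Reals_cnj_iff of_real_Re)

definition brow :: "nat \<Rightarrow> (nat \<Rightarrow> complex mat) \<Rightarrow> nat \<Rightarrow> nat \<Rightarrow> complex" where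
  "brow p \<beta> a c = \<beta> (a div p) $$ (a mod p, c)"

definition bval :: "nat \<Rightarrow> (nat \<Rightarrow> complex mat) \<Rightarrow> nat \<Rightarrow> (nat \<Rightarrow> complex) \<Rightarrow> complex" where
  "bval p \<beta> a t = (\<Sum>c<2*p. brow p \<beta> a c * t c)"

text \<open>The entries of B J B^*, where B is the stack of all \<beta>(k).\<close>

definition gram :: "nat \<Rightarrow> (nat \<Rightarrow> complex mat) \<Rightarrow> nat \<Rightarrow> nat \<Rightarrow> complex" where
  "gram p \<beta> a b = Jform p (brow p \<beta> a) (brow p \<beta> b)"

text \<open>bdual is the operator J beta(k)^* and bproj is P_k = J beta(k)^* beta(k), which is a J-orthogonal
  projection for admissible beta.\<close>

definition bdual :: "nat \<Rightarrow> (nat \<Rightarrow> complex mat) \<Rightarrow> nat \<Rightarrow> (nat \<Rightarrow> complex) \<Rightarrow> nat \<Rightarrow> complex" where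
  "bdual p \<beta> k y c = (\<Sum>i<p. cnj (brow p \<beta> (k*p+i) (swap_half p c)) * y i)"

definition bproj :: "nat \<Rightarrow> (nat \<Rightarrow> complex mat) \<Rightarrow> nat \<Rightarrow> (nat \<Rightarrow> complex) \<Rightarrow> nat \<Rightarrow> complex" where
  "bproj p \<beta> k t = bdual p \<beta> k (\<lambda>i. bval p \<beta> (k*p+i) t)"

lemma bval_lincomb: "bval p \<beta> a (\<lambda>c. \<mu> * x c + \<nu> * y c) = \<mu> * bval p \<beta> a x + \<nu> * bval p \<beta> a y"
  unfolding bval_def by (simp add: sum_distrib_left sum.distrib algebra_simps)

lemma bval_scale: "bval p \<beta> a (\<lambda>c. \<mu> * x c) = \<mu> * bval p \<beta> a x"
  unfolding bval_def by (simp add: sum_distrib_left algebra_simps)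

lemma bval_sum: "bval p \<beta> a (\<lambda>c. \<Sum>l\<in>I. f l c) = (\<Sum>l\<in>I. bval p \<beta> a (f l))"
  unfolding bval_def by (simp add: sum_distrib_left) (rule sum.swap)

lemma bval_dual: "bval p \<beta> a (\<lambda>c. cnj (brow p \<beta> b (swap_half p c))) = gram p \<beta> a b"
  unfolding bval_def gram_def Jform_def
  by (rule sum_swap_half'[of "\<lambda>c d. brow p \<beta> a d * cnj (brow p \<beta> b c)"]) 

lemma bval_bdual: "bval p \<beta> a (bdual p \<beta> k y) = (\<Sum>i<p. gram p \<beta> a (k*p+i) * y i)"
proof -
  have "bdual p \<beta> k y = (\<lambda>c. \<Sum>i<p. y i * cnj (brow p \<beta> (k*p+i) (swap_half p c)))"
    by (simp add: bdual_def fun_eq_iff mult.commute)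
  then show ?thesis
    by (simp only: bval_sum bval_scale bval_dual) (simp add: mult.commute)
qed

lemma gram_cnj: "cnj (gram p \<beta> a b) = gram p \<beta> b a"
  by (simp add: gram_def Jform_cnj)

section \<open>Entries of products and adjoints; admissibility in terms of rows\<close>

lemma mat_mult_entry:
  assumes "A \<in> carrier_mat n m" "B \<in> carrier_mat m k" "i < n" "j < k"
  shows "(A * B) $$ (i,j) = (\<Sum>c<m. A $$ (i,c) * B $$ (c,j))"
  using assms by (simp add: scalar_prod_def lessThan_atLeast0)

lemma adj_carrier[simp]: "A \<in> carrier_mat n m \<Longrightarrow> adj A \<in> carrier_mat m n"
  by (simp add: adj_def)

lemma dim_adj[simp]: "dim_row (adj A) = dim_col A" "dim_col (adj A) = dim_row A"
  by (auto simp: adj_def)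

lemma adj_entry: "A \<in> carrier_mat n m \<Longrightarrow> i < m \<Longrightarrow> j < n \<Longrightarrow> adj A $$ (i,j) = cnj (A $$ (j,i))"
  by (auto simp: adj_def)

lemma adj_adj[simp]: "adj (adj A) = A"
  by (auto simp: adj_def intro!: eq_matI)

lemma adj_mult:
  assumes "A \<in> carrier_mat n m" "B \<in> carrier_mat m k"
  shows "adj (A * B) = adj B * adj A"
proof (rule eq_matI)
  fix i j assume "i < dim_row (adj B * adj A)" "j < dim_col (adj B * adj A)"
  then have ij: "i < k" "j < n" using assms by (auto simp: adj_def)
  have "adj (A * B) $$ (i,j) = cnj (\<Sum>c<m. A $$ (j,c) * B $$ (c,i))"
    using assms ij by (subst adj_entry[of _ n k]) (auto simp: mat_mult_entry simp del: index_mult_mat)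
  also have "\<dots> = (adj B * adj A) $$ (i,j)"
    using assms ij
    by (subst mat_mult_entry[of _ k m _ n]) (auto simp: adj_entry mult.commute intro!: sum.cong)
  finally show "adj (A * B) $$ (i,j) = (adj B * adj A) $$ (i,j)" .
qed (use assms in \<open>auto simp: adj_def\<close>)

lemma Jmat_carrier[simp]: "Jmat p \<in> carrier_mat (2*p) (2*p)"
  by (simp add: Jmat_def)

lemma Jmat_entry: "a < 2*p \<Longrightarrow> c < 2*p \<Longrightarrow> Jmat p $$ (a,c) = (if c = swap_half p a then 1 else 0)"
  by (auto simp: Jmat_def swap_half_def)

lemma mult_Jmat_entry:
  assumes "A \<in> carrier_mat n (2*p)" "i < n" "c < 2*p"
  shows "(A * Jmat p) $$ (i,c) = A $$ (i, swap_half p c)"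
proof -
  have "(A * Jmat p) $$ (i,c) = (\<Sum>d<2*p. A $$ (i,d) * (if d = swap_half p c then 1 else 0))"
    using assms by (subst mat_mult_entry[of _ n "2*p" _ "2*p"])
      (auto simp: Jmat_entry swap_half_swap_half intro!: sum.cong)
  then show ?thesis using assms by (simp add: swap_half_lt if_distrib cong: if_cong)
qed

lemma mult_Jmat_adj_entry:
  assumes "A \<in> carrier_mat n (2*p)" "B \<in> carrier_mat m (2*p)" "i < n" "j < m"
  shows "(A * Jmat p * adj B) $$ (i,j) = Jform p (\<lambda>c. A $$ (i,c)) (\<lambda>c. B $$ (j,c))"
  unfolding Jform_def using assms
  by (subst mat_mult_entry[of _ n "2*p" _ m])
     (auto simp: mult_Jmat_entry adj_entry simp del: index_mult_mat intro!: sum.cong)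

lemma block_index: "i < p \<Longrightarrow> (k*p+i) div p = k" "i < p \<Longrightarrow> (k*p+i) mod p = i" for i p k :: nat
  by auto

lemma admissible_gram:
  assumes "admissible p \<beta>" "i < p" "j < p"
  shows "gram p \<beta> (k*p+i) (k*p+j) = (if i = j then 1 else 0)"
proof -
  have "(\<beta> k * Jmat p * adj (\<beta> k)) $$ (i,j) = (1\<^sub>m p) $$ (i,j)" "\<beta> k \<in> carrier_mat p (2*p)"
    using assms unfolding admissible_def by auto
  then show ?thesis using assms(2,3)
    by (simp add: mult_Jmat_adj_entry gram_def brow_def[abs_def] block_index del: index_mult_mat)
qed

lemma bval_bdual_block:
  assumes "admissible p \<beta>" "i < p"
  shows "bval p \<beta> (k*p+i) (bdual p \<beta> k y) = y i"
proof -
  have "bval p \<beta> (k*p+i) (bdual p \<beta> k y) = (\<Sum>j<p. if i = j then y j else 0)"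
    unfolding bval_bdual using assms by (intro sum.cong) (auto simp: admissible_gram)
  then show ?thesis using assms by simp
qed

definition bnorm2 :: "nat \<Rightarrow> (nat \<Rightarrow> complex mat) \<Rightarrow> nat \<Rightarrow> (nat \<Rightarrow> complex) \<Rightarrow> real" where
  "bnorm2 p \<beta> k t = (\<Sum>i<p. (cmod (bval p \<beta> (k*p+i) t))\<^sup>2)"

text \<open>Since J^2 = 1, the operator J \<beta>(k)^* is the adjoint of \<beta>(k), regarded as a
  map from the indefinite space to the Euclidean space C^p.\<close>

lemma Jform_bdual: "Jform p (bdual p \<beta> k y) t = (\<Sum>i<p. y i * cnj (bval p \<beta> (k*p+i) t))"
proof -
  have "Jform p (bdual p \<beta> k y) t = (\<Sum>c<2*p. \<Sum>i<p. cnj (brow p \<beta> (k*p+i) c) * y i * cnj (t c))"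
    unfolding Jform_def bdual_def
    by (intro sum.cong) (auto simp: swap_half_swap_half sum_distrib_right)
  also have "\<dots> = (\<Sum>i<p. \<Sum>c<2*p. cnj (brow p \<beta> (k*p+i) c) * y i * cnj (t c))"
    by (rule sum.swap)
  also have "\<dots> = (\<Sum>i<p. y i * cnj (bval p \<beta> (k*p+i) t))"
    by (intro sum.cong) (auto simp: bval_def sum_distrib_left cnj_sum algebra_simps)
  finally show ?thesis .
qed

lemma Jform_bproj_self: "Jform p (bproj p \<beta> k t) t = of_real (bnorm2 p \<beta> k t)"
  unfolding bproj_def Jform_bdual bnorm2_def of_real_sum complex_norm_square ..

lemma Jform_bproj_bproj:
  assumes "admissible p \<beta>"
  shows "Jform p (bproj p \<beta> k t) (bproj p \<beta> k t) = of_real (bnorm2 p \<beta> k t)"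
  unfolding bproj_def Jform_bdual bnorm2_def of_real_sum complex_norm_square
  by (simp add: bval_bdual_block[OF assms])

text \<open>The vector is \<mu> (1 - P_k) t + (\<mu> + \<nu>) P_k t; the two parts are J-orthogonal,
  and the form of P_k t is |\<beta>(k) t|^2.\<close>

lemma Jform_lincomb_bproj:
  assumes "admissible p \<beta>"
  shows "Jform p (\<lambda>c. \<mu> * t c + \<nu> * bproj p \<beta> k t c) (\<lambda>c. \<mu> * t c + \<nu> * bproj p \<beta> k t c)
    = of_real ((cmod \<mu>)\<^sup>2) * Jform p t t + of_real (((cmod (\<mu> + \<nu>))\<^sup>2 - (cmod \<mu>)\<^sup>2) * bnorm2 p \<beta> k t)"
proof -
  have 1: "Jform p t (bproj p \<beta> k t) = of_real (bnorm2 p \<beta> k t)"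
    using Jform_bproj_self[of p \<beta> k t] Jform_cnj[of p "bproj p \<beta> k t" t] by simp
  show ?thesis
    unfolding Jform_lincomb_left Jform_lincomb_right 1 Jform_bproj_self Jform_bproj_bproj[OF assms]
    unfolding of_real_mult of_real_diff complex_norm_square by (simp add: algebra_simps)
qed

section \<open>The signature of J and the sign of the form on the kernel of \<beta>(k)\<close>

lemma injective_imp_surjective:
  fixes A :: "complex mat"
  assumes A: "A \<in> carrier_mat n n"
    and inj: "\<And>x. (\<forall>a<n. (\<Sum>b<n. A $$ (a,b) * x b) = 0) \<Longrightarrow> \<forall>b<n. x b = 0"
  obtains B where "B \<in> carrier_mat n n" "A * B = 1\<^sub>m n" "B * A = 1\<^sub>m n"
proof -
  have "Determinant.det A \<noteq> 0"
  proof
    assume "Determinant.det A = 0"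
    then obtain v where v: "v \<in> carrier_vec n" "v \<noteq> 0\<^sub>v n" "A *\<^sub>v v = 0\<^sub>v n"
      using det_0_iff_vec_prod_zero_field[OF A] by blast
    have "(\<Sum>b<n. A $$ (a,b) * vec_index v b) = 0" if "a < n" for a
    proof -
      have "vec_index (A *\<^sub>v v) a = 0" using v that by simp
      then show ?thesis using A v(1) that
        by (simp add: scalar_prod_def lessThan_atLeast0)
    qed
    then have "\<forall>b<n. vec_index v b = 0" using inj[of "vec_index v"] by blast
    then have "v = 0\<^sub>v n" using v(1) by (intro eq_vecI) auto
    then show False using v(2) by simp
  qed
  then have "mat_inverse A \<noteq> None"
    using mat_inverse(1)[OF A, of "()"] det_non_zero_imp_unit[OF A, of "()"] by blast
  then obtain B where "mat_inverse A = Some B" by auto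
  then show thesis using mat_inverse(2)[OF A] that by blast
qed

lemma Jform_half_zero:
  assumes "\<And>c. p \<le> c \<Longrightarrow> c < 2*p \<Longrightarrow> x c = 0"
  shows "Jform p x x = 0"
  unfolding Jform_def by (rule sum.neutral) (auto simp: swap_half_def assms)

text \<open>J has p positive squares and the range of J \<beta>(k)^* is a p-dimensional positive
  subspace, so its J-orthogonal complement, the kernel of \<beta>(k), is nonpositive. Instead of an
  inertia theorem a direct complement is used: the vectors with vanishing lower half form a neutral
  space, which meets the positive range only in 0, and together the two spaces span
  everything.\<close>

lemma Jform_nonpos_on_kernel:
  assumes adm: "admissible p \<beta>" and ker: "\<And>i. i < p \<Longrightarrow> bval p \<beta> (k*p+i) w = 0"
  shows "Jnorm p w \<le> 0"
proof -
  \<comment> \<open>\<open>A\<close> is the lower half of J \<beta>(k)^*. It is injective, because a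
    vector with zero lower half is neutral while the form of J \<beta>(k)^* y is |y|^2.\<close>
  define A where "A = mat p p (\<lambda>(a,i). cnj (brow p \<beta> (k*p+i) a))"
  have A: "A \<in> carrier_mat p p" by (simp add: A_def)
  have Ay: "(\<Sum>i<p. A $$ (a,i) * y i) = bdual p \<beta> k y (a + p)" if "a < p" for a y
    using that by (simp add: A_def bdual_def swap_half_def)
  have dual: "Jform p (bdual p \<beta> k y) (bdual p \<beta> k y) = of_real (\<Sum>i<p. (cmod (y i))\<^sup>2)" for y
    unfolding Jform_bdual of_real_sum complex_norm_square
    using adm by (simp add: bval_bdual_block)
  have "\<forall>i<p. y i = 0" if "\<forall>a<p. (\<Sum>i<p. A $$ (a,i) * y i) = 0" for y
  proof -
    have "bdual p \<beta> k y c = 0" if "p \<le> c" "c < 2*p" for c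
      using Ay[of "c - p" y] \<open>\<forall>a<p. _ a\<close> that by auto
    then have "(\<Sum>i<p. (cmod (y i))\<^sup>2) = 0"
      using dual[of y] Jform_half_zero[of p "bdual p \<beta> k y"] by (metis of_real_eq_0_iff)
    then show ?thesis by (simp add: sum_nonneg_eq_0_iff)
  qed
  then obtain B where B: "B \<in> carrier_mat p p" "A * B = 1\<^sub>m p"
    using injective_imp_surjective[OF A] by metis
  define y where "y i = (\<Sum>b<p. B $$ (i,b) * w (b + p))" for i
  have y: "bdual p \<beta> k y (a + p) = w (a + p)" if "a < p" for a
  proof -
    have "bdual p \<beta> k y (a + p) = (\<Sum>i<p. \<Sum>b<p. A $$ (a,i) * (B $$ (i,b) * w (b + p)))"
      unfolding Ay[OF that, symmetric] y_def sum_distrib_left ..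
    also have "\<dots> = (\<Sum>b<p. (A * B) $$ (a,b) * w (b + p))"
      using that A B(1) by (subst sum.swap)
        (auto simp: mat_mult_entry sum_distrib_right mult.assoc simp del: index_mult_mat intro!: sum.cong)
    also have "\<dots> = (\<Sum>b<p. if b = a then w (b + p) else 0)"
      using that by (intro sum.cong) (auto simp: B(2))
    finally show ?thesis using that by simp
  qed
  \<comment> \<open>By the choice of y the difference has zero lower half and is neutral. Its mixed
    terms vanish as w is in the kernel, which leaves [w,w] = -|y|^2.\<close>
  let ?w = "\<lambda>c. 1 * w c + (-1) * bdual p \<beta> k y c"
  have z1: "Jform p (bdual p \<beta> k y) w = 0" unfolding Jform_bdual by (simp add: ker)
  then have z2: "Jform p w (bdual p \<beta> k y) = 0" using Jform_cnj[of p "bdual p \<beta> k y" w] by simp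
  have "0 = Jform p ?w ?w"
  proof (rule Jform_half_zero[symmetric])
    fix c assume "p \<le> c" "c < 2 * p"
    then show "1 * w c + - 1 * bdual p \<beta> k y c = 0" using y[of "c - p"] by simp
  qed
  also have "\<dots> = Jform p w w + of_real (\<Sum>i<p. (cmod (y i))\<^sup>2)"
    unfolding Jform_lincomb_left Jform_lincomb_right by (simp add: z1 z2 dual del: of_real_sum)
  finally have "Jnorm p w = - (\<Sum>i<p. (cmod (y i))\<^sup>2)"
    by (simp add: complex_eq_iff)
  then show ?thesis by (simp add: sum_nonneg)
qed

text \<open>t - P_k t lies in the kernel of \<beta>(k), and its form is [t,t] - |\<beta>(k)
  t|^2.\<close>

lemma Jform_le_bnorm2:
  assumes adm: "admissible p \<beta>"
  shows "Jnorm p t \<le> bnorm2 p \<beta> k t"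
proof -
  let ?w = "\<lambda>c. 1 * t c + (-1) * bproj p \<beta> k t c"
  have "Jnorm p ?w \<le> 0"
  proof (rule Jform_nonpos_on_kernel[OF adm])
    fix i assume "i < p"
    then show "bval p \<beta> (k * p + i) ?w = 0"
      unfolding bval_lincomb bproj_def using adm by (simp add: bval_bdual_block)
  qed
  then show ?thesis unfolding Jform_lincomb_bproj[OF adm] by simp
qed

text \<open>With l = i(z+1)/(z-1), the vector K W_k(l) K^* v equals (2/(z+1))^k times the k-th member of this
  sequence, because 1 - (i/l)(2 P_k - 1) = (2/(z+1)) (P_k + z (1 - P_k)).\<close>

fun tseq :: "nat \<Rightarrow> (nat \<Rightarrow> complex mat) \<Rightarrow> complex \<Rightarrow> (nat \<Rightarrow> complex) \<Rightarrow> nat \<Rightarrow> nat \<Rightarrow> complex" where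
  "tseq p \<beta> z v 0 = v"
| "tseq p \<beta> z v (Suc k) = (\<lambda>c. z * tseq p \<beta> z v k c + (1 - z) * bproj p \<beta> k (tseq p \<beta> z v k) c)"

text \<open>This is q(l) |2/(z+1)|^2: the weight that remains when the scalar factors (2/(z+1))^k of
  K W_k K^* are absorbed.\<close>

definition weyl_wt :: "complex \<Rightarrow> real" where
  "weyl_wt z = 2 / (1 + (cmod z)\<^sup>2)"

lemma Jform_tseq_Suc:
  assumes adm: "admissible p \<beta>"
  shows "Jnorm p (tseq p \<beta> z v (Suc k))
    = (cmod z)\<^sup>2 * Jnorm p (tseq p \<beta> z v k)
      + (1 - (cmod z)\<^sup>2) * bnorm2 p \<beta> k (tseq p \<beta> z v k)"
  unfolding tseq.simps Jform_lincomb_bproj[OF adm] by simp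

text \<open>The weighted quadratic form of K C_k K^* = 2 \<beta>(k)^* \<beta>(k) - J at t_k.\<close>

definition weyl_summand :: "nat \<Rightarrow> (nat \<Rightarrow> complex mat) \<Rightarrow> complex \<Rightarrow> (nat \<Rightarrow> complex) \<Rightarrow> nat \<Rightarrow> real" where
  "weyl_summand p \<beta> z v k = weyl_wt z ^ k * (2 * bnorm2 p \<beta> k (tseq p \<beta> z v k)
     - Jnorm p (tseq p \<beta> z v k))"

lemma bnorm2_nonneg: "0 \<le> bnorm2 p \<beta> k t"
  by (simp add: bnorm2_def sum_nonneg)

lemma weyl_wt_pos: "0 < weyl_wt z"
  unfolding weyl_wt_def by (simp add: add_pos_nonneg)

lemma weyl_summand_nonneg:
  assumes adm: "admissible p \<beta>"
  shows "0 \<le> weyl_summand p \<beta> z v k"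
  unfolding weyl_summand_def
  using Jform_le_bnorm2[OF adm, of "tseq p \<beta> z v k" k] bnorm2_nonneg[of p \<beta> k "tseq p \<beta> z v k"] weyl_wt_pos[of
      z]
  by simp

text \<open>The weight 2/(1 + |z|^2) is the one for which the increment of the weighted J-form is a
  multiple of the summand with a factor independent of k; this factor is positive for |z| <
  1.\<close>

lemma weyl_telescope:
  assumes adm: "admissible p \<beta>"
  shows "weyl_wt z ^ Suc k * Jnorm p (tseq p \<beta> z v (Suc k))
    - weyl_wt z ^ k * Jnorm p (tseq p \<beta> z v k)
    = (1 - (cmod z)\<^sup>2) / (1 + (cmod z)\<^sup>2) * weyl_summand p \<beta> z v k"
proof -
  define q where "q = (cmod z)\<^sup>2"
  have q: "1 + q \<noteq> 0" using zero_le_power2[of "cmod z"] unfolding q_def by linarith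
  define J where "J = Jnorm p (tseq p \<beta> z v k)"
  define S where "S = bnorm2 p \<beta> k (tseq p \<beta> z v k)"
  have "2 / (1 + q) * (q * J + (1 - q) * S) - J = (1 - q) / (1 + q) * (2 * S - J)"
    using q by (simp add: field_simps)
  then have *: "weyl_wt z * (q * J + (1 - q) * S) - J = (1 - q) / (1 + q) * (2 * S - J)"
    by (simp add: weyl_wt_def q_def)
  have "weyl_wt z ^ Suc k * (q * J + (1 - q) * S) - weyl_wt z ^ k * J
      = weyl_wt z ^ k * (weyl_wt z * (q * J + (1 - q) * S) - J)"
    by (simp add: algebra_simps)
  then show ?thesis
    unfolding Jform_tseq_Suc[OF adm] weyl_summand_def q_def[symmetric] J_def[symmetric] S_def[symmetric] *
    by simp
qed

text \<open>The weighted forms increase in k, and each summand dominates the weighted form of its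
  index. If the series converges, the summands tend to 0, so no form can be positive. Conversely,
  forms bounded above by 0 bound the partial sums of the nonnegative summands.\<close>

lemma summable_weyl_iff:
  assumes adm: "admissible p \<beta>" and z: "cmod z < 1"
  shows "summable (weyl_summand p \<beta> z v) \<longleftrightarrow> (\<forall>k. Jnorm p (tseq p \<beta> z v k) \<le> 0)"
proof -
  define a where "a k = weyl_wt z ^ k * Jnorm p (tseq p \<beta> z v k)" for k
  define \<kappa> where "\<kappa> = (1 - (cmod z)\<^sup>2) / (1 + (cmod z)\<^sup>2)"
  have "(cmod z)\<^sup>2 < 1" using z by (simp add: power_less_one_iff)
  then have \<kappa>: "0 < \<kappa>" unfolding \<kappa>_def by (auto intro!: divide_pos_pos add_pos_nonneg)
  have step: "a (Suc k) - a k = \<kappa> * weyl_summand p \<beta> z v k" for k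
    using weyl_telescope[OF adm, of z k v] by (simp add: a_def \<kappa>_def)
  note nn = weyl_summand_nonneg[OF adm, of z v]
  have mono: "mono a"
    using step nn \<kappa> by (intro incseq_SucI) (metis diff_ge_0_iff_ge less_imp_le mult_nonneg_nonneg)
  have a_iff: "a k \<le> 0 \<longleftrightarrow> Jnorm p (tseq p \<beta> z v k) \<le> 0" for k
    unfolding a_def using weyl_wt_pos[of z] by (simp add: mult_le_0_iff not_le) (metis zero_less_power not_less)
  show ?thesis
  proof
    assume "summable (weyl_summand p \<beta> z v)"
    then have lim: "weyl_summand p \<beta> z v \<longlonglongrightarrow> 0" by (rule summable_LIMSEQ_zero)
    have "a k \<le> 0" for k
    proof (rule LIMSEQ_le_const[OF lim], intro exI[of _ k] allI impI)
      fix n assume "k \<le> n"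
      then have "a k \<le> a n" using mono by (simp add: mono_def)
      also have "\<dots> \<le> weyl_summand p \<beta> z v n"
        unfolding a_def weyl_summand_def using weyl_wt_pos[of z]
          Jform_le_bnorm2[OF adm, of "tseq p \<beta> z v n" n]
        by (intro mult_left_mono) auto
      finally show "a k \<le> weyl_summand p \<beta> z v n" .
    qed
    then show "\<forall>k. Jnorm p (tseq p \<beta> z v k) \<le> 0" using a_iff by blast
  next
    assume "\<forall>k. Jnorm p (tseq p \<beta> z v k) \<le> 0"
    then have neg: "a k \<le> 0" for k using a_iff by blast
    have "(\<Sum>k<n. weyl_summand p \<beta> z v k) \<le> - a 0 / \<kappa>" for n
    proof -
      have "\<kappa> * (\<Sum>k<n. weyl_summand p \<beta> z v k) = a n - a 0"
        by (simp add: sum_distrib_left step[symmetric] sum_lessThan_telescope)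
      also have "\<dots> \<le> - a 0" using neg[of n] by simp
      finally show ?thesis by (subst pos_le_divide_eq[OF \<kappa>]) (simp add: mult.commute)
    qed
    then show "summable (weyl_summand p \<beta> z v)" using nn by (intro summableI_nonneg_bounded)
  qed
qed

section \<open>Passage to the disc\<close>

text \<open>Vectors are functions on the natural numbers, as in \<open>qform\<close>; only
  coordinates below the column count enter.\<close>

definition mapp :: "complex mat \<Rightarrow> (nat \<Rightarrow> complex) \<Rightarrow> nat \<Rightarrow> complex" where
  "mapp A x a = (\<Sum>b<dim_col A. A $$ (a,b) * x b)"

lemma mapp_mult:
  assumes "A \<in> carrier_mat n m" "B \<in> carrier_mat m k" "a < n"
  shows "mapp (A * B) x a = mapp A (mapp B x) a"
proof -
  have "mapp (A * B) x a = (\<Sum>b<k. \<Sum>c<m. A $$ (a,c) * (B $$ (c,b) * x b))"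
    unfolding mapp_def using assms
    by (auto simp: mat_mult_entry sum_distrib_right mult.assoc simp del: index_mult_mat(1) intro!: sum.cong)
  also have "\<dots> = (\<Sum>c<m. \<Sum>b<k. A $$ (a,c) * (B $$ (c,b) * x b))" by (rule sum.swap)
  also have "\<dots> = mapp A (mapp B x) a" using assms by (simp add: mapp_def sum_distrib_left)
  finally show ?thesis .
qed

lemma mapp_cong: "A \<in> carrier_mat n m \<Longrightarrow> (\<And>b. b < m \<Longrightarrow> x b = y b) \<Longrightarrow> mapp A x a = mapp A y a"
  unfolding mapp_def by (intro sum.cong) auto

lemma mapp_minus:
  "A \<in> carrier_mat n m \<Longrightarrow> B \<in> carrier_mat n m \<Longrightarrow> a < n \<Longrightarrow> mapp (A - B) x a = mapp A x a - mapp B x a"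
  by (auto simp: mapp_def sum_subtractf left_diff_distrib)

lemma mapp_smult: "A \<in> carrier_mat n m \<Longrightarrow> a < n \<Longrightarrow> mapp (\<mu> \<cdot>\<^sub>m A) x a = \<mu> * mapp A x a"
  by (auto simp: mapp_def sum_distrib_left mult.assoc)

lemma mapp_scale: "mapp A (\<lambda>c. \<mu> * x c) a = \<mu> * mapp A x a"
  by (simp add: mapp_def sum_distrib_left algebra_simps)

lemma qform_mapp: "A \<in> carrier_mat n n \<Longrightarrow> qform A x = (\<Sum>a<n. cnj (x a) * mapp A x a)"
  by (simp add: qform_def mapp_def sum_distrib_left mult.assoc)

lemma qform_congruence:
  assumes X: "X \<in> carrier_mat m n" and C: "C \<in> carrier_mat m m"
  shows "qform (adj X * C * X) x = qform C (mapp X x)"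
proof -
  have aX: "adj X \<in> carrier_mat n m" using X by simp
  have "adj X * C * X \<in> carrier_mat n n" using X C aX by (metis mult_carrier_mat)
  then have "qform (adj X * C * X) x = (\<Sum>a<n. cnj (x a) * mapp (adj X * C * X) x a)"
    by (rule qform_mapp)
  also have "\<dots> = (\<Sum>a<n. \<Sum>c<m. cnj (X $$ (c,a)) * cnj (x a) * mapp C (mapp X x) c)"
  proof (rule sum.cong[OF refl])
    fix a assume "a \<in> {..<n}"
    then have a: "a < n" by simp
    have "mapp (adj X * C * X) x a = mapp (adj X) (mapp C (mapp X x)) a"
    proof -
      have "mapp (adj X * C * X) x a = mapp (adj X * C) (mapp X x) a"
        using a by (intro mapp_mult[OF mult_carrier_mat[OF aX C] X])
      also have "\<dots> = mapp (adj X) (mapp C (mapp X x)) a"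
        using C aX a by (intro mapp_mult[of _ n m _ m])
      finally show ?thesis .
    qed
    then show "cnj (x a) * mapp (adj X * C * X) x a
        = (\<Sum>c<m. cnj (X $$ (c,a)) * cnj (x a) * mapp C (mapp X x) c)"
      using a X aX by (simp add: mapp_def[of "adj X"] adj_entry sum_distrib_left algebra_simps)
  qed
  also have "\<dots> = (\<Sum>c<m. \<Sum>a<n. cnj (X $$ (c,a)) * cnj (x a) * mapp C (mapp X x) c)"
    by (rule sum.swap)
  also have "\<dots> = (\<Sum>c<m. cnj (mapp X x c) * mapp C (mapp X x) c)"
    using X by (simp add: mapp_def[of X] cnj_sum sum_distrib_right)
  also have "\<dots> = qform C (mapp X x)" using C by (simp add: qform_mapp)
  finally show ?thesis .
qed

lemma Kmat_carrier[simp]: "Kmat p \<in> carrier_mat (2*p) (2*p)" by (simp add: Kmat_def)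
lemma jmat_carrier[simp]: "jmat p \<in> carrier_mat (2*p) (2*p)" by (simp add: jmat_def)

lemma Jmat_mult_entry:
  assumes "A \<in> carrier_mat (2*p) n" "c < 2*p" "i < n"
  shows "(Jmat p * A) $$ (c,i) = A $$ (swap_half p c, i)"
proof -
  have "(Jmat p * A) $$ (c,i) = (\<Sum>d<2*p. (if d = swap_half p c then 1 else 0) * A $$ (d,i))"
    using assms by (subst mat_mult_entry[of _ "2*p" "2*p" _ n])
      (auto simp: Jmat_entry intro!: sum.cong)
  then show ?thesis using assms by (simp add: swap_half_lt if_distrib if_distribR cong: if_cong)
qed

text \<open>K diagonalises J; together with unitarity this is K j K^* = J.\<close>

lemma Kmat_jmat: "Kmat p * jmat p = Jmat p * Kmat p"
proof (rule eq_matI)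
  fix i j assume "i < dim_row (Jmat p * Kmat p)" "j < dim_col (Jmat p * Kmat p)"
  then have ij: "i < 2*p" "j < 2*p" by (auto simp: Jmat_def Kmat_def)
  have "(Kmat p * jmat p) $$ (i,j) = (\<Sum>c<2*p. if c = j then Kmat p $$ (i,j) * (if j < p then 1 else -1) else 0)"
    unfolding mat_mult_entry[OF Kmat_carrier jmat_carrier ij]
    using ij by (intro sum.cong) (auto simp: jmat_def)
  also have "\<dots> = Kmat p $$ (i,j) * (if j < p then 1 else -1)" using ij by simp
  also have "\<dots> = Kmat p $$ (swap_half p i, j)"
    using ij by (auto simp: Kmat_def swap_half_def le_mod_geq)
  finally show "(Kmat p * jmat p) $$ (i,j) = (Jmat p * Kmat p) $$ (i,j)"
    using ij by (simp add: Jmat_mult_entry[of _ _ "2*p"] del: index_mult_mat)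
qed (auto simp: Jmat_def Kmat_def jmat_def)

lemma Kmat_unitary: "adj (Kmat p) * Kmat p = 1\<^sub>m (2*p)"
proof (rule eq_matI)
  fix i j assume "i < dim_row (1\<^sub>m (2*p) :: complex mat)" "j < dim_col (1\<^sub>m (2*p) :: complex mat)"
  then have ij: "i < 2*p" "j < 2*p" by auto
  then have p: "0 < p" by simp
  define r where "r = 1 / complex_of_real (sqrt 2)"
  have r2: "r * r = 1/2" "cnj r = r"
    unfolding r_def by (auto simp flip: of_real_mult)
  \<comment> \<open>Column i of K has exactly two nonzero entries, one in each half, in the rows i
    mod p and i mod p + p.\<close>
  have K: "Kmat p $$ (c,i) = (if c = i mod p then (if p \<le> i then - r else r) else 0)"
      "Kmat p $$ (c + p,i) = (if c = i mod p then r else 0)" if "c < p" "i < 2*p" for c i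
    using that by (auto simp: Kmat_def r_def)
  have "(adj (Kmat p) * Kmat p) $$ (i,j) = (\<Sum>c<2*p. cnj (Kmat p $$ (c,i)) * Kmat p $$ (c,j))"
    using ij by (subst mat_mult_entry[of _ "2*p" "2*p" _ "2*p"]) (auto simp: adj_entry[of _ "2*p" "2*p"]
        intro!: sum.cong)
  also have "\<dots> = (\<Sum>c<p. cnj (Kmat p $$ (c,i)) * Kmat p $$ (c,j)) + (\<Sum>c<p. cnj (Kmat p $$ (c+p,i))
      * Kmat p $$ (c+p,j))"
    by (rule sum_lessThan_double)
  also have "\<dots> = (\<Sum>c<p. if c = i mod p then (if i mod p = j mod p then (if p \<le> i \<longleftrightarrow> p
      \<le> j then 1/2 else -1/2) else 0) else 0)
      + (\<Sum>c<p. if c = i mod p then (if i mod p = j mod p then 1/2 else 0) else 0)"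
    by (intro arg_cong2[of _ _ _ _ "(+)"] sum.cong) (auto simp: K ij r2)
  also have "\<dots> = (if i mod p = j mod p \<and> (p \<le> i \<longleftrightarrow> p \<le> j) then 1 else 0)"
    using p by auto
  also have "\<dots> = 1\<^sub>m (2*p) $$ (i,j)"
  proof -
    have "i mod p = j mod p \<and> (p \<le> i \<longleftrightarrow> p \<le> j) \<longleftrightarrow> i = j"
      using ij by (auto simp: le_mod_geq)
    then show ?thesis using ij by simp
  qed
  finally show "(adj (Kmat p) * Kmat p) $$ (i,j) = 1\<^sub>m (2*p) $$ (i,j)" .
qed (auto simp: adj_def Kmat_def)

lemma Kmat_unitary': "Kmat p * adj (Kmat p) = 1\<^sub>m (2*p)"
  by (rule mat_mult_left_right_inverse[OF _ _ Kmat_unitary]) auto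

section \<open>Conjugation by K and the passage from l to z\<close>

definition Dmat :: "nat \<Rightarrow> (nat \<Rightarrow> complex mat) \<Rightarrow> nat \<Rightarrow> complex mat" where
  "Dmat p \<beta> k = 2 \<cdot>\<^sub>m (adj (\<beta> k) * \<beta> k) - Jmat p"

text \<open>Conjugation by K replaces j by J and C_k by \<open>Dmat\<close>, so the solution acts on
  the space whose form is \<open>Jform\<close>.\<close>

definition Vsol :: "nat \<Rightarrow> (nat \<Rightarrow> complex mat) \<Rightarrow> complex \<Rightarrow> nat \<Rightarrow> complex mat" where
  "Vsol p \<beta> l k = Kmat p * Wsol p \<beta> l k * adj (Kmat p)"

lemma jmat_conv: "jmat p = adj (Kmat p) * Jmat p * Kmat p"
proof -
  have "adj (Kmat p) * Jmat p * Kmat p = adj (Kmat p) * (Kmat p * jmat p)"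
    unfolding Kmat_jmat by (rule assoc_mult_mat[of _ "2*p" "2*p" _ "2*p" _ "2*p"]) auto
  also have "\<dots> = adj (Kmat p) * Kmat p * jmat p"
    by (rule assoc_mult_mat[of _ "2*p" "2*p" _ "2*p" _ "2*p", symmetric]) auto
  also have "\<dots> = jmat p" unfolding Kmat_unitary by (rule left_mult_one_mat[OF jmat_carrier])
  finally show ?thesis ..
qed

lemma Cmat_conv:
  assumes b: "\<beta> k \<in> carrier_mat p (2*p)"
  shows "Cmat p \<beta> k = adj (Kmat p) * Dmat p \<beta> k * Kmat p"
proof -
  let ?K = "Kmat p" and ?B = "adj (\<beta> k) * \<beta> k"
  have B: "?B \<in> carrier_mat (2*p) (2*p)" using b by (metis adj_carrier mult_carrier_mat)
  have cm: "X * Y \<in> carrier_mat (2*p) (2*p)" if "X \<in> carrier_mat (2*p) (2*p)" "Y \<in> carrier_mat (2*p) (2*p)"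
      for X Y :: "complex mat"
    using that by (rule mult_carrier_mat)
  have "adj ?K * (2 \<cdot>\<^sub>m ?B - Jmat p) * ?K = (adj ?K * (2 \<cdot>\<^sub>m ?B) - adj ?K * Jmat p) * ?K"
    using B by (subst mult_minus_distrib_mat[of _ "2*p" "2*p" _ "2*p"]) auto
  also have "\<dots> = adj ?K * (2 \<cdot>\<^sub>m ?B) * ?K - adj ?K * Jmat p * ?K"
    using B by (subst minus_mult_distrib_mat[of _ "2*p" "2*p" _ _ "2*p"]) (auto intro!: cm)
  also have "adj ?K * (2 \<cdot>\<^sub>m ?B) * ?K = 2 \<cdot>\<^sub>m (adj ?K * ?B * ?K)"
    using B 
    by (subst mult_smult_distrib[of _ "2*p" "2*p" _ "2*p"], simp, simp)
       (subst mult_smult_assoc_mat[of _ "2*p" "2*p" _ "2*p"], auto intro!: cm)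
  also have "adj ?K * ?B = adj ?K * adj (\<beta> k) * \<beta> k"
    using b by (subst assoc_mult_mat[of _ "2*p" "2*p" _ p _ "2*p"]) auto
  finally show ?thesis unfolding Dmat_def Cmat_def jmat_conv ..
qed

lemma Dmat_carrier[simp]: "Dmat p \<beta> k \<in> carrier_mat (2*p) (2*p)"
  by (simp add: Dmat_def Jmat_def minus_mat_def)

lemma Cmat_carrier[simp]: "Cmat p \<beta> k \<in> carrier_mat (2*p) (2*p)"
  by (simp add: Cmat_def minus_mat_def jmat_def)

lemma Wsol_carrier[simp]: "Wsol p \<beta> l k \<in> carrier_mat (2*p) (2*p)"
proof (induction k)
  case (Suc k)
  have "jmat p * Cmat p \<beta> k * Wsol p \<beta> l k \<in> carrier_mat (2*p) (2*p)"
    by (rule mult_carrier_mat[OF mult_carrier_mat[OF jmat_carrier Cmat_carrier] Suc])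
  then show ?case unfolding Wsol.simps by (intro minus_carrier_mat smult_carrier_mat)
qed simp

lemma Vsol_carrier[simp]: "Vsol p \<beta> l k \<in> carrier_mat (2*p) (2*p)"
  unfolding Vsol_def
  by (rule mult_carrier_mat[OF mult_carrier_mat[OF Kmat_carrier Wsol_carrier] adj_carrier[OF Kmat_carrier]])

lemma Vsol_0: "Vsol p \<beta> l 0 = 1\<^sub>m (2*p)"
  unfolding Vsol_def by (simp add: right_mult_one_mat[OF Kmat_carrier] Kmat_unitary')

lemma Vsol_Suc:
  assumes b: "\<beta> k \<in> carrier_mat p (2*p)"
  shows "Vsol p \<beta> l (Suc k) = Vsol p \<beta> l k - (\<i> / l) \<cdot>\<^sub>m (Jmat p * (Dmat p \<beta> k * Vsol p \<beta> l k))"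
proof -
  let ?m = "2*p"
  let ?K = "Kmat p" and ?D = "Dmat p \<beta> k" and ?W = "Wsol p \<beta> l k"
  let ?c = "\<lambda>X. X \<in> carrier_mat ?m ?m"
  note as = assoc_mult_mat[of _ ?m ?m _ ?m _ ?m]
  have c: "?c ?K" "?c (adj ?K)" "?c ?D" "?c ?W" "?c (Jmat p)" "?c (jmat p)" "?c (Cmat p \<beta> k)"
    by auto
  have cm: "?c (A * B)" if "?c A" "?c B" for A B using that by (rule mult_carrier_mat)
  have "?K * (jmat p * Cmat p \<beta> k * ?W) * adj ?K
      = (?K * jmat p) * (adj ?K * (?D * (?K * ?W * adj ?K)))"
    unfolding Cmat_conv[of \<beta> k p, OF b] by (simp only: as c cm)
  also have "\<dots> = Jmat p * (?K * adj ?K) * (?D * (?K * ?W * adj ?K))"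
    unfolding Kmat_jmat by (simp only: as c cm)
  also have "\<dots> = Jmat p * (?D * Vsol p \<beta> l k)"
    unfolding Kmat_unitary' Vsol_def by (simp only: right_mult_one_mat[OF c(5)])
  finally have 1: "?K * (jmat p * Cmat p \<beta> k * ?W) * adj ?K = Jmat p * (?D * Vsol p \<beta> l k)" .
  let ?X = "jmat p * Cmat p \<beta> k * ?W"
  have X: "?c ?X" using c cm by blast
  have "Vsol p \<beta> l (Suc k) = (?K * ?W - ?K * ((\<i> / l) \<cdot>\<^sub>m ?X)) * adj ?K"
    unfolding Vsol_def using c X by (simp add: mult_minus_distrib_mat[of _ ?m ?m _ ?m] del: assoc_mult_mat)
  also have "\<dots> = ?K * ?W * adj ?K - ?K * ((\<i> / l) \<cdot>\<^sub>m ?X) * adj ?K"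
    using c X by (intro minus_mult_distrib_mat[of _ ?m ?m _ _ ?m] cm smult_carrier_mat)
  also have "?K * ((\<i> / l) \<cdot>\<^sub>m ?X) = (\<i> / l) \<cdot>\<^sub>m (?K * ?X)"
    using c X by (intro mult_smult_distrib[of _ ?m ?m _ ?m]) auto
  also have "(\<i> / l) \<cdot>\<^sub>m (?K * ?X) * adj ?K = (\<i> / l) \<cdot>\<^sub>m (?K * ?X * adj ?K)"
    using c X by (intro mult_smult_assoc_mat[of _ ?m ?m _ ?m] cm)
  finally show ?thesis unfolding 1 Vsol_def .
qed

text \<open>The vector [-F; I] x. For F = i \<phi> it is \<open>colvec\<close> of \<phi> applied to
  x.\<close>

definition vinit :: "nat \<Rightarrow> complex mat \<Rightarrow> (nat \<Rightarrow> complex) \<Rightarrow> nat \<Rightarrow> complex" where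
  "vinit p F x c = (if c < p then - (\<Sum>j<p. F $$ (c,j) * x j) else x (c - p))"

lemma colvec_carrier[simp]: "colvec p F \<in> carrier_mat (2*p) p"
  by (simp add: colvec_def)

lemma mapp_colvec:
  assumes F: "F \<in> carrier_mat p p" and c: "c < 2*p"
  shows "mapp (colvec p F) x c = vinit p (\<i> \<cdot>\<^sub>m F) x c"
proof (cases "c < p")
  case True
  then show ?thesis using F c
    by (auto simp: mapp_def vinit_def colvec_def sum_negf[symmetric] intro!: sum.cong)
next
  case False
  have "mapp (colvec p F) x c = (\<Sum>b<p. if b = c - p then x b else 0)"
    using F c False unfolding mapp_def colvec_def by (intro sum.cong) auto
  then show ?thesis using False c by (simp add: vinit_def)
qed

lemma mapp_Jmat: "c < 2*p \<Longrightarrow> mapp (Jmat p) t c = t (swap_half p c)"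
proof -
  assume c: "c < 2*p"
  have "mapp (Jmat p) t c = (\<Sum>d<2*p. (if d = swap_half p c then t d else 0))"
    using c unfolding mapp_def
        by (intro sum.cong) (auto simp: Jmat_entry Jmat_def[THEN arg_cong[of _ _ dim_col]])
  then show ?thesis using c by (simp add: swap_half_lt)
qed

lemma mapp_Dmat:
  assumes b: "\<beta> k \<in> carrier_mat p (2*p)" and c: "c < 2*p"
  shows "mapp (Dmat p \<beta> k) t c = 2 * (\<Sum>i<p. cnj (brow p \<beta> (k*p+i) c) * bval p \<beta> (k*p+i) t) - t (swap_half p c)"
proof -
  have cs: "adj (\<beta> k) * \<beta> k \<in> carrier_mat (2*p) (2*p)" "adj (\<beta> k) \<in> carrier_mat (2*p) p"
    using b by (auto intro: mult_carrier_mat)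
  have 1: "mapp (\<beta> k) t i = bval p \<beta> (k*p+i) t" if "i < p" for i
    using that b by (simp add: mapp_def bval_def brow_def)
  have "mapp (adj (\<beta> k) * \<beta> k) t c = mapp (adj (\<beta> k)) (mapp (\<beta> k) t) c"
    by (rule mapp_mult[OF cs(2) b c])
  also have "\<dots> = (\<Sum>i<p. cnj (brow p \<beta> (k*p+i) c) * bval p \<beta> (k*p+i) t)"
    using b c cs(2) by (simp add: mapp_def[of "adj (\<beta> k)"] adj_entry brow_def 1)
  finally have 2: "mapp (adj (\<beta> k) * \<beta> k) t c = (\<Sum>i<p. cnj (brow p \<beta> (k*p+i) c) * bval p \<beta> (k*p+i) t)" .
  have "mapp (Dmat p \<beta> k) t c = mapp (2 \<cdot>\<^sub>m (adj (\<beta> k) * \<beta> k)) t c - mapp (Jmat p) t c"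
    unfolding Dmat_def using cs c by (intro mapp_minus[of _ "2*p" "2*p"]) auto
  also have "mapp (2 \<cdot>\<^sub>m (adj (\<beta> k) * \<beta> k)) t c = 2 * mapp (adj (\<beta> k) * \<beta> k) t c"
    using cs c by (intro mapp_smult[of _ "2*p" "2*p"]) auto
  finally show ?thesis unfolding 2 mapp_Jmat[OF c] .
qed

lemma qform_Dmat:
  assumes b: "\<beta> k \<in> carrier_mat p (2*p)"
  shows "qform (Dmat p \<beta> k) t = of_real (2 * bnorm2 p \<beta> k t - Jnorm p t)"
proof -
  have "qform (Dmat p \<beta> k) t
    = (\<Sum>c<2*p. 2 * (\<Sum>i<p. cnj (t c) * cnj (brow p \<beta> (k*p+i) c) * bval p \<beta> (k*p+i) t) - t (swap_half p c)
        * cnj (t c))"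
    unfolding qform_mapp[OF Dmat_carrier]
    by (intro sum.cong) (auto simp: mapp_Dmat[of \<beta> k p, OF b] right_diff_distrib sum_distrib_left algebra_simps)
  also have "\<dots> = 2 * (\<Sum>c<2*p. \<Sum>i<p. cnj (t c) * cnj (brow p \<beta> (k*p+i) c) * bval p \<beta> (k*p+i) t) - Jform p t t"
    by (simp only: sum_subtractf sum_distrib_left[symmetric] Jform_def)
  also have "(\<Sum>c<2*p. \<Sum>i<p. cnj (t c) * cnj (brow p \<beta> (k*p+i) c) * bval p \<beta> (k*p+i) t)
     = (\<Sum>i<p. \<Sum>c<2*p. cnj (t c) * cnj (brow p \<beta> (k*p+i) c) * bval p \<beta> (k*p+i) t)"
    by (rule sum.swap)
  also have "\<dots> = of_real (bnorm2 p \<beta> k t)"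
    unfolding bnorm2_def of_real_sum complex_norm_square
    by (intro sum.cong refl) (simp add: bval_def cnj_sum sum_distrib_left sum_distrib_right algebra_simps)
  finally show ?thesis using Jform_real[of p t] by simp
qed

lemma bproj_conv: "c < 2*p \<Longrightarrow> bproj p \<beta> k t c
    = (\<Sum>i<p. cnj (brow p \<beta> (k*p+i) (swap_half p c)) * bval p \<beta> (k*p+i) t)"
  by (simp add: bproj_def bdual_def)

lemma disc_ne: "cmod z < 1 \<Longrightarrow> z + 1 \<noteq> 0" "cmod z < 1 \<Longrightarrow> z - 1 \<noteq> 0"
  by (metis eq_neg_iff_add_eq_0 less_irrefl norm_minus_cancel norm_one) auto

lemma mapp_Vsol:
  assumes adm: "admissible p \<beta>" and z: "cmod z < 1" and l: "l = \<i> * (z + 1) / (z - 1)"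
  shows "c < 2*p \<Longrightarrow> mapp (Vsol p \<beta> l k) v c = (2 / (z + 1)) ^ k * tseq p \<beta> z v k c"
proof (induction k arbitrary: c)
  case 0
  have "mapp (Vsol p \<beta> l 0) v c = (\<Sum>b<2*p. if b = c then v b else 0)"
    using 0 unfolding Vsol_0 mapp_def by (intro sum.cong) auto
  then show ?case using 0 by simp
next
  case (Suc k)
  let ?V = "Vsol p \<beta> l k" and ?D = "Dmat p \<beta> k" and ?t = "tseq p \<beta> z v k" and ?m = "2*p" and ?s
      = "(2 / (z + 1)) ^ k"
  have b: "\<beta> k \<in> carrier_mat p (2*p)" using adm by (simp add: admissible_def)
  have z1: "z + 1 \<noteq> 0" "z - 1 \<noteq> 0"
    using disc_ne[OF z] by auto
  have il: "\<i> / l = (z - 1) / (z + 1)" using z1 unfolding l by (simp add: divide_divide_eq_right)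
  have DV: "?D * ?V \<in> carrier_mat ?m ?m" by (rule mult_carrier_mat[OF Dmat_carrier Vsol_carrier])
  have JDV: "Jmat p * (?D * ?V) \<in> carrier_mat ?m ?m" by (rule mult_carrier_mat[OF Jmat_carrier DV])
  have "mapp (Vsol p \<beta> l (Suc k)) v c = mapp ?V v c - (\<i> / l) * mapp (Jmat p * (?D * ?V)) v c"
    unfolding Vsol_Suc[of \<beta> k p, OF b] using JDV Suc.prems
    by (simp add: mapp_minus[of _ ?m ?m] mapp_smult[of _ ?m ?m])
  also have "mapp (Jmat p * (?D * ?V)) v c = mapp (?D * ?V) v (swap_half p c)"
    using Suc.prems by (simp only: mapp_mult[OF Jmat_carrier DV] mapp_Jmat)
  also have "\<dots> = mapp ?D (mapp ?V v) (swap_half p c)"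
    using Suc.prems by (intro mapp_mult[OF Dmat_carrier Vsol_carrier]) (simp add: swap_half_lt)
  also have "\<dots> = mapp ?D (\<lambda>c. ?s * ?t c) (swap_half p c)"
    by (rule mapp_cong[OF Dmat_carrier]) (rule Suc.IH)
  also have "\<dots> = ?s * mapp ?D ?t (swap_half p c)" by (rule mapp_scale)
  also have "mapp ?D ?t (swap_half p c) = 2 * bproj p \<beta> k ?t c - ?t c"
    using Suc.prems by (subst mapp_Dmat[of \<beta> k p, OF b]) (auto simp: swap_half_lt swap_half_swap_half
        bproj_conv)
  also have "mapp ?V v c = ?s * ?t c" by (rule Suc.IH[OF Suc.prems])
  also have "?s * ?t c - (\<i> / l) * (?s * (2 * bproj p \<beta> k ?t c - ?t c))
     = ?s * (2 / (z + 1)) * (z * ?t c + (1 - z) * bproj p \<beta> k ?t c)"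
  proof -
    have "?t c - (\<i> / l) * (2 * bproj p \<beta> k ?t c - ?t c)
        = (2 / (z + 1)) * (z * ?t c + (1 - z) * bproj p \<beta> k ?t c)"
      unfolding il using z1(1) by (simp add: divide_simps) (simp add: algebra_simps)
    then have "?s * (?t c - (\<i> / l) * (2 * bproj p \<beta> k ?t c - ?t c))
        = ?s * ((2 / (z + 1)) * (z * ?t c + (1 - z) * bproj p \<beta> k ?t c))"
      by (rule arg_cong)
    then show ?thesis by (simp only: right_diff_distrib mult.assoc mult.left_commute)
  qed
  finally show ?case by (simp add: mult.commute)
qed

text \<open>Each term is a congruence X^* D X up to a scalar, so its quadratic form at x is that of
  \<open>Dmat\<close> at X x, and only a vector sequence has to be followed.\<close>

lemma weyl_term_conv:
  assumes adm: "admissible p \<beta>"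
  shows "weyl_term p \<beta> \<phi> l k = complex_of_real (qfun l ^ k) \<cdot>\<^sub>m
    (adj (Vsol p \<beta> l k * colvec p (\<phi> l)) * Dmat p \<beta> k * (Vsol p \<beta> l k * colvec p (\<phi> l)))"
proof -
  let ?m = "2*p" and ?c = "colvec p (\<phi> l)"
  let ?K = "Kmat p" and ?D = "Dmat p \<beta> k" and ?W = "Wsol p \<beta> l k"
  have b: "\<beta> k \<in> carrier_mat p (2*p)" using adm by (simp add: admissible_def)
  let ?s = "\<lambda>X. X \<in> carrier_mat ?m ?m"
  note as = assoc_mult_mat[of _ ?m ?m _ ?m _ ?m]
  note as' = assoc_mult_mat[of _ p ?m _ ?m _ ?m] assoc_mult_mat[of _ p ?m _ ?m _ p] assoc_mult_mat[of _ ?m ?m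
      _ ?m _ p]
  have c: "?s ?K" "?s (adj ?K)" "?s ?D" "?s ?W" "?s (adj ?W)" "?c \<in> carrier_mat ?m p" "adj ?c \<in> carrier_mat p
      ?m"
    by auto
  have cm: "?s (A * B)" if "?s A" "?s B" for A B using that by (rule mult_carrier_mat)
  have cm2: "A * B \<in> carrier_mat ?m p" if "?s A" "B \<in> carrier_mat ?m p" for A B using that
      by (rule mult_carrier_mat)
  have "adj (Vsol p \<beta> l k * ?c) = adj ?c * adj (Vsol p \<beta> l k)"
    by (rule adj_mult[OF Vsol_carrier colvec_carrier])
  also have "adj (Vsol p \<beta> l k) = adj (adj ?K) * adj (?K * ?W)"
    unfolding Vsol_def by (rule adj_mult[of _ ?m ?m _ ?m]) (use c in \<open>auto intro!: cm\<close>)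
  also have "adj (?K * ?W) = adj ?W * adj ?K" by (rule adj_mult[of _ ?m ?m _ ?m]) (use c in auto)
  finally have 1: "adj (Vsol p \<beta> l k * ?c) = adj ?c * (?K * (adj ?W * adj ?K))" by simp
  show ?thesis
    unfolding weyl_term_def Cmat_conv[of \<beta> k p, OF b] 1 unfolding Vsol_def by (simp only: as as' c cm cm2)
qed

lemma qfun_weyl_wt:
  assumes z: "cmod z < 1"
  shows "qfun (\<i> * (z + 1) / (z - 1)) * (cmod (2 / (z + 1)))\<^sup>2 = weyl_wt z"
proof -
  have z1: "z + 1 \<noteq> 0" "z - 1 \<noteq> 0" using disc_ne[OF z] by auto
  \<comment> \<open>The parallelogram law is what makes the weight depend on |z| alone.\<close>
  have s: "(cmod (z + 1))\<^sup>2 + (cmod (z - 1))\<^sup>2 = 2 * (1 + (cmod z)\<^sup>2)"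
    unfolding cmod_power2 by (simp add: power2_eq_square algebra_simps)
  define A where "A = (cmod (z + 1))\<^sup>2"
  define B where "B = (cmod (z - 1))\<^sup>2"
  have AB: "A > 0" "B > 0" using z1 by (auto simp: A_def B_def)
  have "qfun (\<i> * (z + 1) / (z - 1)) * (cmod (2 / (z + 1)))\<^sup>2 = (A / B) / (A / B + 1) * (4 / A)"
    by (simp add: qfun_def norm_divide norm_mult power_divide A_def B_def)
  also have "\<dots> = 4 / (A + B)" using AB by (simp add: divide_simps)
  also have "A + B = 2 * (1 + (cmod z)\<^sup>2)" using s unfolding A_def B_def .
  also have "4 / (2 * (1 + (cmod z)\<^sup>2)) = weyl_wt z" 
  proof -
    have "4 / (2 * X) = 2 / X" for X :: real by simp
    then show ?thesis unfolding weyl_wt_def .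
  qed
  finally show ?thesis .
qed

lemma qform_smult: "qform (\<mu> \<cdot>\<^sub>m A) x = \<mu> * qform A x" if "A \<in> carrier_mat n n"
  using that by (simp add: qform_def sum_distrib_left algebra_simps)

lemma qform_cong: "A \<in> carrier_mat n n \<Longrightarrow> (\<And>c. c < n \<Longrightarrow> x c = y c) \<Longrightarrow> qform A x = qform A y"
  unfolding qform_def by (intro sum.cong) auto

lemma qform_weyl_term:
  assumes adm: "admissible p \<beta>" and z: "cmod z < 1" and l: "l = \<i> * (z + 1) / (z - 1)"
    and F: "\<phi> l \<in> carrier_mat p p"
  shows "qform (weyl_term p \<beta> \<phi> l k) x = of_real (weyl_summand p \<beta> z (vinit p (Ftrans \<phi> z) x) k)"
proof -
  let ?m = "2*p" and ?c = "colvec p (\<phi> l)"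
  let ?V = "Vsol p \<beta> l k" and ?D = "Dmat p \<beta> k" and ?v = "vinit p (Ftrans \<phi> z) x"
  define s where "s = (2 / (z + 1)) ^ k"
  let ?t = "tseq p \<beta> z ?v k"
  have b: "\<beta> k \<in> carrier_mat p (2*p)" using adm by (simp add: admissible_def)
  have Vc: "?V * ?c \<in> carrier_mat ?m p" by (rule mult_carrier_mat[OF Vsol_carrier colvec_carrier])
  have "qform (weyl_term p \<beta> \<phi> l k) x = of_real (qfun l ^ k) * qform (adj (?V * ?c) * ?D * (?V * ?c)) x"
    unfolding weyl_term_conv[OF adm]
    by (rule qform_smult, rule mult_carrier_mat[OF mult_carrier_mat[OF adj_carrier[OF Vc] Dmat_carrier] Vc])
  also have "qform (adj (?V * ?c) * ?D * (?V * ?c)) x = qform ?D (mapp (?V * ?c) x)"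
    by (rule qform_congruence[OF Vc Dmat_carrier])
  also have "\<dots> = qform ?D (\<lambda>c. s * ?t c)"
  proof (rule qform_cong[OF Dmat_carrier])
    fix c assume c: "c < 2*p"
    have "mapp (?V * ?c) x c = mapp ?V (mapp ?c x) c" by (rule mapp_mult[OF Vsol_carrier colvec_carrier c])
    also have "\<dots> = mapp ?V ?v c"
      by (rule mapp_cong[OF Vsol_carrier]) (simp add: mapp_colvec[OF F] Ftrans_def l[symmetric])
    also have "\<dots> = s * ?t c" unfolding s_def by (rule mapp_Vsol[OF adm z l c])
    finally show "mapp (?V * ?c) x c = s * ?t c" .
  qed
  also have "\<dots> = of_real ((cmod s)\<^sup>2) * qform ?D ?t"
    unfolding complex_norm_square qform_def sum_distrib_left by (intro sum.cong) (auto simp: algebra_simps)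
  also have "of_real (qfun l ^ k) * (of_real ((cmod s)\<^sup>2) * qform ?D ?t)
      = of_real (weyl_wt z ^ k) * qform ?D ?t"
  proof -
    have "qfun l ^ k * (cmod s)\<^sup>2 = (qfun l * (cmod (2 / (z + 1)))\<^sup>2) ^ k"
      unfolding s_def norm_power by (simp add: power_mult_distrib power_mult[symmetric] mult.commute)
    then have "qfun l ^ k * (cmod s)\<^sup>2 = weyl_wt z ^ k" unfolding l qfun_weyl_wt[OF z] .
    then show ?thesis by (metis mult.assoc of_real_mult)
  qed
  finally show ?thesis unfolding qform_Dmat[of \<beta> k p, OF b] weyl_summand_def by simp
qed

lemma mobius_in_lower_hp:
  assumes z: "cmod z < 1"
  shows "\<i> * (z + 1) / (z - 1) \<in> lower_hp"
proof -
  have "(cmod z)\<^sup>2 < 1" using z by (simp add: power_less_one_iff)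
  then have *: "(Re z)\<^sup>2 + (Im z)\<^sup>2 < 1" by (simp add: cmod_power2)
  have "z - 1 \<noteq> 0" using disc_ne[OF z] by simp
  then have d: "0 < (Re (z - 1))\<^sup>2 + (Im (z - 1))\<^sup>2"
    using complex_neq_0 by blast
  have "Im (\<i> * (z + 1) / (z - 1)) = ((Re z)\<^sup>2 + (Im z)\<^sup>2 - 1) / ((Re (z - 1))\<^sup>2 + (Im (z - 1))\<^sup>2)"
    by (simp add: Im_divide power2_eq_square algebra_simps)
  then show ?thesis unfolding lower_hp_def using * d by (simp add: divide_neg_pos)
qed

lemma mobius_inverse:
  assumes l: "l \<in> lower_hp"
  defines "z \<equiv> (l + \<i>) / (l - \<i>)"
  shows "cmod z < 1" "l = \<i> * (z + 1) / (z - 1)"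
proof -
  have im: "Im l < 0" using l by (simp add: lower_hp_def)
  then have n: "l - \<i> \<noteq> 0" by (auto simp: complex_eq_iff)
  have "(cmod (l + \<i>))\<^sup>2 < (cmod (l - \<i>))\<^sup>2"
    using im unfolding cmod_power2 by (simp add: power2_eq_square algebra_simps)
  then have "cmod (l + \<i>) < cmod (l - \<i>)" by (rule power_less_imp_less_base) simp
  then show "cmod z < 1" using n by (simp add: z_def norm_divide divide_less_eq)
  have "z + 1 = 2 * l / (l - \<i>)" "z - 1 = 2 * \<i> / (l - \<i>)" using n unfolding z_def
      by (simp_all add: field_simps)
  then show "l = \<i> * (z + 1) / (z - 1)" using n by simp
qed

lemma weyl_term_carrier:
  assumes "admissible p \<beta>"
  shows "weyl_term p \<beta> \<phi> l k \<in> carrier_mat p p"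
proof -
  have Vc: "Vsol p \<beta> l k * colvec p (\<phi> l) \<in> carrier_mat (2*p) p"
    by (rule mult_carrier_mat[OF Vsol_carrier colvec_carrier])
  show ?thesis unfolding weyl_term_conv[OF assms]
    by (intro smult_carrier_mat mult_carrier_mat[OF mult_carrier_mat[OF adj_carrier[OF Vc] Dmat_carrier] Vc])
qed

lemma qform_delta:
  assumes A: "A \<in> carrier_mat p p" and ab: "a < p" "b < p" "a \<noteq> b"
  shows "qform A (\<lambda>i. if i = a then 1 else if i = b then \<omega> else 0)
    = A $$ (a,a) + \<omega> * A $$ (a,b) + cnj \<omega> * A $$ (b,a) + cnj \<omega> * \<omega> * A $$ (b,b)"
proof -
  let ?x = "\<lambda>i. if i = a then 1 else if i = b then \<omega> else 0"
  have s: "(\<Sum>i<p. g i) = g a + g b" if "\<And>i. i \<noteq> a \<Longrightarrow> i \<noteq> b \<Longrightarrow> g i = 0" for g :: "nat \<Rightarrow> complex"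
  proof -
    have "(\<Sum>i<p. g i) = (\<Sum>i\<in>{a,b}. g i)"
      using ab that by (intro sum.mono_neutral_right) auto
    then show ?thesis using ab by simp
  qed
  have "qform A ?x = (\<Sum>i<p. cnj (?x i) * (\<Sum>j<p. A $$ (i,j) * ?x j))"
    using A by (simp add: qform_def sum_distrib_left mult.assoc)
  also have "\<dots> = (\<Sum>j<p. A $$ (a,j) * ?x j) + cnj \<omega> * (\<Sum>j<p. A $$ (b,j) * ?x j)"
    using ab(3) by (subst s) auto
  finally have *: "qform A ?x = (\<Sum>j<p. A $$ (a,j) * ?x j) + cnj \<omega> * (\<Sum>j<p. A $$ (b,j) * ?x j)" .
  have "(\<Sum>j<p. A $$ (i,j) * ?x j) = A $$ (i,a) + \<omega> * A $$ (i,b)" for i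
    using ab(3) by (subst s) auto
  then show ?thesis unfolding * by (simp add: algebra_simps)
qed

lemma qform_delta1:
  assumes A: "A \<in> carrier_mat p p" and a: "a < p"
  shows "qform A (\<lambda>i. if i = a then 1 else 0) = A $$ (a,a)"
proof -
  have "(\<Sum>j<p. w * A $$ (i,j) * (if j = a then 1 else 0)) = (\<Sum>j<p. if j = a then w * A $$ (i,a) else 0)" for w i
    by (intro sum.cong) auto
  then have "qform A (\<lambda>i. if i = a then 1 else 0) = (\<Sum>i<p. cnj (if i = a then 1 else 0) * A $$ (i,a))"
    using A a by (simp add: qform_def)
  also have "\<dots> = (\<Sum>i<p. if i = a then A $$ (a,a) else 0)" by (intro sum.cong) auto
  finally show ?thesis using a by simp
qed

text \<open>This replaces convergence of a matrix series by that of scalar series of quadratic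
  forms, to which the telescoping applies. The direction from forms to entries is
  polarization.\<close>

lemma summable_entries_iff_qform:
  assumes A: "\<And>k. A k \<in> carrier_mat p p"
  shows "(\<forall>a<p. \<forall>b<p. summable (\<lambda>k. A k $$ (a,b))) \<longleftrightarrow> (\<forall>x. summable (\<lambda>k. qform (A k) x))"
proof
  assume "\<forall>a<p. \<forall>b<p. summable (\<lambda>k. A k $$ (a,b))"
  then show "\<forall>x. summable (\<lambda>k. qform (A k) x)"
    using A[THEN carrier_matD(1)] unfolding qform_def
        by (auto intro!: summable_sum summable_mult summable_mult2)
next
  assume R: "\<forall>x. summable (\<lambda>k. qform (A k) x)"
  have d: "summable (\<lambda>k. A k $$ (a,a))" if "a < p" for a
    using R[rule_format, of "\<lambda>i. if i = a then 1 else 0"] qform_delta1[OF A that] by simp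
  show "\<forall>a<p. \<forall>b<p. summable (\<lambda>k. A k $$ (a,b))"
  proof (intro allI impI)
    fix a b assume ab: "a < p" "b < p"
    show "summable (\<lambda>k. A k $$ (a,b))"
    proof (cases "a = b")
      case False
      let ?Q = "\<lambda>\<omega> k. qform (A k) (\<lambda>i. if i = a then 1 else if i = b then \<omega> else 0)"
      \<comment> \<open>Without the diagonal terms the forms for \<omega> = 1 and \<omega> = i are
        A_ab + A_ba and i (A_ab - A_ba); the combination isolates 2 A_ab.\<close>
      have "summable (\<lambda>k. (?Q 1 k - A k $$ (a,a) - A k $$ (b,b)) - \<i> * (?Q \<i> k - A k $$ (a,a) - A k $$ (b,b)))"
        using R d ab by (intro summable_diff summable_mult) auto
      then have "summable (\<lambda>k. ((?Q 1 k - A k $$ (a,a) - A k $$ (b,b)) - \<i> * (?Q \<i> k - A k $$ (a,a)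
          - A k $$ (b,b))) / 2)"
        by (rule summable_divide)
      also have "(\<lambda>k. ((?Q 1 k - A k $$ (a,a) - A k $$ (b,b)) - \<i> * (?Q \<i> k - A k $$ (a,a)
          - A k $$ (b,b))) / 2) = (\<lambda>k. A k $$ (a,b))"
        unfolding qform_delta[OF A ab False] by (auto simp: fun_eq_iff algebra_simps)
      finally show ?thesis .
    qed (use d ab in simp)
  qed
qed

text \<open>The Mobius map is a bijection of the disc onto the lower half-plane, so the convergence
  condition for all l becomes a sign condition for all z and all start vectors. From here on no Weyl
  series occurs.\<close>

lemma is_weyl_iff:
  assumes adm: "admissible p \<beta>"
  shows "is_weyl p \<beta> \<phi> \<longleftrightarrow> (\<forall>l\<in>lower_hp. \<phi> l \<in> carrier_mat p p) \<and>
     (\<forall>a<p. \<forall>b<p. (\<lambda>l. \<phi> l $$ (a,b)) holomorphic_on lower_hp) \<and>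
     (\<forall>z\<in>ball 0 1. \<forall>x k. Jnorm p (tseq p \<beta> z (vinit p (Ftrans \<phi> z) x) k) \<le> 0)"
proof -
  have 1: "(\<forall>a<p. \<forall>b<p. summable (\<lambda>k. weyl_term p \<beta> \<phi> l k $$ (a,b))) \<longleftrightarrow>
      (\<forall>x k. Jnorm p (tseq p \<beta> z (vinit p (Ftrans \<phi> z) x) k) \<le> 0)"
    if c: "\<forall>l\<in>lower_hp. \<phi> l \<in> carrier_mat p p" and z: "cmod z < 1" and l: "l = \<i> * (z + 1) / (z - 1)" for z l
  proof -
    have F: "\<phi> l \<in> carrier_mat p p" using c mobius_in_lower_hp[OF z] l by blast
    show ?thesis
      unfolding summable_entries_iff_qform[OF weyl_term_carrier[OF adm]] qform_weyl_term[where ?\<phi>=\<phi>, OF adm z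
          l F]
        summable_of_real_iff summable_weyl_iff[OF adm z] ..
  qed
  show ?thesis
  proof (intro iffI conjI)
    assume w: "is_weyl p \<beta> \<phi>"
    then have c: "\<forall>l\<in>lower_hp. \<phi> l \<in> carrier_mat p p"
        and s: "\<forall>l\<in>lower_hp. \<forall>a<p. \<forall>b<p. summable (\<lambda>k. weyl_term p \<beta> \<phi> l k $$ (a,b))"
      and h: "\<forall>a<p. \<forall>b<p. (\<lambda>l. \<phi> l $$ (a,b)) holomorphic_on lower_hp"
      by (auto simp: is_weyl_def)
    show "\<forall>l\<in>lower_hp. \<phi> l \<in> carrier_mat p p" by (rule c)
    show "\<forall>a<p. \<forall>b<p. (\<lambda>l. \<phi> l $$ (a,b)) holomorphic_on lower_hp" by (rule h)
    show "\<forall>z\<in>ball 0 1. \<forall>x k. Jnorm p (tseq p \<beta> z (vinit p (Ftrans \<phi> z) x) k) \<le> 0"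
    proof
      fix z :: complex assume "z \<in> ball 0 1"
      then have z: "cmod z < 1" by simp
      show "\<forall>x k. Jnorm p (tseq p \<beta> z (vinit p (Ftrans \<phi> z) x) k) \<le> 0"
        using 1[OF c z refl] s mobius_in_lower_hp[OF z] by blast
    qed
  next
    assume R: "(\<forall>l\<in>lower_hp. \<phi> l \<in> carrier_mat p p) \<and>
     (\<forall>a<p. \<forall>b<p. (\<lambda>l. \<phi> l $$ (a,b)) holomorphic_on lower_hp) \<and>
     (\<forall>z\<in>ball 0 1. \<forall>x k. Jnorm p (tseq p \<beta> z (vinit p (Ftrans \<phi> z) x) k) \<le> 0)"
    have "\<forall>l\<in>lower_hp. \<forall>a<p. \<forall>b<p. summable (\<lambda>k. weyl_term p \<beta> \<phi> l k $$ (a,b))"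
    proof
      fix l assume l: "l \<in> lower_hp"
      show "\<forall>a<p. \<forall>b<p. summable (\<lambda>k. weyl_term p \<beta> \<phi> l k $$ (a,b))"
        using 1[OF conjunct1[OF R] mobius_inverse[OF l]] R mobius_inverse(1)[OF l] by simp
    qed
    then show "is_weyl p \<beta> \<phi>" using R unfolding is_weyl_def by blast
  qed
qed

section \<open>Block Toeplitz matrices and the displacement equation\<close>

text \<open>The entries do not depend on N: the Toeplitz matrices of all orders are truncations of
  one infinite matrix.\<close>

definition Tent :: "nat \<Rightarrow> (nat \<Rightarrow> complex mat) \<Rightarrow> nat \<Rightarrow> nat \<Rightarrow> complex" where
  "Tent p c a b = sseq c (int (b div p) - int (a div p)) $$ (a mod p, b mod p)"

definition Pent :: "nat \<Rightarrow> (nat \<Rightarrow> complex mat) \<Rightarrow> nat \<Rightarrow> nat \<Rightarrow> complex" where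
  "Pent p c a d = (if d < p then (if a mod p = d then 1 else 0) else (\<Sum>k\<le>a div p. c k $$ (a mod p, d - p)))"

text \<open>The matrix A of the theorem is i(1/2 + A0), so that A S - S A^* = i R becomes S + A0 S + S A0^* = R.\<close>

definition A0 :: "nat \<Rightarrow> nat \<Rightarrow> nat \<Rightarrow> complex" where
  "A0 p a b = (if b div p < a div p \<and> a mod p = b mod p then 1 else 0)"

lemma toeplitz_carrier[simp]: "toeplitz p c N \<in> carrier_mat (Suc N * p) (Suc N * p)"
  by (simp add: toeplitz_def blockmat_def)

lemma Pimat_carrier[simp]: "Pimat p c N \<in> carrier_mat (Suc N * p) (2 * p)"
  by (simp add: Pimat_def blockmat_def)

lemma Amat_carrier[simp]: "Amat p N \<in> carrier_mat (Suc N * p) (Suc N * p)"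
  by (simp add: Amat_def blockmat_def)

lemma toeplitz_entry: "a < Suc N * p \<Longrightarrow> b < Suc N * p \<Longrightarrow> toeplitz p c N $$ (a,b) = Tent p c a b"
  by (simp add: toeplitz_def blockmat_def Tent_def)

lemma Pimat_entry: "a < Suc N * p \<Longrightarrow> d < 2 * p \<Longrightarrow> Pimat p c N $$ (a,d) = Pent p c a d"
proof -
  assume a: "a < Suc N * p" and d: "d < 2 * p"
  then have p: "0 < p" by (cases p) auto
  show ?thesis
  proof (cases "d < p")
    case True
    then show ?thesis using a d p by (simp add: Pimat_def blockmat_def Pent_def)
  next
    case False
    then have "d div p = 1" "d mod p = d - p" using d p
      by (auto simp: le_mod_geq le_div_geq)
    then show ?thesis using a d p False by (simp add: Pimat_def blockmat_def Pent_def msum_def)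
  qed
qed

lemma Amat_entry:
  assumes "a < Suc N * p" "b < Suc N * p"
  shows "Amat p N $$ (a,b) = \<i> * ((if a = b then 1/2 else 0) + A0 p a b)"
proof -
  have p: "0 < p" using assms by (cases p) auto
  have ab: "a = b \<longleftrightarrow> a div p = b div p \<and> a mod p = b mod p" by (metis div_mult_mod_eq)
  show ?thesis using assms p by (auto simp: Amat_def blockmat_def A0_def ab)
qed

lemma sum_blocks: "(\<Sum>c<n*p. f c) = (\<Sum>k<n. \<Sum>i<p. f (k*p+i))" for p n :: nat and f :: "nat \<Rightarrow> 'a::comm_monoid_add"
proof -
  have "sum f {k*p..<k*p+p} = (\<Sum>i<p. f (k*p+i))" for k
    using sum.shift_bounds_nat_ivl[of f 0 "k*p" p] by (simp add: lessThan_atLeast0 add.commute)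
  then show ?thesis by (simp add: sum.nat_group[symmetric])
qed

lemma sum_A0_left:
  fixes f :: "nat \<Rightarrow> complex"
  assumes "a < n * p"
  shows "(\<Sum>c<n*p. A0 p a c * f c) = (\<Sum>k<a div p. f (k*p + a mod p))"
proof -
  have p: "0 < p" using assms by (cases p) auto
  have an: "a div p \<le> n" using assms p by (simp add: div_less_iff_less_mult less_imp_le)
  have "(\<Sum>c<n*p. A0 p a c * f c) = (\<Sum>k<n. \<Sum>i<p. if i
      = a mod p then (if k < a div p then f (k*p + a mod p) else 0) else 0)"
    unfolding sum_blocks by (intro sum.cong) (auto simp: A0_def)
  also have "\<dots> = (\<Sum>k<n. if k < a div p then f (k*p + a mod p) else 0)" using p by simp
  also have "\<dots> = (\<Sum>k<a div p. f (k*p + a mod p))"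
    using an by (intro sum.mono_neutral_cong_right) auto
  finally show ?thesis .
qed

lemma sum_A0_right:
  fixes f :: "nat \<Rightarrow> complex"
  assumes "b < Suc N * p"
  shows "(\<Sum>c<Suc N*p. f c * A0 p c b) = (\<Sum>k\<in>{b div p<..N}. f (k*p + b mod p))"
proof -
  have p: "0 < p" using assms by (cases p) auto
  have "(\<Sum>c<Suc N*p. f c * A0 p c b) = (\<Sum>k<Suc N. \<Sum>i<p. if i
      = b mod p then (if b div p < k then f (k*p + b mod p) else 0) else 0)"
    unfolding sum_blocks by (intro sum.cong) (auto simp: A0_def)
  also have "\<dots> = (\<Sum>k<Suc N. if b div p < k then f (k*p + b mod p) else 0)" using p by simp
  also have "\<dots> = (\<Sum>k\<in>{b div p<..N}. f (k*p + b mod p))"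
    by (intro sum.mono_neutral_cong_right) auto
  finally show ?thesis .
qed

text \<open>Raising i by one shifts the index in the last sum on the left; the resulting difference
  telescopes, cancels the new corner term and leaves s(-i-1).\<close>

lemma toeplitz_sum_identity:
  fixes s :: "int \<Rightarrow> complex"
  shows "s (int j - int i) + (\<Sum>k<i. s (int j - int k)) + (\<Sum>k<j. s (int k - int i))
     = (\<Sum>k\<le>j. s (int k)) + (\<Sum>k<i. s (- int k - 1))"
proof (induction i)
  case 0
  show ?case by (cases "j = 0") (auto simp: lessThan_Suc_atMost[symmetric] sum.lessThan_Suc)
next
  case (Suc i)
  have t: "(\<Sum>k<j. s (int k - int i - 1) - s (int k - int i)) = s (- int i - 1) - s (int j - int i - 1)"
    using sum_lessThan_telescope'[of "\<lambda>k. s (int k - int i - 1)" j] by simp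
  have "s (int j - int (Suc i)) + (\<Sum>k<Suc i. s (int j - int k)) + (\<Sum>k<j. s (int k - int (Suc i)))
    = (s (int j - int i) + (\<Sum>k<i. s (int j - int k)) + (\<Sum>k<j. s (int k - int i)))
      + s (int j - int i - 1) + (\<Sum>k<j. s (int k - int i - 1) - s (int k - int i))"
    by (simp add: sum_subtractf algebra_simps)
  then show ?case unfolding Suc.IH t by simp
qed

lemma Tent_identity:
  assumes c: "\<And>k. c k \<in> carrier_mat p p" and ab: "a < n*p" "b < n*p"
  shows "Tent p c a b + (\<Sum>d<n*p. A0 p a d * Tent p c d b) + (\<Sum>d<n*p. A0 p b d * Tent p c a d)
    = Jform p (Pent p c a) (Pent p c b)"
proof -
  have p: "0 < p" using ab by (cases p) auto
  define i j a' b' where "i = a div p" "j = b div p" "a' = a mod p" "b' = b mod p"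
  have ab': "a' < p" "b' < p" using p by (auto simp: i_j_a'_b'_def)
  define s where "s r = sseq c r $$ (a',b')" for r
  have s0: "s 0 = c 0 $$ (a',b') + cnj (c 0 $$ (b',a'))"
    using c[of 0] ab' by (simp add: s_def sseq_def adj_def)
  have sp: "s (int k) = cnj (c k $$ (b',a'))" if "k > 0" for k
    using c[of k] ab' that by (simp add: s_def sseq_def adj_def)
  have sn: "s (- int k - 1) = c (Suc k) $$ (a',b')" for k
    by (simp add: s_def sseq_def nat_diff_distrib add.commute nat_add_distrib flip: Suc_eq_plus1)
  have "Tent p c a b + (\<Sum>d<n*p. A0 p a d * Tent p c d b) + (\<Sum>d<n*p. A0 p b d * Tent p c a d)
    = s (int j - int i) + (\<Sum>k<i. s (int j - int k)) + (\<Sum>k<j. s (int k - int i))"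
    unfolding sum_A0_left[OF ab(1)] sum_A0_left[OF ab(2)]
    using ab' by (simp add: Tent_def i_j_a'_b'_def[symmetric] s_def)
  also have "\<dots> = (\<Sum>k\<le>j. s (int k)) + (\<Sum>k<i. s (- int k - 1))" by (rule toeplitz_sum_identity)
  \<comment> \<open>s_0 = \<alpha>_0 + \<alpha>_0^* supplies \<alpha>_0^* to the conjugated sum for
    block j; the remaining \<alpha>_0 is the first term of the sum for block i.\<close>
  also have "(\<Sum>k\<le>j. s (int k)) = c 0 $$ (a',b') + (\<Sum>k\<le>j. cnj (c k $$ (b',a')))"
    by (simp add: sum.atMost_shift s0 sp del: of_nat_Suc)
  also have "(\<Sum>k<i. s (- int k - 1)) = (\<Sum>k\<le>i. c k $$ (a',b')) - c 0 $$ (a',b')"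
    by (simp add: sn sum.atMost_shift)
  also have "c 0 $$ (a',b') + (\<Sum>k\<le>j. cnj (c k $$ (b',a'))) + ((\<Sum>k\<le>i. c k $$ (a',b')) - c 0 $$ (a',b'))
     = (\<Sum>k\<le>i. c k $$ (a',b')) + cnj (\<Sum>k\<le>j. c k $$ (b',a'))" by simp
  also have "\<dots> = (\<Sum>d<p. if d = b' then (\<Sum>k\<le>i. c k $$ (a',b')) else 0) + (\<Sum>d<p. if d
      = a' then cnj (\<Sum>k\<le>j. c k $$ (b',a')) else 0)"
    using ab' by simp
  also have "\<dots> = Jform p (Pent p c a) (Pent p c b)"
    unfolding Jform_def sum_lessThan_double
    by (intro arg_cong2[of _ _ _ _ "(+)"] sum.cong) (auto simp: Pent_def swap_half_def i_j_a'_b'_def)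
  finally show ?thesis .
qed

text \<open>In the entry (a,b) the product X Y involves only rows of Y above a, and Y X^* only
  columns left of b. So the entries vanish by induction on a + b.\<close>

lemma sylvester_zero:
  fixes X Y :: "complex mat"
  assumes X: "X \<in> carrier_mat n n" and Y: "Y \<in> carrier_mat n n"
    and low: "\<And>a b. a < n \<Longrightarrow> b < n \<Longrightarrow> a \<le> b \<Longrightarrow> X $$ (a,b) = 0"
    and eq: "Y + X * Y + Y * adj X = 0\<^sub>m n n"
  shows "Y = 0\<^sub>m n n"
proof -
  have "a < n \<Longrightarrow> b < n \<Longrightarrow> Y $$ (a,b) = 0" for a b
  proof (induction "a + b" arbitrary: a b rule: less_induct)
    case less
    have aX: "adj X \<in> carrier_mat n n" using X by simp
    have "(Y + X * Y + Y * adj X) $$ (a,b) = Y $$ (a,b) + (X * Y) $$ (a,b) + (Y * adj X) $$ (a,b)"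
      using less.prems X Y by (simp del: index_mult_mat(1))
    then have "Y $$ (a,b) + (X * Y) $$ (a,b) + (Y * adj X) $$ (a,b) = 0"
      unfolding eq using less.prems by simp
    moreover have "(X * Y) $$ (a,b) = 0"
      unfolding mat_mult_entry[OF X Y less.prems]
      using less by (intro sum.neutral) (metis add_less_cancel_right lessThan_iff low mult_eq_0_iff not_le)
    moreover have "(Y * adj X) $$ (a,b) = 0"
      unfolding mat_mult_entry[OF Y aX less.prems]
      using less X by (intro sum.neutral) (auto simp: adj_entry, metis add_less_cancel_left low not_le)
    ultimately show ?case by simp
  qed
  then show ?thesis using Y by (intro eq_matI) auto
qed

text \<open>Used with A0 for the uniqueness of S and with L for M T M^* = 1.\<close>

lemma sylvester_cancel:
  fixes X S T :: "complex mat"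
  assumes X: "X \<in> carrier_mat n n" and S: "S \<in> carrier_mat n n" and T: "T \<in> carrier_mat n n"
    and low: "\<And>a b. a < n \<Longrightarrow> b < n \<Longrightarrow> a \<le> b \<Longrightarrow> X $$ (a,b) = 0"
    and eq: "S + X * S + S * adj X = T + X * T + T * adj X"
  shows "S = T"
proof -
  have aX: "adj X \<in> carrier_mat n n" using X by simp
  have Y: "S - T \<in> carrier_mat n n" by (rule minus_carrier_mat[OF T])
  have regroup: "(S - T) + (P - Q) + (U - V) = (S + P + U) - (T + Q + V)"
    if "P \<in> carrier_mat n n" "Q \<in> carrier_mat n n" "U \<in> carrier_mat n n" "V \<in> carrier_mat n n"
    for P Q U V
    using that S T by (intro eq_matI) auto
  have "(S - T) + X * (S - T) + (S - T) * adj X = (S + X * S + S * adj X) - (T + X * T + T * adj X)"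
    unfolding mult_minus_distrib_mat[OF X S T] minus_mult_distrib_mat[OF S T aX]
    by (rule regroup) (rule mult_carrier_mat[OF X S] mult_carrier_mat[OF X T] mult_carrier_mat[OF S aX]
        mult_carrier_mat[OF T aX])+
  also have "\<dots> = 0\<^sub>m n n"
    unfolding eq by (rule minus_r_inv_mat) (intro add_carrier_mat mult_carrier_mat[OF T aX])
  finally have Y0: "S - T = 0\<^sub>m n n"
    using low by (intro sylvester_zero[OF X Y])
  have "S $$ (a,b) = T $$ (a,b)" if "a < n" "b < n" for a b
    using arg_cong[OF Y0, of "\<lambda>Y. Y $$ (a,b)"] S T that by simp
  then show ?thesis using S T by (intro eq_matI) auto
qed

section \<open>The displacement equations of T and of the identity\<close>

definition A0mat :: "nat \<Rightarrow> nat \<Rightarrow> complex mat" where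
  "A0mat p n = mat n n (\<lambda>(a,b). A0 p a b)"

definition Bmat :: "nat \<Rightarrow> (nat \<Rightarrow> complex mat) \<Rightarrow> nat \<Rightarrow> complex mat" where
  "Bmat p \<beta> n = mat n (2*p) (\<lambda>(a,c). brow p \<beta> a c)"

text \<open>The strictly block lower triangular part of B J B^*; it is for the identity matrix what
  A0 is for T.\<close>

definition Lmat :: "nat \<Rightarrow> (nat \<Rightarrow> complex mat) \<Rightarrow> nat \<Rightarrow> complex mat" where
  "Lmat p \<beta> n = mat n n (\<lambda>(a,b). if b div p < a div p then gram p \<beta> a b else 0)"

lemma A0mat_carrier[simp]: "A0mat p n \<in> carrier_mat n n" by (simp add: A0mat_def)
lemma Bmat_carrier[simp]: "Bmat p \<beta> n \<in> carrier_mat n (2*p)" by (simp add: Bmat_def)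
lemma Lmat_carrier[simp]: "Lmat p \<beta> n \<in> carrier_mat n n" by (simp add: Lmat_def)

lemma A0mat_entry: "a < n \<Longrightarrow> b < n \<Longrightarrow> A0mat p n $$ (a,b) = A0 p a b" by (simp add: A0mat_def)

lemma A0_strict: "b \<le> d \<Longrightarrow> A0 p b d = 0"
  using div_le_mono[of b d p] by (auto simp: A0_def)

lemma Lmat_strict: "a < n \<Longrightarrow> b < n \<Longrightarrow> a \<le> b \<Longrightarrow> Lmat p \<beta> n $$ (a,b) = 0"
  using div_le_mono[of a b p] by (auto simp: Lmat_def)

lemma cnj_A0[simp]: "cnj (A0 p a b) = A0 p a b" by (simp add: A0_def)

lemma toeplitz_displacement:
  assumes c: "\<And>k. c k \<in> carrier_mat p p"
  shows "toeplitz p c N + A0mat p (Suc N*p) * toeplitz p c N + toeplitz p c N * adj (A0mat p (Suc N*p))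
    = Pimat p c N * Jmat p * adj (Pimat p c N)"
proof (rule eq_matI)
  let ?n = "Suc N*p" and ?T = "toeplitz p c N" and ?A = "A0mat p (Suc N*p)" and ?P = "Pimat p c N"
  have aA: "adj ?A \<in> carrier_mat ?n ?n" by (rule adj_carrier[OF A0mat_carrier])
  fix a b assume "a < dim_row (?P * Jmat p * adj ?P)" "b < dim_col (?P * Jmat p * adj ?P)"
  then have ab: "a < ?n" "b < ?n" by (auto simp: carrier_matD[OF Pimat_carrier])
  have "(?T + ?A * ?T + ?T * adj ?A) $$ (a,b) = ?T $$ (a,b) + (?A * ?T) $$ (a,b) + (?T * adj ?A) $$ (a,b)"
    using ab by (simp add: carrier_matD[OF toeplitz_carrier] carrier_matD[OF A0mat_carrier] del:
        index_mult_mat(1) mult_Suc)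
  also have "(?A * ?T) $$ (a,b) = (\<Sum>d<?n. A0 p a d * Tent p c d b)"
    unfolding mat_mult_entry[OF A0mat_carrier toeplitz_carrier ab]
    using ab by (intro sum.cong) (auto simp: toeplitz_entry A0mat_entry simp del: mult_Suc)
  also have "(?T * adj ?A) $$ (a,b) = (\<Sum>d<?n. A0 p b d * Tent p c a d)"
    unfolding mat_mult_entry[OF toeplitz_carrier aA ab]
    using ab by (intro sum.cong) (auto simp: toeplitz_entry adj_entry[OF A0mat_carrier] A0mat_entry simp del:
        mult_Suc)
  also have "?T $$ (a,b) = Tent p c a b" using ab by (rule toeplitz_entry)
  also have "Tent p c a b + (\<Sum>d<?n. A0 p a d * Tent p c d b) + (\<Sum>d<?n. A0 p b d * Tent p c a d)
    = Jform p (Pent p c a) (Pent p c b)" using c ab by (rule Tent_identity)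
  also have "\<dots> = Jform p (\<lambda>d. ?P $$ (a,d)) (\<lambda>d. ?P $$ (b,d))"
    using ab by (intro Jform_cong) (auto simp: Pimat_entry simp del: mult_Suc)
  also have "\<dots> = (?P * Jmat p * adj ?P) $$ (a,b)"
    using ab by (intro mult_Jmat_adj_entry[symmetric, OF Pimat_carrier Pimat_carrier])
  finally show "(?T + ?A * ?T + ?T * adj ?A) $$ (a,b) = (?P * Jmat p * adj ?P) $$ (a,b)" .
qed (auto simp: carrier_matD[OF Pimat_carrier] carrier_matD[OF toeplitz_carrier] carrier_matD[OF A0mat_carrier])

text \<open>By admissibility the diagonal blocks of B J B^* are identities, and by hermitian
  symmetry the strictly lower part L determines the rest.\<close>

lemma Bmat_displacement:
  assumes adm: "admissible p \<beta>" and p0: "0 < p"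
  shows "1\<^sub>m n + Lmat p \<beta> n + adj (Lmat p \<beta> n) = Bmat p \<beta> n * Jmat p * adj (Bmat p \<beta> n)"
proof (rule eq_matI)
  let ?B = "Bmat p \<beta> n" and ?L = "Lmat p \<beta> n"
  fix a b assume "a < dim_row (?B * Jmat p * adj ?B)" "b < dim_col (?B * Jmat p * adj ?B)"
  then have ab: "a < n" "b < n" by (auto simp: carrier_matD[OF Bmat_carrier])
  have "(?B * Jmat p * adj ?B) $$ (a,b) = Jform p (\<lambda>d. ?B $$ (a,d)) (\<lambda>d. ?B $$ (b,d))"
    using ab by (intro mult_Jmat_adj_entry[OF Bmat_carrier Bmat_carrier])
  also have "\<dots> = gram p \<beta> a b"
    unfolding gram_def using ab by (intro Jform_cong) (auto simp: Bmat_def)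
  also have "\<dots> = (1\<^sub>m n + ?L + adj ?L) $$ (a,b)"
  proof -
    consider "a div p = b div p" | "a div p < b div p" | "b div p < a div p" by linarith
    then show ?thesis
    proof cases
      case 1
      have p: "a mod p < p" "b mod p < p" using p0 by auto
      have "gram p \<beta> (a div p * p + a mod p) (a div p * p + b mod p) = (if a mod p = b mod p then 1 else 0)"
        by (rule admissible_gram[OF adm p])
      also have "a div p * p + b mod p = b" using 1 by (metis div_mult_mod_eq)
      finally have "gram p \<beta> a b = (if a mod p = b mod p then 1 else 0)" by simp
      moreover have "a mod p = b mod p \<longleftrightarrow> a = b" using 1 by (metis div_mult_mod_eq)
      ultimately show ?thesis using ab 1 by (simp add: Lmat_def adj_def)
    next
      case 2
      then have "a \<noteq> b" by auto
      then show ?thesis using ab 2 by (simp add: Lmat_def adj_def gram_cnj)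
    next
      case 3
      then have "a \<noteq> b" by auto
      then show ?thesis using ab 3 by (simp add: Lmat_def adj_def)
    qed
  qed
  finally show "(1\<^sub>m n + ?L + adj ?L) $$ (a,b) = (?B * Jmat p * adj ?B) $$ (a,b)" by simp
qed (auto simp: carrier_matD[OF Bmat_carrier] carrier_matD[OF Lmat_carrier])

lemma Tent_hermitian:
  assumes c: "\<And>k. c k \<in> carrier_mat p p" and p: "0 < p"
  shows "cnj (Tent p c b a) = Tent p c a b"
  unfolding Tent_def sseq_def
  using p c[THEN carrier_matD(1)] c[THEN carrier_matD(2)] by (auto simp: adj_def)

lemma toeplitz_hermitian:
  assumes c: "\<And>k. c k \<in> carrier_mat p p"
  shows "adj (toeplitz p c N) = toeplitz p c N"
proof (rule eq_matI)
  let ?n = "Suc N*p" and ?T = "toeplitz p c N"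
  fix a b assume "a < dim_row ?T" "b < dim_col ?T"
  then have ab: "a < ?n" "b < ?n" by (auto simp: toeplitz_def blockmat_def)
  then have "0 < p" by (cases p) auto
  then have "cnj (Tent p c b a) = Tent p c a b" by (rule Tent_hermitian[OF c])
  then show "adj ?T $$ (a,b) = ?T $$ (a,b)"
    using ab by (simp add: adj_entry[OF toeplitz_carrier] toeplitz_entry del: mult_Suc)
qed (auto simp: toeplitz_def blockmat_def)

lemma square_algebra:
  fixes A B C :: "complex mat"
  assumes "A \<in> carrier_mat n n" "B \<in> carrier_mat n n" "C \<in> carrier_mat n n"
  shows "A * B * C = A * (B * C)" "A * (B + C) = A * B + A * C" "(A + B) * C = A * C + B * C"
  using assms by (auto intro: assoc_mult_mat mult_add_distrib_mat add_mult_distrib_mat)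

lemma congruence_Jmat:
  assumes M: "M \<in> carrier_mat n n" and P: "P \<in> carrier_mat n (2*p)"
  shows "M * (P * Jmat p * adj P) * adj M = (M * P) * Jmat p * adj (M * P)"
proof -
  have aP: "adj P \<in> carrier_mat (2*p) n" and aM: "adj M \<in> carrier_mat n n" using M P by auto
  have PJ: "P * Jmat p \<in> carrier_mat n (2*p)" by (rule mult_carrier_mat[OF P Jmat_carrier])
  have "M * (P * Jmat p * adj P) = M * (P * Jmat p) * adj P"
    by (rule assoc_mult_mat[symmetric, OF M PJ aP])
  also have "M * (P * Jmat p) = M * P * Jmat p"
    by (rule assoc_mult_mat[symmetric, OF M P Jmat_carrier])
  finally have "M * (P * Jmat p * adj P) * adj M = M * P * Jmat p * adj P * adj M" by simp
  also have "\<dots> = M * P * Jmat p * (adj P * adj M)"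
    by (rule assoc_mult_mat[OF mult_carrier_mat[OF mult_carrier_mat[OF M P] Jmat_carrier] aP aM])
  finally show ?thesis unfolding adj_mult[OF M P] .
qed

text \<open>The congruence by M carries the equation of T into X + L X + X L^* = B J B^* for X = M T
  M^*. This equation is also solved by X = 1, and its solution is unique.\<close>

lemma congruence_toeplitz:
  assumes c: "\<And>k. c k \<in> carrier_mat p p" and adm: "admissible p \<beta>" and p0: "0 < p"
    and M: "M \<in> carrier_mat (Suc N*p) (Suc N*p)"
    and MA: "M * A0mat p (Suc N*p) = Lmat p \<beta> (Suc N*p) * M"
    and MP: "M * Pimat p c N = Bmat p \<beta> (Suc N*p)"
  shows "M * toeplitz p c N * adj M = 1\<^sub>m (Suc N*p)"
proof -
  define n where "n = Suc N*p"
  define T where "T = toeplitz p c N"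
  define A where "A = A0mat p n"
  define L where "L = Lmat p \<beta> n"
  define B where "B = Bmat p \<beta> n"
  define P where "P = Pimat p c N"
  define X where "X = M * T * adj M"
  note defs = n_def[symmetric] T_def[symmetric] A_def[symmetric] L_def[symmetric] B_def[symmetric]
      P_def[symmetric]
  have M': "M \<in> carrier_mat n n" "adj M \<in> carrier_mat n n" using M by (auto simp: n_def)
  have T: "T \<in> carrier_mat n n" unfolding T_def n_def by (rule toeplitz_carrier)
  have A: "A \<in> carrier_mat n n" "adj A \<in> carrier_mat n n" unfolding A_def by auto
  have L: "L \<in> carrier_mat n n" "adj L \<in> carrier_mat n n" unfolding L_def by auto
  have B: "B \<in> carrier_mat n (2*p)" "adj B \<in> carrier_mat (2*p) n" unfolding B_def by auto
  have P: "P \<in> carrier_mat n (2*p)" "adj P \<in> carrier_mat (2*p) n" unfolding P_def n_def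
      by (auto simp del: mult_Suc)
  have MA': "M * A = L * M" using MA unfolding defs .
  have MP': "M * P = B" using MP unfolding defs .
  note c = M' T A L
  note sa = square_algebra[where n=n]
  have cm: "Y * Z \<in> carrier_mat n n" "Y + Z \<in> carrier_mat n n"
    if "Y \<in> carrier_mat n n" "Z \<in> carrier_mat n n" for Y Z :: "complex mat"
    using that by (auto intro: mult_carrier_mat)
  have aMA: "adj A * adj M = adj M * adj L"
    using arg_cong[OF MA', of adj] by (simp add: adj_mult[OF M'(1) A(1)] adj_mult[OF L(1) M'(1)])
  have X: "X \<in> carrier_mat n n" unfolding X_def by (intro cm(1) c)
  have "X + L * X + X * adj L = M * T * adj M + (L * M) * T * adj M + M * T * (adj M * adj L)"
    unfolding X_def by (simp only: sa cm c)
  also have "\<dots> = M * (T + A * T + T * adj A) * adj M"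
    unfolding MA'[symmetric] aMA[symmetric] by (simp only: sa cm c)
  also have "T + A * T + T * adj A = P * Jmat p * adj P"
    unfolding T_def A_def P_def n_def by (rule toeplitz_displacement[OF assms(1)])
  also have "M * (P * Jmat p * adj P) * adj M = B * Jmat p * adj B"
    unfolding MP'[symmetric] by (rule congruence_Jmat[OF M'(1) P(1)])
  also have "\<dots> = 1\<^sub>m n + L + adj L"
    unfolding B_def L_def by (rule Bmat_displacement[OF adm p0, symmetric])
  finally have eq: "X + L * X + X * adj L = 1\<^sub>m n + L + adj L" .
  have "X = 1\<^sub>m n"
  proof (rule sylvester_cancel[OF L(1) X])
    show "X + L * X + X * adj L = 1\<^sub>m n + L * 1\<^sub>m n + 1\<^sub>m n * adj L"
      unfolding eq using L by simp
  qed (auto simp: L_def Lmat_strict)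
  then show ?thesis unfolding X_def T_def n_def .
qed

lemma Amat_displacement_entry:
  assumes S: "S \<in> carrier_mat (Suc N*p) (Suc N*p)" and ab: "a < Suc N*p" "b < Suc N*p"
  shows "(Amat p N * S - S * adj (Amat p N)) $$ (a,b)
    = \<i> * (S + A0mat p (Suc N*p) * S + S * adj (A0mat p (Suc N*p))) $$ (a,b)"
proof -
  define n where "n = Suc N*p"
  define A where "A = A0mat p n"
  have n: "Suc N*p = n" by (simp only: n_def)
  have ab: "a < n" "b < n" using ab unfolding n .
  have S: "S \<in> carrier_mat n n" using S unfolding n .
  have Am: "Amat p N \<in> carrier_mat n n" "adj (Amat p N) \<in> carrier_mat n n"
    using Amat_carrier[of p N] unfolding n by auto
  have A: "A \<in> carrier_mat n n" "adj A \<in> carrier_mat n n" unfolding A_def by auto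
  have Ame: "Amat p N $$ (a,b) = \<i> * ((if a = b then 1/2 else 0) + A0 p a b)" if "a < n" "b < n" for a b
    using Amat_entry[of a N p b] that unfolding n .
  have "(Amat p N * S) $$ (a,b) = (\<Sum>d<n. (if d = a then \<i>/2 * S $$ (a,b) else 0) + \<i> * (A0 p a d * S $$ (d,b)))"
    unfolding mat_mult_entry[OF Am(1) S ab]
    using ab by (intro sum.cong) (auto simp: Ame algebra_simps)
  also have "\<dots> = \<i>/2 * S $$ (a,b) + \<i> * (A * S) $$ (a,b)"
    unfolding mat_mult_entry[OF A(1) S ab] using ab
        by (simp add: sum.distrib sum_distrib_left A_def A0mat_entry)
  finally have 1: "(Amat p N * S) $$ (a,b) = \<i>/2 * S $$ (a,b) + \<i> * (A * S) $$ (a,b)" .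
  have "(S * adj (Amat p N)) $$ (a,b) = (\<Sum>d<n. (if d
      = b then - \<i>/2 * S $$ (a,b) else 0) - \<i> * (S $$ (a,d) * A0 p b d))"
    unfolding mat_mult_entry[OF S Am(2) ab]
    using ab by (intro sum.cong) (auto simp: Ame adj_entry[OF Am(1)] algebra_simps)
  also have "\<dots> = - \<i>/2 * S $$ (a,b) - \<i> * (S * adj A) $$ (a,b)"
    unfolding mat_mult_entry[OF S A(2) ab] using ab
    by (simp add: sum_subtractf sum_distrib_left A_def adj_entry[OF A0mat_carrier] A0mat_entry)
  finally have 2: "(S * adj (Amat p N)) $$ (a,b) = - \<i>/2 * S $$ (a,b) - \<i> * (S * adj A) $$ (a,b)" .
  have "(Amat p N * S - S * adj (Amat p N)) $$ (a,b) = (Amat p N * S) $$ (a,b) - (S * adj (Amat p N)) $$ (a,b)"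
    using ab Am S by (simp del: index_mult_mat(1))
  moreover have "(S + A * S + S * adj A) $$ (a,b) = S $$ (a,b) + (A * S) $$ (a,b) + (S * adj A) $$ (a,b)"
    using ab A S by (simp del: index_mult_mat(1))
  ultimately show ?thesis unfolding n A_def[symmetric] by (simp only: 1 2) (simp add: algebra_simps)
qed

lemma sylvester_iff:
  assumes S: "S \<in> carrier_mat (Suc N*p) (Suc N*p)" and R: "R \<in> carrier_mat (Suc N*p) (Suc N*p)"
  shows "Amat p N * S - S * adj (Amat p N) = \<i> \<cdot>\<^sub>m R \<longleftrightarrow>
    S + A0mat p (Suc N*p) * S + S * adj (A0mat p (Suc N*p)) = R"
    (is "?l \<longleftrightarrow> ?r")
proof -
  define n where "n = Suc N*p"
  have n: "Suc N*p = n" by (simp only: n_def)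
  note e = Amat_displacement_entry[OF S, unfolded n]
  have Am: "Amat p N \<in> carrier_mat n n" using Amat_carrier[of p N] unfolding n .
  note S = S[unfolded n] and R = R[unfolded n]
  have ir: "(\<i> \<cdot>\<^sub>m R) $$ (a,b) = \<i> * R $$ (a,b)" if "a < n" "b < n" for a b using R that by simp
  have dl: "dim_row (Amat p N * S - S * adj (Amat p N)) = n" "dim_col (Amat p N * S - S * adj (Amat p N)) = n"
    using Am S by auto
  have dr: "dim_row (S + A0mat p n * S + S * adj (A0mat p n))
      = n" "dim_col (S + A0mat p n * S + S * adj (A0mat p n)) = n"
    using S carrier_matD[OF A0mat_carrier[of p n]] by auto
  show ?thesis unfolding n
  proof
    assume l: "Amat p N * S - S * adj (Amat p N) = \<i> \<cdot>\<^sub>m R"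
    show "S + A0mat p n * S + S * adj (A0mat p n) = R"
    proof (rule eq_matI)
      fix a b assume "a < dim_row R" "b < dim_col R"
      then have ab: "a < n" "b < n" using R by auto
      have "\<i> * (S + A0mat p n * S + S * adj (A0mat p n)) $$ (a,b) = \<i> * R $$ (a,b)"
        unfolding e[OF ab, symmetric] l using ir[OF ab] .
      then show "(S + A0mat p n * S + S * adj (A0mat p n)) $$ (a,b) = R $$ (a,b)" by simp
    qed (use dr R in auto)
  next
    assume r: "S + A0mat p n * S + S * adj (A0mat p n) = R"
    show "Amat p N * S - S * adj (Amat p N) = \<i> \<cdot>\<^sub>m R"
    proof (rule eq_matI)
      fix a b assume "a < dim_row (\<i> \<cdot>\<^sub>m R)" "b < dim_col (\<i> \<cdot>\<^sub>m R)"
      then have ab: "a < n" "b < n" using R by auto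
      show "(Amat p N * S - S * adj (Amat p N)) $$ (a,b) = (\<i> \<cdot>\<^sub>m R) $$ (a,b)"
        unfolding e[OF ab] r ir[OF ab] ..
    qed (use dl R in auto)
  qed
qed

lemma Pi_J_Pi_carrier: "Pimat p c N * Jmat p * adj (Pimat p c N) \<in> carrier_mat (Suc N*p) (Suc N*p)"
  by (rule mult_carrier_mat[OF mult_carrier_mat[OF Pimat_carrier Jmat_carrier] adj_carrier[OF Pimat_carrier]])

lemma toeplitz_sylvester:
  assumes "\<And>k. c k \<in> carrier_mat p p"
  shows "Amat p N * toeplitz p c N - toeplitz p c N * adj (Amat p N)
      = \<i> \<cdot>\<^sub>m (Pimat p c N * Jmat p * adj (Pimat p c N))"
  unfolding sylvester_iff[OF toeplitz_carrier Pi_J_Pi_carrier] by (rule toeplitz_displacement[OF assms])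

lemma sylvester_unique:
  assumes c: "\<And>k. c k \<in> carrier_mat p p" and S: "S \<in> carrier_mat (Suc N*p) (Suc N*p)"
    and eq: "Amat p N * S - S * adj (Amat p N) = \<i> \<cdot>\<^sub>m (Pimat p c N * Jmat p * adj (Pimat p c N))"
  shows "S = toeplitz p c N"
proof -
  define n where "n = Suc N*p"
  have n: "Suc N*p = n" by (simp only: n_def)
  define A where "A = A0mat p n"
  define T where "T = toeplitz p c N"
  have A: "A \<in> carrier_mat n n" "adj A \<in> carrier_mat n n" unfolding A_def by auto
  have T: "T \<in> carrier_mat n n" using toeplitz_carrier[of p c N] unfolding n T_def .
  have "S + A * S + S * adj A = T + A * T + T * adj A"
    using eq unfolding sylvester_iff[OF S Pi_J_Pi_carrier]
        unfolding toeplitz_displacement[OF c, symmetric] n A_def T_def .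
  note eq' = this
  note S = S[unfolded n]
  have "S = T"
    by (rule sylvester_cancel[OF A(1) S T _ eq']) (auto simp: A_def A0mat_entry A0_strict)
  then show ?thesis unfolding T_def .
qed

section \<open>Positivity and inverse from a congruence to the identity\<close>

lemma qform_one: "qform (1\<^sub>m n) y = of_real (\<Sum>a<n. (cmod (y a))\<^sup>2)"
proof -
  have "qform (1\<^sub>m n) y = (\<Sum>a<n. \<Sum>b<n. if b = a then cnj (y a) * y a else 0)"
    unfolding qform_def index_one_mat by (intro sum.cong) auto
  also have "\<dots> = (\<Sum>a<n. cnj (y a) * y a)" by simp
  also have "\<dots> = of_real (\<Sum>a<n. (cmod (y a))\<^sup>2)"
    unfolding of_real_sum complex_norm_square by (simp add: mult.commute)
  finally show ?thesis .
qed

lemma inverse_of_congruence: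
  assumes T: "T \<in> carrier_mat n n" and M: "M \<in> carrier_mat n n" and h: "adj T = T"
    and MTM: "M * T * adj M = 1\<^sub>m n"
  shows "pos_def T" "minv T = adj M * M" "T * (adj M * M) = 1\<^sub>m n" "(adj M * M) * T = 1\<^sub>m n"
proof -
  have aM: "adj M \<in> carrier_mat n n" using M by simp
  have MT: "M * T \<in> carrier_mat n n" and TM: "T * adj M \<in> carrier_mat n n" and MM: "adj M * M \<in> carrier_mat n n"
    by (rule mult_carrier_mat[OF M T] mult_carrier_mat[OF T aM] mult_carrier_mat[OF aM M])+
  \<comment> \<open>For square matrices a right inverse is also a left inverse; all conclusions come
    from M^* M T = 1.\<close>
  have 1: "adj M * (M * T) = 1\<^sub>m n" by (rule mat_mult_left_right_inverse[OF MT aM MTM])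
  show b: "(adj M * M) * T = 1\<^sub>m n" using 1 assoc_mult_mat[OF aM M T] by simp
  show a: "T * (adj M * M) = 1\<^sub>m n" by (rule mat_mult_left_right_inverse[OF MM T b])
  have aMT: "adj (M * T) = T * adj M" using adj_mult[OF M T] h by simp
  \<comment> \<open>T = (M T)^* (M T), a Gram matrix of an invertible factor.\<close>
  have "adj (M * T) * 1\<^sub>m n * (M * T) = T * adj M * (M * T)"
    unfolding aMT right_mult_one_mat[OF TM] ..
  also have "\<dots> = T * (adj M * (M * T))" by (rule assoc_mult_mat[OF T aM MT])
  also have "\<dots> = T" unfolding 1 by (rule right_mult_one_mat[OF T])
  finally have Tc: "adj (M * T) * 1\<^sub>m n * (M * T) = T" .
  have q: "Re (qform T v) = (\<Sum>a<n. (cmod (mapp (M * T) v a))\<^sup>2)" for v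
  proof -
    have "qform T v = qform (adj (M * T) * 1\<^sub>m n * (M * T)) v" unfolding Tc ..
    also have "\<dots> = qform (1\<^sub>m n) (mapp (M * T) v)" by (rule qform_congruence[OF MT]) simp
    finally show ?thesis unfolding qform_one by simp
  qed
  show "pos_def T" unfolding pos_def_def
  proof (intro conjI allI impI)
    show "herm T" using T h by (simp add: herm_def)
    fix v :: "nat \<Rightarrow> complex" assume "\<exists>a<dim_row T. v a \<noteq> 0"
    then obtain a where a: "a < n" "v a \<noteq> 0" using T by auto
    have "Re (qform T v) \<noteq> 0"
    proof
      assume "Re (qform T v) = 0"
      then have z: "mapp (M * T) v i = 0" if "i < n" for i
        using that unfolding q by (simp add: sum_nonneg_eq_0_iff)
      have "v a = mapp (1\<^sub>m n) v a"
      proof -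
        have "mapp (1\<^sub>m n) v a = (\<Sum>b<n. if b = a then v b else 0)"
          unfolding mapp_def using a by (intro sum.cong) auto
        then show ?thesis using a by simp
      qed
      also have "\<dots> = mapp (adj M) (mapp (M * T) v) a"
        unfolding 1[symmetric] by (rule mapp_mult[OF aM MT a(1)])
      also have "\<dots> = 0" unfolding mapp_def[of "adj M"] using z M by simp
      finally show False using a by simp
    qed
    moreover have "Re (qform T v) \<ge> 0" unfolding q by (simp add: sum_nonneg)
    ultimately show "0 < Re (qform T v)" by simp
  qed
  \<comment> \<open>\<open>minv\<close> reads off the option returned by \<open>mat_inverse\<close>;
    the value \<open>None\<close> is impossible because T is a unit of the matrix ring.\<close>
  show "minv T = adj M * M"
  proof (cases "mat_inverse T")
    case None
    have "T \<in> Units (ring_mat TYPE(complex) n ())"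
      unfolding Units_def ring_mat_def using T MM a b by auto
    then show ?thesis using mat_inverse(1)[OF T None, of "()"] by simp
  next
    case (Some X)
    then have X: "T * X = 1\<^sub>m n" "X * T = 1\<^sub>m n" "X \<in> carrier_mat n n" using mat_inverse(2)[OF T] by auto
    have "X = X * (T * (adj M * M))" unfolding a using X(3) by simp
    also have "\<dots> = X * T * (adj M * M)" by (rule assoc_mult_mat[symmetric, OF X(3) T MM])
    also have "\<dots> = adj M * M" unfolding X by (rule left_mult_one_mat[OF MM])
    finally show ?thesis using Some by (simp add: minv_def)
  qed
qed

lemma Bmat_gram_sum:
  "adj (Bmat p \<beta> (Suc N*p)) * Bmat p \<beta> (Suc N*p) = msum (2*p) (\<lambda>k. adj (\<beta> k) * \<beta> k) {..N}"
  if b: "\<And>k. \<beta> k \<in> carrier_mat p (2*p)"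
proof (rule eq_matI)
  let ?B = "Bmat p \<beta> (Suc N*p)"
  fix i j assume "i < dim_row (msum (2*p) (\<lambda>k. adj (\<beta> k)
      * \<beta> k) {..N})" "j < dim_col (msum (2*p) (\<lambda>k. adj (\<beta> k) * \<beta> k) {..N})"
  then have ij: "i < 2*p" "j < 2*p" by (auto simp: msum_def)
  have "(adj ?B * ?B) $$ (i,j) = (\<Sum>a<Suc N*p. cnj (brow p \<beta> a i) * brow p \<beta> a j)"
    unfolding mat_mult_entry[OF adj_carrier[OF Bmat_carrier] Bmat_carrier ij]
    using ij by (intro sum.cong) (auto simp: adj_entry[OF Bmat_carrier] Bmat_def[THEN arg_cong[of _ _ "\<lambda>B. B
        $$ _"]] simp del: mult_Suc)
  also have "\<dots> = (\<Sum>k<Suc N. \<Sum>r<p. cnj (brow p \<beta> (k*p+r) i) * brow p \<beta> (k*p+r) j)"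
    by (rule sum_blocks)
  also have "\<dots> = (\<Sum>k<Suc N. (adj (\<beta> k) * \<beta> k) $$ (i,j))"
  proof (rule sum.cong[OF refl])
    fix k
    show "(\<Sum>r<p. cnj (brow p \<beta> (k*p+r) i) * brow p \<beta> (k*p+r) j) = (adj (\<beta> k) * \<beta> k) $$ (i,j)"
      unfolding mat_mult_entry[OF adj_carrier[OF b] b ij]
      using ij by (intro sum.cong) (auto simp: adj_entry[OF b] brow_def)
  qed
  finally show "(adj ?B * ?B) $$ (i,j) = msum (2*p) (\<lambda>k. adj (\<beta> k) * \<beta> k) {..N} $$ (i,j)"
    using ij by (simp only: msum_def index_mat case_prod_conv lessThan_Suc_atMost)
qed (auto simp: msum_def carrier_matD[OF Bmat_carrier])

section \<open>The intertwining matrix of a system\<close>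

lemma bval_zero[simp]: "bval p \<beta> a (\<lambda>_. 0) = 0" by (simp add: bval_def)
lemma bproj_zero[simp]: "bproj p \<beta> k (\<lambda>_. 0) c = 0" by (simp add: bproj_def bdual_def)

text \<open>nvec k j is the coefficient of z^(k-j) in (P_(k-1) + z(1 - P_(k-1))) ... (P_0 + z(1 - P_0)) u.\<close>

fun nvec :: "nat \<Rightarrow> (nat \<Rightarrow> complex mat) \<Rightarrow> (nat \<Rightarrow> complex) \<Rightarrow> nat \<Rightarrow> nat \<Rightarrow> nat \<Rightarrow> complex" where
  "nvec p \<beta> u 0 j = (\<lambda>c. if j = 0 then u c else 0)"
| "nvec p \<beta> u (Suc k) j = (\<lambda>c. bproj p \<beta> k (if j = 0 then (\<lambda>_. 0) else nvec p \<beta> u k (j - 1)) c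
      + (nvec p \<beta> u k j c - bproj p \<beta> k (nvec p \<beta> u k j) c))"

lemma nvec_zero: "k < j \<Longrightarrow> nvec p \<beta> u k j = (\<lambda>_. 0)"
  by (induction k arbitrary: j) auto

text \<open>From k to k+1 the coefficient with index l changes by P_k n_(l-1) - P_k n_l. The sum
  over l > j therefore telescopes and grows by P_k n_j; the other end P_k n_n is zero because k <
  n.\<close>

lemma nvec_tail:
  assumes "k \<le> n" "j \<le> n"
  shows "(\<Sum>l\<in>{j<..n}. nvec p \<beta> u k l c) = (\<Sum>l<k. bproj p \<beta> l (nvec p \<beta> u l j) c)"
  using assms(1)
proof (induction k)
  case 0
  then show ?case by (auto intro!: sum.neutral)
next
  case (Suc k)
  define g where "g l = bproj p \<beta> k (nvec p \<beta> u k l) c" for l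
  have "g n = 0" unfolding g_def using nvec_zero[of k n p \<beta> u] Suc.prems by simp
  have "(\<Sum>l\<in>{j<..n}. nvec p \<beta> u (Suc k) l c) = (\<Sum>l\<in>{j<..n}. nvec p \<beta> u k l c - (g l - g (l - 1)))"
    unfolding g_def by (intro sum.cong) auto
  also have "\<dots> = (\<Sum>l\<in>{j<..n}. nvec p \<beta> u k l c) - (g n - g j)"
    unfolding sum_subtractf[of _ _ "{j<..n}"] using sum_telescope''[OF assms(2), of g]
    by (simp add: sum_subtractf atLeastSucAtMost_greaterThanAtMost)
  also have "\<dots> = (\<Sum>l<Suc k. bproj p \<beta> l (nvec p \<beta> u l j) c)"
    using Suc \<open>g n = 0\<close> by (simp add: g_def)
  finally show ?case .
qed

lemma nvec_head: "nvec p \<beta> u k 0 c = u c - (\<Sum>l<k. bproj p \<beta> l (nvec p \<beta> u l 0) c)"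
  by (induction k) auto

text \<open>The sum of the coefficients is the value of the polynomial at z = 1, where every factor
  P_l + z (1 - P_l) is the identity.\<close>

lemma nvec_total:
  assumes "k \<le> n"
  shows "(\<Sum>l\<le>n. nvec p \<beta> u k l c) = u c"
proof -
  have "{..n} = insert 0 {0<..n}" by auto
  then have "(\<Sum>l\<le>n. nvec p \<beta> u k l c) = nvec p \<beta> u k 0 c + (\<Sum>l\<in>{0<..n}. nvec p \<beta> u k l c)"
    by simp
  then show ?thesis using nvec_tail[OF assms, of 0] nvec_head[of p \<beta> u k c] by simp
qed

text \<open>The block (k,j) is the coefficient of z^(k-j) in \<beta>(k) times the product of the
  factors below k, restricted to the first p unit vectors. This restriction matches the first p
  columns of Pi.\<close>

definition Mnv :: "nat \<Rightarrow> (nat \<Rightarrow> complex mat) \<Rightarrow> nat \<Rightarrow> complex mat" where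
  "Mnv p \<beta> n = mat n n (\<lambda>(a,b). bval p \<beta> a (nvec p \<beta> (\<lambda>c. if c = b mod p then 1 else 0) (a div p) (b div p)))"

lemma Mnv_carrier[simp]: "Mnv p \<beta> n \<in> carrier_mat n n" by (simp add: Mnv_def)

lemma block_index_lt: "k \<le> N \<Longrightarrow> i < p \<Longrightarrow> k * p + i < Suc N * p" for k N i p :: nat
  by (metis add.commute add_less_le_mono mult_Suc mult_le_mono1)

lemma div_le_of_lt: "a < Suc N * p \<Longrightarrow> a div p \<le> N" for a N p :: nat
  by (metis less_Suc_eq_le less_mult_imp_div_less)

lemma mapp_Lmat:
  assumes a: "a < n"
  shows "mapp (Lmat p \<beta> n) s a = (\<Sum>b<a div p * p. gram p \<beta> a b * s b)"
proof (cases "p = 0")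
  case False
  have "mapp (Lmat p \<beta> n) s a = (\<Sum>b<n. if b div p < a div p then gram p \<beta> a b * s b else 0)"
    unfolding mapp_def using a by (intro sum.cong) (auto simp: Lmat_def)
  also have "\<dots> = (\<Sum>b<a div p * p. gram p \<beta> a b * s b)"
  proof (rule sum.mono_neutral_cong_right)
    show "{..<a div p * p} \<subseteq> {..<n}"
      using order_trans[OF div_times_less_eq_dividend less_imp_le[OF a]] by simp
  qed (use False in \<open>auto simp: div_less_iff_less_mult\<close>)
  finally show ?thesis .
qed (use a in \<open>simp add: mapp_def Lmat_def\<close>)

text \<open>Multiplication by A0 from the right sums the blocks behind b div p, which is the tail
  evaluated by \<open>nvec_tail\<close>. Applying a row of \<beta> to P_l = J \<beta>(l)^*
  \<beta>(l) then gives Gram entries times entries of M, that is, L M.\<close>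

lemma Mnv_intertwines: "Mnv p \<beta> (Suc N*p) * A0mat p (Suc N*p) = Lmat p \<beta> (Suc N*p) * Mnv p \<beta> (Suc N*p)"
proof -
  define n where "n = Suc N*p"
  have n: "Suc N*p = n" by (simp only: n_def)
  show ?thesis unfolding n
  proof (rule eq_matI)
    fix a b assume "a < dim_row (Lmat p \<beta> n * Mnv p \<beta> n)" "b < dim_col (Lmat p \<beta> n * Mnv p \<beta> n)"
    then have ab: "a < n" "b < n" by (auto simp: Lmat_def Mnv_def)
    then have p: "0 < p" unfolding n_def by (cases p) auto
    have aN: "a div p \<le> N" "b div p \<le> N" using ab div_le_of_lt unfolding n_def by blast+
    let ?e = "\<lambda>c. if c = b mod p then 1 else 0 :: complex"
    have "(Mnv p \<beta> n * A0mat p n) $$ (a,b) = (\<Sum>c<n. Mnv p \<beta> n $$ (a,c) * A0 p c b)"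
      unfolding mat_mult_entry[OF Mnv_carrier A0mat_carrier ab] using ab by (simp add: A0mat_entry)
    also have "\<dots> = (\<Sum>k\<in>{b div p<..N}. Mnv p \<beta> n $$ (a, k*p + b mod p))"
      using sum_A0_right[of b N p "\<lambda>c. Mnv p \<beta> n $$ (a,c)"] ab unfolding n by simp
    also have "\<dots> = (\<Sum>k\<in>{b div p<..N}. bval p \<beta> a (nvec p \<beta> ?e (a div p) k))"
    proof (rule sum.cong[OF refl])
      fix k assume "k \<in> {b div p<..N}"
      then have "k * p + b mod p < n" unfolding n_def using p by (intro block_index_lt) auto
      then show "Mnv p \<beta> n $$ (a, k*p + b mod p) = bval p \<beta> a (nvec p \<beta> ?e (a div p) k)"
        using ab p by (simp add: Mnv_def)
    qed
    also have "\<dots> = bval p \<beta> a (\<lambda>c. \<Sum>k\<in>{b div p<..N}. nvec p \<beta> ?e (a div p) k c)"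
      by (rule bval_sum[symmetric])
    also have "\<dots> = bval p \<beta> a (\<lambda>c. \<Sum>l<a div p. bproj p \<beta> l (nvec p \<beta> ?e l (b div p)) c)"
      unfolding nvec_tail[OF aN] ..
    also have "\<dots> = (\<Sum>l<a div p. \<Sum>i<p. gram p \<beta> a (l*p+i) * bval p \<beta> (l*p+i) (nvec p \<beta> ?e l (b div p)))"
      unfolding bval_sum bproj_def bval_bdual ..
    also have "\<dots> = (\<Sum>l<a div p. \<Sum>i<p. gram p \<beta> a (l*p+i) * Mnv p \<beta> n $$ (l*p+i, b))"
    proof (intro sum.cong refl)
      fix l i assume li: "l \<in> {..<a div p}" "i \<in> {..<p}"
      then have "l*p+i < n" unfolding n_def using aN by (intro block_index_lt) auto
      then show "gram p \<beta> a (l*p+i) * bval p \<beta> (l*p+i) (nvec p \<beta> ?e l (b div p))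
          = gram p \<beta> a (l*p+i) * Mnv p \<beta> n $$ (l*p+i, b)"
        using ab li by (simp add: Mnv_def)
    qed
    also have "\<dots> = mapp (Lmat p \<beta> n) (\<lambda>c. Mnv p \<beta> n $$ (c,b)) a"
      unfolding mapp_Lmat[OF ab(1)] sum_blocks ..
    also have "\<dots> = (Lmat p \<beta> n * Mnv p \<beta> n) $$ (a,b)"
      unfolding mat_mult_entry[OF Lmat_carrier Mnv_carrier ab] mapp_def carrier_matD(2)[OF Lmat_carrier] ..
    finally show "(Mnv p \<beta> n * A0mat p n) $$ (a,b) = (Lmat p \<beta> n * Mnv p \<beta> n) $$ (a,b)" .
  qed (auto simp: Lmat_def Mnv_def A0mat_def)
qed

text \<open>The block column of identities adds up all blocks in a row of M, which evaluates the
  polynomial at z = 1.\<close>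

lemma Mnv_first_columns:
  assumes a: "a < Suc N*p" and d: "d < p"
  shows "(Mnv p \<beta> (Suc N*p) * Pimat p c N) $$ (a,d) = brow p \<beta> a d"
proof -
  define n where "n = Suc N*p"
  have n: "Suc N*p = n" by (simp only: n_def)
  have a': "a < n" using a unfolding n .
  have aN: "a div p \<le> N" using a by (rule div_le_of_lt)
  have P: "Pimat p c N \<in> carrier_mat n (2*p)" unfolding n_def by (rule Pimat_carrier)
  have d2: "d < 2*p" using d by simp
  let ?e = "\<lambda>c. if c = d then 1 else 0 :: complex"
  have "(Mnv p \<beta> n * Pimat p c N) $$ (a,d) = (\<Sum>b<Suc N*p. Mnv p \<beta> n $$ (a,b) * (if b mod p = d then 1 else 0))"
    unfolding mat_mult_entry[OF Mnv_carrier P a' d2] unfolding n_def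
    using d by (intro sum.cong) (auto simp: Pimat_entry Pent_def simp del: mult_Suc)
  also have "\<dots> = (\<Sum>k<Suc N. \<Sum>i<p. if i = d then Mnv p \<beta> n $$ (a,k*p+d) else 0)"
    unfolding sum_blocks by (intro sum.cong) auto
  also have "\<dots> = (\<Sum>k<Suc N. Mnv p \<beta> n $$ (a,k*p+d))" using d by simp
  also have "\<dots> = (\<Sum>k\<le>N. bval p \<beta> a (nvec p \<beta> ?e (a div p) k))"
  proof (intro sum.cong)
    fix k assume "k \<in> {..N}"
    then have "k * p + d < n" unfolding n_def using d by (intro block_index_lt) auto
    then show "Mnv p \<beta> n $$ (a, k*p + d) = bval p \<beta> a (nvec p \<beta> ?e (a div p) k)"
      using a' d by (simp add: Mnv_def)
  qed auto
  also have "\<dots> = bval p \<beta> a (\<lambda>c. \<Sum>k\<le>N. nvec p \<beta> ?e (a div p) k c)" by (rule bval_sum[symmetric])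
  also have "\<dots> = bval p \<beta> a ?e" unfolding nvec_total[OF aN] ..
  also have "\<dots> = (\<Sum>c<2*p. if c = d then brow p \<beta> a d else 0)"
    unfolding bval_def by (intro sum.cong) auto
  also have "\<dots> = brow p \<beta> a d" using d2 by simp
  finally show ?thesis unfolding n .
qed

text \<open>The quotients s of the numbers beta(k) t_k by z^(k+1) determine t_k = z^k tau_k.\<close>

definition tau :: "nat \<Rightarrow> (nat \<Rightarrow> complex mat) \<Rightarrow> complex \<Rightarrow> (nat \<Rightarrow> complex) \<Rightarrow> (nat \<Rightarrow> complex) \<Rightarrow> nat \<Rightarrow> nat
    \<Rightarrow> complex" where
  "tau p \<beta> z v s k c = v c + (1 - z) * (\<Sum>b<k*p. s b * cnj (brow p \<beta> b (swap_half p c)))"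

lemma bval_tau: "bval p \<beta> a (tau p \<beta> z v s k) = bval p \<beta> a v + (1 - z) * (\<Sum>b<k*p. gram p \<beta> a b * s b)"
proof -
  have "tau p \<beta> z v s k = (\<lambda>c. 1 * v c + (1 - z) * (\<Sum>b<k*p. s b * cnj (brow p \<beta> b (swap_half p c))))"
    by (simp add: tau_def fun_eq_iff)
  then show ?thesis
    by (simp only: bval_lincomb bval_sum bval_scale bval_dual) (simp add: mult.commute)
qed

text \<open>Divided by z^(K+1), the recursion of t reads tau_(K+1) = tau_K + (1 - z) J \<beta>(K)^*
  s_K. The statement avoids the division, so it covers z = 0.\<close>

lemma tseq_tau:
  assumes "\<And>k i. k < K \<Longrightarrow> i < p \<Longrightarrow> bval p \<beta> (k*p+i) (tseq p \<beta> z v k) = z ^ Suc k * s (k*p+i)"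
  shows "tseq p \<beta> z v K = (\<lambda>c. z ^ K * tau p \<beta> z v s K c)"
  using assms
proof (induction K)
  case 0
  show ?case by (simp add: tau_def)
next
  case (Suc K)
  then have IH: "tseq p \<beta> z v K = (\<lambda>c. z ^ K * tau p \<beta> z v s K c)" by simp
  show ?case
  proof
    fix c
    have "(\<Sum>b<Suc K*p. s b * cnj (brow p \<beta> b (swap_half p c)))
        = (\<Sum>b<K*p. s b * cnj (brow p \<beta> b (swap_half p c))) + (\<Sum>i<p. s (K*p+i)
            * cnj (brow p \<beta> (K*p+i) (swap_half p c)))"
      unfolding sum_blocks by simp
    then have "tau p \<beta> z v s (Suc K) c = tau p \<beta> z v s K c
        + (1 - z) * (\<Sum>i<p. s (K*p+i) * cnj (brow p \<beta> (K*p+i) (swap_half p c)))"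
      unfolding tau_def by (simp only: distrib_left add.assoc)
    moreover have "bproj p \<beta> K (tseq p \<beta> z v K) c
        = z ^ Suc K * (\<Sum>i<p. s (K*p+i) * cnj (brow p \<beta> (K*p+i) (swap_half p c)))"
      unfolding bproj_def bdual_def sum_distrib_left
      using Suc.prems by (intro sum.cong) (auto simp: algebra_simps)
    ultimately show "tseq p \<beta> z v (Suc K) c = z ^ Suc K * tau p \<beta> z v s (Suc K) c"
      unfolding tseq.simps by (simp only: IH) (simp add: algebra_simps)
  qed
qed

text \<open>Iterates \<open>Jform_tseq_Suc\<close> with |\<beta>(k) t_k|^2 = |z|^(2k+2) |s_k|^2. The
  bracket is the quantity whose sign is compared: the Weyl condition uses it to bound s, Potapov's
  inequality to control t_K.\<close>

lemma Jform_tseq_sum: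
  assumes adm: "admissible p \<beta>"
    and "\<And>k i. k < K \<Longrightarrow> i < p \<Longrightarrow> bval p \<beta> (k*p+i) (tseq p \<beta> z v k) = z ^ Suc k * s (k*p+i)"
  shows "Jnorm p (tseq p \<beta> z v K)
    = (cmod z) ^ (2*K) * (Jnorm p v + (1 - (cmod z)\<^sup>2) * (\<Sum>b<K*p. (cmod (s b))\<^sup>2))"
  using assms(2)
proof (induction K)
  case (Suc K)
  have "bnorm2 p \<beta> K (tseq p \<beta> z v K) = (cmod z) ^ (2 * Suc K) * (\<Sum>i<p. (cmod (s (K*p+i)))\<^sup>2)"
    unfolding bnorm2_def sum_distrib_left using Suc.prems
    by (intro sum.cong refl) (simp add: norm_mult norm_power power_mult_distrib power_even_eq del: power_Suc
        mult_Suc_right)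
  moreover have "(\<Sum>b<Suc K*p. (cmod (s b))\<^sup>2) = (\<Sum>b<K*p. (cmod (s b))\<^sup>2) + (\<Sum>i<p. (cmod (s (K*p+i)))\<^sup>2)"
    unfolding sum_blocks by simp
  moreover have IH: "Jnorm p (tseq p \<beta> z v K)
    = (cmod z) ^ (2*K) * (Jnorm p v + (1 - (cmod z)\<^sup>2) * (\<Sum>b<K*p. (cmod (s b))\<^sup>2))"
    using Suc by simp
  ultimately show ?case
    unfolding Jform_tseq_Suc[OF adm] by (simp only: IH) (simp add: power2_eq_square algebra_simps)
qed simp

section \<open>Backward shifts of F and the vector h\<close>

definition Hser :: "(nat \<Rightarrow> complex mat) \<Rightarrow> complex \<Rightarrow> nat \<Rightarrow> nat \<Rightarrow> nat \<Rightarrow> complex" where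
  "Hser c z k i j = (\<Sum>n. c (n + k) $$ (i,j) * z ^ n)"

text \<open>Block k of h is the (k+1)-fold backward shift of F, evaluated at z and applied to
  x.\<close>

definition hvec :: "nat \<Rightarrow> (nat \<Rightarrow> complex mat) \<Rightarrow> complex \<Rightarrow> (nat \<Rightarrow> complex) \<Rightarrow> nat \<Rightarrow> complex" where
  "hvec p c z x a = (\<Sum>j<p. Hser c z (Suc (a div p)) (a mod p) j * x j)"

lemma expansion_summable:
  assumes "expansion p F c" "cmod z < 1" "i < p" "j < p"
  shows "summable (\<lambda>n. c (n + k) $$ (i,j) * z ^ n)"
proof -
  have "(\<lambda>n. c n $$ (i,j) * z ^ n) sums (F z $$ (i,j))" using assms by (simp add: expansion_def)
  then show ?thesis
    unfolding summable_powser_ignore_initial_segment[of "\<lambda>n. c n $$ (i,j)" k z] by (rule sums_summable)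
qed

lemma Hser_rec:
  assumes "expansion p F c" "cmod z < 1" "i < p" "j < p"
  shows "Hser c z k i j = c k $$ (i,j) + z * Hser c z (Suc k) i j"
  using powser_split_head(1)[OF expansion_summable[OF assms, of k]] unfolding Hser_def
      by (simp add: mult.commute)

lemma Hser_0:
  assumes "expansion p F c" "cmod z < 1" "i < p" "j < p"
  shows "Hser c z 0 i j = F z $$ (i,j)"
  using assms unfolding Hser_def expansion_def by (simp add: sums_iff)

text \<open>In matrix form, Pi [-F; I] x = ((1 - z) A0 - z) h. A partial sum of coefficients minus F
  is a combination of shifts because H_k = c_k + z H_(k+1).\<close>

lemma Pent_vinit_hvec:
  assumes E: "expansion p F c" and z: "cmod z < 1" and a: "a < n*p"
  shows "(\<Sum>d<2*p. Pent p c a d * vinit p (F z) x d)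
    = (1 - z) * (\<Sum>b<n*p. A0 p a b * hvec p c z x b) - z * hvec p c z x a"
proof -
  have p: "0 < p" using a by (cases p) auto
  define i a' where "i = a div p" "a' = a mod p"
  have a': "a' < p" using p by (simp add: i_a'_def)
  have key: "- Hser c z 0 a' j + (\<Sum>k\<le>i. c k $$ (a',j))
      = (1 - z) * (\<Sum>k<i. Hser c z (Suc k) a' j) - z * Hser c z (Suc i) a' j"
    if "j < p" for j i
  proof (induction i)
    case 0
    then show ?case using Hser_rec[OF E z a' that, of 0] by simp
  next
    case (Suc i)
    then show ?case using Hser_rec[OF E z a' that, of "Suc i"] by (simp add: algebra_simps)
  qed
  have "(\<Sum>d<2*p. Pent p c a d * vinit p (F z) x d)
     = (\<Sum>d<p. if d = a' then - (\<Sum>j<p. F z $$ (a',j) * x j) else 0) + (\<Sum>d<p. (\<Sum>k\<le>i. c k $$ (a',d)) * x d)"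
    unfolding sum_lessThan_double
        by (intro arg_cong2[of _ _ _ _ "(+)"] sum.cong) (auto simp: Pent_def vinit_def i_a'_def)
  also have "\<dots> = (\<Sum>j<p. (- Hser c z 0 a' j + (\<Sum>k\<le>i. c k $$ (a',j))) * x j)"
    using a' by (simp add: Hser_0[OF E z] sum.distrib distrib_right sum_negf sum_subtractf left_diff_distrib)
  also have "\<dots> = (\<Sum>j<p. ((1 - z) * (\<Sum>k<i. Hser c z (Suc k) a' j) - z * Hser c z (Suc i) a' j) * x j)"
    by (intro sum.cong refl arg_cong2[of _ _ _ _ "(*)"] key) auto
  also have "\<dots> = (1 - z) * (\<Sum>j<p. \<Sum>k<i. Hser c z (Suc k) a' j * x j) - z * (\<Sum>j<p. Hser c z (Suc i) a' j * x j)"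
    by (simp add: sum_subtractf left_diff_distrib sum_distrib_left sum_distrib_right mult.assoc)
  also have "(\<Sum>j<p. \<Sum>k<i. Hser c z (Suc k) a' j * x j) = (\<Sum>k<i. \<Sum>j<p. Hser c z (Suc k) a' j * x j)"
    by (rule sum.swap)
  also have "\<dots> = (\<Sum>b<n*p. A0 p a b * hvec p c z x b)"
    unfolding sum_A0_left[OF a] hvec_def using p by (simp add: i_a'_def)
  finally show ?thesis by (simp add: hvec_def i_a'_def)
qed

text \<open>M is applied to the formula of \<open>Pent_vinit_hvec\<close> and moved past A0. For M
  Pi = B the result is the recursion of the system; M Pi is kept here because
  \<open>weyl_interpolation\<close> has to compare it with B.\<close>

lemma intertwined_hvec:
  fixes x :: "nat \<Rightarrow> complex"
  assumes E: "expansion p F c" and z: "cmod z < 1"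
    and M: "M \<in> carrier_mat (Suc N*p) (Suc N*p)"
    and MA: "M * A0mat p (Suc N*p) = Lmat p \<beta> (Suc N*p) * M" and a: "a < Suc N*p"
  defines "s \<equiv> \<lambda>a. - mapp M (hvec p c z x) a"
  shows "z * s a = mapp (M * Pimat p c N) (vinit p (F z) x) a + (1 - z) * mapp (Lmat p \<beta> (Suc N*p)) s a"
proof -
  define n where "n = Suc N*p"
  have n: "Suc N*p = n" by (simp only: n_def)
  note M = M[unfolded n] and MA = MA[unfolded n] and a = a[unfolded n]
  have P: "Pimat p c N \<in> carrier_mat n (2*p)" unfolding n_def by (rule Pimat_carrier)
  let ?h = "hvec p c z x" and ?L = "Lmat p \<beta> n"
  have "mapp (M * Pimat p c N) (vinit p (F z) x) a = mapp M (mapp (Pimat p c N) (vinit p (F z) x)) a"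
    by (rule mapp_mult[OF M P a])
  also have "\<dots> = mapp M (\<lambda>b. (1 - z) * mapp (A0mat p n) ?h b - z * ?h b) a"
  proof (rule mapp_cong[OF M])
    fix b assume b: "b < n"
    have "mapp (Pimat p c N) (vinit p (F z) x) b = (\<Sum>d<2*p. Pent p c b d * vinit p (F z) x d)"
      unfolding mapp_def carrier_matD(2)[OF Pimat_carrier] using b unfolding n_def
      by (intro sum.cong) (auto simp: Pimat_entry simp del: mult_Suc)
    also have "\<dots> = (1 - z) * (\<Sum>d<n. A0 p b d * ?h d) - z * ?h b"
      using b unfolding n_def by (intro Pent_vinit_hvec[OF E z])
    also have "(\<Sum>d<n. A0 p b d * ?h d) = mapp (A0mat p n) ?h b"
      unfolding mapp_def carrier_matD(2)[OF A0mat_carrier] using b by (simp add: A0mat_entry)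
    finally show "mapp (Pimat p c N) (vinit p (F z) x) b = (1 - z) * mapp (A0mat p n) ?h b - z * ?h b" .
  qed
  also have "\<dots> = (1 - z) * mapp M (mapp (A0mat p n) ?h) a - z * mapp M ?h a"
    unfolding mapp_def[of M] by (simp add: right_diff_distrib sum_subtractf sum_distrib_left sum.distrib
        algebra_simps)
  also have "mapp M (mapp (A0mat p n) ?h) a = mapp (?L * M) ?h a"
    unfolding MA[symmetric] by (rule mapp_mult[symmetric, OF M A0mat_carrier a])
  also have "\<dots> = mapp ?L (mapp M ?h) a" by (rule mapp_mult[OF Lmat_carrier M a])
  finally show ?thesis unfolding n s_def using mapp_scale[of ?L "-1" "mapp M ?h" a] by simp
qed

lemma Hser_tendsto:
  assumes E: "expansion p F c" and ij: "i < p" "j < p"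
  shows "((\<lambda>z. Hser c z k i j) \<longlongrightarrow> Hser c 0 k i j) (at 0)"
proof -
  have "isCont (\<lambda>z. \<Sum>n. c (n + k) $$ (i,j) * z ^ n) (0::complex)"
    by (rule isCont_powser[of _ "1/2"]) (use expansion_summable[OF E _ ij, of "1/2" k] in auto)
  then show ?thesis unfolding Hser_def isCont_def .
qed

lemma F_tendsto:
  assumes E: "expansion p F c" and ij: "i < p" "j < p"
  shows "((\<lambda>z. F z $$ (i,j)) \<longlongrightarrow> Hser c 0 0 i j) (at 0)"
proof (rule Lim_transform_eventually[OF Hser_tendsto[OF E ij, of 0]])
  have "eventually (\<lambda>z::complex. z \<in> ball 0 1) (at 0)"
    by (rule eventually_at_in_open') auto
  then show "\<forall>\<^sub>F z in at 0. Hser c z 0 i j = F z $$ (i, j)"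
    by eventually_elim (simp add: Hser_0[OF E _ ij])
qed

text \<open>The vectors s and -M h solve the same triangular system up to the inhomogeneity d = (B - M Pi) v,
  which does not depend on z. The Weyl inequality bounds s near z = 0, hence d = z (s + M h) tends to 0
  in the first row where s + M h could fail to vanish.\<close>

lemma weyl_interpolation:
  assumes p: "0 < p" and adm: "admissible p \<beta>" and E: "expansion p F c"
    and weyl: "\<And>z x k. cmod z < 1 \<Longrightarrow> Jnorm p (tseq p \<beta> z (vinit p (F z) x) k) \<le> 0"
  shows "Mnv p \<beta> (Suc N*p) * Pimat p c N = Bmat p \<beta> (Suc N*p)"
proof -
  define n where "n = Suc N*p"
  have n: "Suc N*p = n" by (simp only: n_def)
  define M where "M = Mnv p \<beta> n"
  define L where "L = Lmat p \<beta> n"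
  have M: "M \<in> carrier_mat n n" by (simp add: M_def)
  have MA: "M * A0mat p n = L * M" unfolding M_def L_def n_def by (rule Mnv_intertwines)
  have P: "Pimat p c N \<in> carrier_mat n (2*p)" unfolding n_def by (rule Pimat_carrier)
  have MP: "M * Pimat p c N \<in> carrier_mat n (2*p)" by (rule mult_carrier_mat[OF M P])
  have second: "(M * Pimat p c N) $$ (a, m + p) = brow p \<beta> a (m + p)" if a: "a < n" and m: "m < p" for a m
  proof -
    define x where "x = (\<lambda>i. if i = m then 1 else 0 :: complex)"
    define d where "d a = brow p \<beta> a (m + p) - (M * Pimat p c N) $$ (a, m + p)" for a
    define v where "v z = vinit p (F z) x" for z
    \<comment> \<open>The first p columns of B and M Pi agree, so the part of v that depends on z
      drops out; the lower half of v is the unit vector x, which selects column m + p.\<close>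
    have dv: "bval p \<beta> a (v z) - mapp (M * Pimat p c N) (v z) a = d a" if "a < n" for a z
    proof -
      have "bval p \<beta> a (v z) - mapp (M * Pimat p c N) (v z) a
         = (\<Sum>e<2*p. (brow p \<beta> a e - (M * Pimat p c N) $$ (a,e)) * v z e)"
        unfolding bval_def mapp_def carrier_matD(2)[OF MP] by (simp only: left_diff_distrib sum_subtractf)
      also have "\<dots> = (\<Sum>e<p. 0) + (\<Sum>e<p. if e = m then d a else 0)"
        unfolding sum_lessThan_double
      proof (intro arg_cong2[of _ _ _ _ "(+)"] sum.cong refl)
        fix e assume "e \<in> {..<p}"
        then show "(brow p \<beta> a e - (M * Pimat p c N) $$ (a,e)) * v z e = 0"
          using Mnv_first_columns[of a N p e \<beta> c] that unfolding n M_def by simp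
      qed (auto simp: v_def vinit_def x_def d_def)
      finally show ?thesis using m by simp
    qed
    \<comment> \<open>Dividing by powers of z is harmless: z = 0 is approached only as a
      limit.\<close>
    define s where "s z a = bval p \<beta> a (tseq p \<beta> z (v z) (a div p)) / z ^ Suc (a div p)" for z a
    define s' where "s' z a = - mapp M (hvec p c z x) a" for z a
    have bs: "bval p \<beta> (k*p+i) (tseq p \<beta> z (v z) k) = z ^ Suc k * s z (k*p+i)" if "i < p" "z \<noteq> 0" for k i z
      using that by (simp add: s_def)
    have es: "z * s z a = bval p \<beta> a (v z) + (1 - z) * mapp L (s z) a" if a: "a < n" and z: "z \<noteq> 0" for z a
    proof -
      define k where "k = a div p"
      have "z ^ k * (z * s z a) = bval p \<beta> a (tseq p \<beta> z (v z) k)"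
        using z by (simp add: s_def k_def)
      also have "\<dots> = z ^ k * bval p \<beta> a (tau p \<beta> z (v z) (s z) k)"
        by (subst tseq_tau[of k p \<beta> z "v z" "s z"]) (simp_all only: bs z bval_scale not_False_eq_True)
      finally have "z * s z a = bval p \<beta> a (tau p \<beta> z (v z) (s z) k)" using z by simp
      then show ?thesis unfolding bval_tau L_def mapp_Lmat[OF a] k_def .
    qed
    have es': "z * s' z a = mapp (M * Pimat p c N) (v z) a + (1 - z) * mapp L (s' z) a"
      if a: "a < n" and z: "cmod z < 1" for z a
      using intertwined_hvec[OF E z M[folded n] MA[unfolded L_def, folded n] a[folded n], of x]
      unfolding s'_def v_def L_def n .
    \<comment> \<open>The single inequality for t_(N+1) bounds all s of the blocks up to N. The
      right side stays bounded as z tends to 0, since v converges there.\<close>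
    have bound: "(cmod (s z a))\<^sup>2 \<le> - Jnorm p (v z) / (1 - (cmod z)\<^sup>2)"
      if a: "a < n" and z: "z \<noteq> 0" "cmod z < 1" for z a
    proof -
      have "0 < 1 - (cmod z)\<^sup>2" using z by (simp add: power_less_one_iff)
      have "Jnorm p (tseq p \<beta> z (v z) (Suc N))
        = (cmod z) ^ (2*Suc N) * (Jnorm p (v z) + (1 - (cmod z)\<^sup>2) * (\<Sum>b<Suc N*p. (cmod (s z b))\<^sup>2))"
        using bs z by (intro Jform_tseq_sum[OF adm]) blast
      then have "(cmod z) ^ (2*Suc N) * (Jnorm p (v z) + (1 - (cmod z)\<^sup>2) * (\<Sum>b<n. (cmod (s z b))\<^sup>2)) \<le> 0"
        using weyl[OF z(2), of x "Suc N"] unfolding v_def n by simp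
      then have "Jnorm p (v z) + (1 - (cmod z)\<^sup>2) * (\<Sum>b<n. (cmod (s z b))\<^sup>2) \<le> 0"
        using z(1) mult_le_cancel_left_pos[of "cmod z ^ (2*Suc N)" _ 0]
            by (metis mult_zero_right zero_less_norm_iff zero_less_power)
      moreover have "(cmod (s z a))\<^sup>2 \<le> (\<Sum>b<n. (cmod (s z b))\<^sup>2)"
        using a by (intro member_le_sum) auto
      ultimately have "(1 - (cmod z)\<^sup>2) * (cmod (s z a))\<^sup>2 \<le> - Jnorm p (v z)"
        using \<open>0 < 1 - (cmod z)\<^sup>2\<close> by (smt (verit) mult_left_mono)
      then show ?thesis by (subst pos_le_divide_eq[OF \<open>0 < 1 - (cmod z)\<^sup>2\<close>]) (simp add: mult.commute)
    qed
    have near: "eventually (\<lambda>z::complex. z \<noteq> 0 \<and> cmod z < 1) (at 0)"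
    proof -
      have "eventually (\<lambda>z::complex. z \<in> ball 0 1) (at 0)"
        by (rule eventually_at_in_open') auto
      moreover have "eventually (\<lambda>z::complex. z \<noteq> 0) (at 0)" by (simp add: eventually_at_filter)
      ultimately show ?thesis by eventually_elim simp
    qed
    obtain w where w: "\<And>e. e < 2*p \<Longrightarrow> ((\<lambda>z. v z e) \<longlongrightarrow> w e) (at 0)"
    proof
      fix e assume "e < 2*p"
      then show "((\<lambda>z. v z e) \<longlongrightarrow> (if e < p then - (\<Sum>j<p. Hser c 0 0 e j * x j) else x (e - p))) (at 0)"
        unfolding v_def vinit_def by (auto intro!: tendsto_intros F_tendsto[OF E])
    qed
    have Jlim: "((\<lambda>z. Jform p (v z) (v z)) \<longlongrightarrow> Jform p w w) (at 0)"
      unfolding Jform_def by (intro tendsto_intros w) (auto simp: swap_half_lt)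
    have zs: "((\<lambda>z. z * s z a) \<longlongrightarrow> 0) (at 0)" if a: "a < n" for a
    proof -
      have "((\<lambda>z. (cmod z)\<^sup>2 * (- Jnorm p (v z) / (1 - (cmod z)\<^sup>2))) \<longlongrightarrow> (cmod 0)\<^sup>2 * (- Jnorm p w / (1
          - (cmod 0)\<^sup>2))) (at 0)"
        by (intro tendsto_intros Jlim) auto
      then have lim: "((\<lambda>z. (cmod z)\<^sup>2 * (- Jnorm p (v z) / (1 - (cmod z)\<^sup>2))) \<longlongrightarrow> 0) (at 0)" by simp
      have "((\<lambda>z. (cmod (z * s z a))\<^sup>2) \<longlongrightarrow> 0) (at 0)"
      proof (rule tendsto_sandwich[OF _ _ tendsto_const lim])
        show "\<forall>\<^sub>F z in at 0. (cmod (z * s z a))\<^sup>2 \<le> (cmod z)\<^sup>2 * (- Jnorm p (v z) / (1 - (cmod z)\<^sup>2))"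
          using near
        proof eventually_elim
          case (elim z)
          then show ?case unfolding norm_mult power_mult_distrib using bound[OF a]
              by (intro mult_left_mono) auto
        qed
      qed auto
      then have "((\<lambda>z. sqrt ((cmod (z * s z a))\<^sup>2)) \<longlongrightarrow> sqrt 0) (at 0)" by (rule tendsto_real_sqrt)
      then show ?thesis by (simp add: tendsto_norm_zero_iff)
    qed
    have zs': "((\<lambda>z. z * s' z a) \<longlongrightarrow> 0) (at 0)" if a: "a < n" for a
    proof -
      have "((\<lambda>z. z * - (\<Sum>b<n. M $$ (a,b) * (\<Sum>j<p. Hser c z (Suc (b div p)) (b mod p) j * x j)))
        \<longlongrightarrow> 0 * - (\<Sum>b<n. M $$ (a,b) * (\<Sum>j<p. Hser c 0 (Suc (b div p)) (b mod p) j * x j))) (at 0)"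
        using p by (intro tendsto_intros Hser_tendsto[OF E]) auto
      then show ?thesis unfolding s'_def mapp_def hvec_def carrier_matD(2)[OF M] by simp
    qed
    have "a < n \<longrightarrow> d a = 0 \<and> (\<forall>z. z \<noteq> 0 \<and> cmod z < 1 \<longrightarrow> s z a = s' z a)" for a
    proof (induction a rule: less_induct)
      case (less a)
      show ?case
      proof
        assume a: "a < n"
        have dz: "z * s z a - z * s' z a = d a" if z: "z \<noteq> 0" "cmod z < 1" for z
        proof -
          \<comment> \<open>Row a of L reaches only indices in earlier blocks, where s and s' agree
            by induction.\<close>
          have "mapp L (s z) a = mapp L (s' z) a"
            unfolding L_def mapp_Lmat[OF a]
          proof (intro sum.cong refl)
            fix b assume "b \<in> {..<a div p * p}"
            moreover have "a div p * p \<le> a" by simp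
            ultimately have "b < a" by (meson lessThan_iff less_le_trans)
            then show "gram p \<beta> a b * s z b = gram p \<beta> a b * s' z b" using less a z by simp
          qed
          then show ?thesis using es[OF a z(1)] es'[OF a z(2)] dv[OF a, of z] by simp
        qed
        have "((\<lambda>z. z * s z a - z * s' z a) \<longlongrightarrow> 0 - 0) (at 0)"
          by (intro tendsto_diff zs zs' a)
        then have "((\<lambda>z::complex. d a) \<longlongrightarrow> 0) (at 0)"
          using near by (simp, elim Lim_transform_eventually) (auto elim!: eventually_mono simp: dz)
        then have "d a = 0" by (metis LIM_const_eq)
        then show "d a = 0 \<and> (\<forall>z. z \<noteq> 0 \<and> cmod z < 1 \<longrightarrow> s z a = s' z a)"
          using dz by (simp flip: right_diff_distrib)
      qed
    qed
    then show ?thesis using a unfolding d_def by simp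
  qed
  show ?thesis unfolding n M_def[symmetric]
  proof (rule eq_matI)
    fix a e assume "a < dim_row (Bmat p \<beta> n)" "e < dim_col (Bmat p \<beta> n)"
    then have ae: "a < n" "e < 2*p" by (auto simp: Bmat_def)
    show "(M * Pimat p c N) $$ (a,e) = Bmat p \<beta> n $$ (a,e)"
    proof (cases "e < p")
      case True
      then show ?thesis using Mnv_first_columns[of a N p e \<beta> c] ae unfolding n M_def by (simp add: Bmat_def)
    next
      case False
      then show ?thesis using second[of a "e - p"] ae by (simp add: Bmat_def del: index_mult_mat(1))
    qed
  qed (use carrier_matD[OF MP] in \<open>auto simp: Bmat_def\<close>)
qed

section \<open>Triangular factorization of positive Toeplitz matrices\<close>

lemma sum_extend_zero:
  fixes f :: "nat \<Rightarrow> complex"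
  assumes "m \<le> n" "\<And>b. m \<le> b \<Longrightarrow> f b = 0"
  shows "(\<Sum>b<n. f b) = (\<Sum>b<m. f b)"
  using assms by (intro sum.mono_neutral_right) auto

text \<open>The row is the last row of the inverse of the leading submatrix of size a + 1, divided
  by the square root of its corner entry: row a of the inverse Cholesky factor. It does not refer to
  any order N, which makes the factors of all orders nested.\<close>

lemma triangular_row_exists:
  assumes p: "0 < p" and c: "\<And>k. c k \<in> carrier_mat p p" and pd: "\<And>N. pos_def (toeplitz p c N)"
  shows "\<exists>m. (\<forall>b>a. m b = 0) \<and> (\<forall>d<a. (\<Sum>b\<le>a. m b * Tent p c b d) = 0)
    \<and> (\<Sum>d\<le>a. (\<Sum>b\<le>a. m b * Tent p c b d) * cnj (m d)) = 1"
proof -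
  define n where "n = Suc a"
  define T where "T = mat n n (\<lambda>(a,b). Tent p c a b)"
  have T: "T \<in> carrier_mat n n" by (simp add: T_def)
  \<comment> \<open>The size a + 1 need not be a multiple of p, so the submatrix is placed inside
    the Toeplitz matrix with a + 1 blocks, and vectors are extended by zero.\<close>
  have nle: "n \<le> Suc a * p" using p unfolding n_def by (cases p) auto
  have pos: "0 < Re (qform T y)" if "\<exists>b<n. y b \<noteq> 0" for y
  proof -
    define y' where "y' b = (if b < n then y b else 0)" for b
    have "qform (toeplitz p c a) y' = (\<Sum>i<Suc a*p. \<Sum>j<Suc a*p. cnj (y' i) * Tent p c i j * y' j)"
      unfolding qform_def carrier_matD(1)[OF toeplitz_carrier]
          by (intro sum.cong) (auto simp: toeplitz_entry simp del: mult_Suc)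
    also have "\<dots> = (\<Sum>i<n. \<Sum>j<Suc a*p. cnj (y' i) * Tent p c i j * y' j)"
      by (rule sum_extend_zero[OF nle]) (simp add: y'_def)
    also have "\<dots> = (\<Sum>i<n. \<Sum>j<n. cnj (y' i) * Tent p c i j * y' j)"
      by (intro sum.cong refl sum_extend_zero[OF nle]) (simp add: y'_def)
    also have "\<dots> = qform T y" unfolding qform_def by (simp add: T_def y'_def)
    finally have "qform (toeplitz p c a) y' = qform T y" .
    moreover have "\<exists>b<dim_row (toeplitz p c a). y' b \<noteq> 0"
      using that nle unfolding carrier_matD(1)[OF toeplitz_carrier] y'_def by (meson less_le_trans)
    ultimately show ?thesis using pd[of a] unfolding pos_def_def by metis
  qed
  have "\<forall>b<n. x b = 0" if "\<forall>i<n. (\<Sum>b<n. T $$ (i,b) * x b) = 0" for x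
  proof (rule ccontr)
    assume "\<not> (\<forall>b<n. x b = 0)"
    then have "0 < Re (qform T x)" by (intro pos) auto
    moreover have "qform T x = 0"
      unfolding qform_mapp[OF T] mapp_def carrier_matD(2)[OF T] using that by simp
    ultimately show False by simp
  qed
  then obtain B where B: "B \<in> carrier_mat n n" "B * T = 1\<^sub>m n"
    using injective_imp_surjective[OF T] by metis
  have an: "a < n" by (simp add: n_def)
  define m0 where "m0 b = B $$ (a,b)" for b
  have m0: "(\<Sum>b<n. m0 b * Tent p c b d) = (if d = a then 1 else 0)" if "d < n" for d
  proof -
    have "(B * T) $$ (a,d) = (\<Sum>b<n. m0 b * Tent p c b d)"
      unfolding mat_mult_entry[OF B(1) T an that] m0_def using that by (intro sum.cong) (auto simp: T_def)
    then show ?thesis using B(2) that an by auto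
  qed
  \<comment> \<open>m0 T is the last unit row, so this form is the corner entry of the inverse, up
    to conjugation; it follows that m0 a is real and positive and has a square root.\<close>
  have q: "qform T (\<lambda>d. cnj (m0 d)) = cnj (m0 a)"
  proof -
    have "qform T (\<lambda>d. cnj (m0 d)) = (\<Sum>b<n. \<Sum>d<n. m0 b * Tent p c b d * cnj (m0 d))"
      unfolding qform_def by (simp add: T_def)
    also have "\<dots> = (\<Sum>d<n. \<Sum>b<n. m0 b * Tent p c b d * cnj (m0 d))" by (rule sum.swap)
    also have "\<dots> = (\<Sum>d<n. if d = a then cnj (m0 a) else 0)"
      unfolding sum_distrib_right[symmetric] by (intro sum.cong) (auto simp: m0)
    also have "\<dots> = cnj (m0 a)" using an by simp
    finally show ?thesis .
  qed
  have qreal: "cnj (qform T y) = qform T y" for y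
  proof -
    have "cnj (qform T y) = (\<Sum>i<n. \<Sum>j<n. cnj (y j) * Tent p c j i * y i)"
      unfolding qform_def by (simp add: T_def Tent_hermitian[OF c p] algebra_simps)
    also have "\<dots> = (\<Sum>j<n. \<Sum>i<n. cnj (y j) * Tent p c j i * y i)" by (rule sum.swap)
    also have "\<dots> = qform T y" unfolding qform_def by (simp add: T_def)
    finally show ?thesis .
  qed
  have "\<exists>b<n. cnj (m0 b) \<noteq> 0"
  proof (rule ccontr)
    assume "\<not> (\<exists>b<n. cnj (m0 b) \<noteq> 0)"
    then have "(\<Sum>b<n. m0 b * Tent p c b a) = 0" by auto
    then show False using m0[OF an] by simp
  qed
  then have "0 < Re (cnj (m0 a))" using pos q by metis
  then have r: "0 < Re (m0 a)" by simp
  define r where "r = Re (m0 a)"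
  have m0a: "m0 a = of_real r" using qreal[of "\<lambda>d. cnj (m0 d)"] unfolding q r_def
    by (simp add: complex_eq_iff)
  define t where "t = complex_of_real (1 / sqrt r)"
  have t: "t * cnj t * of_real r = 1"
    unfolding t_def using r r_def by (simp flip: of_real_mult)
  define m where "m b = (if b \<le> a then t * m0 b else 0)" for b
  have ms: "(\<Sum>b\<le>a. m b * Tent p c b d) = (if d = a then t else 0)" if "d \<le> a" for d
  proof -
    have "(\<Sum>b\<le>a. m b * Tent p c b d) = t * (\<Sum>b<n. m0 b * Tent p c b d)"
      unfolding sum_distrib_left n_def lessThan_Suc_atMost by (intro sum.cong) (auto simp: m_def)
    then show ?thesis using m0[of d] that by (simp add: n_def)
  qed
  have "(\<Sum>d\<le>a. (\<Sum>b\<le>a. m b * Tent p c b d) * cnj (m d)) = (\<Sum>d\<le>a. if d = a then t * cnj (m a) else 0)"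
    by (intro sum.cong) (auto simp: ms)
  also have "\<dots> = 1" using t by (simp add: m_def m0a algebra_simps)
  finally have "(\<Sum>d\<le>a. (\<Sum>b\<le>a. m b * Tent p c b d) * cnj (m d)) = 1" .
  moreover have "\<forall>b>a. m b = 0" by (simp add: m_def)
  moreover have "\<forall>d<a. (\<Sum>b\<le>a. m b * Tent p c b d) = 0" by (simp add: ms)
  ultimately show ?thesis by blast
qed

text \<open>M and T M^* = (M T)^* are lower triangular and A0 is strictly block lower triangular, so
  X = M A0 T M^* is strictly block lower triangular. The displacement equation becomes 1 + X + X^* =
  B J B^*: its diagonal blocks show that the rows of each \<beta>(k) are J-orthonormal, and its
  lower part that X = L.\<close>

lemma triangular_structure:
  assumes c: "\<And>k. c k \<in> carrier_mat p p"
    and M: "M \<in> carrier_mat (Suc N*p) (Suc N*p)"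
    and low: "\<And>a b. a < Suc N*p \<Longrightarrow> b < Suc N*p \<Longrightarrow> a < b \<Longrightarrow> M $$ (a,b) = 0"
    and up: "\<And>a d. a < Suc N*p \<Longrightarrow> d < a \<Longrightarrow> (M * toeplitz p c N) $$ (a,d) = 0"
    and MTM: "M * toeplitz p c N * adj M = 1\<^sub>m (Suc N*p)"
    and MP: "M * Pimat p c N = Bmat p \<beta> (Suc N*p)"
  shows "\<And>a b. a < Suc N*p \<Longrightarrow> b < Suc N*p \<Longrightarrow> a div p = b div p \<Longrightarrow> gram p \<beta> a b = (if a = b then 1 else 0)"
    and "M * A0mat p (Suc N*p) = Lmat p \<beta> (Suc N*p) * M"
proof -
  define n where "n = Suc N*p"
  have n: "Suc N*p = n" by (simp only: n_def)
  define T where "T = toeplitz p c N"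
  define A where "A = A0mat p n"
  note M = M[unfolded n] and low = low[unfolded n] and up = up[unfolded n, folded T_def]
    and MTM = MTM[unfolded n, folded T_def] and MP = MP[unfolded n]
  have T: "T \<in> carrier_mat n n" unfolding T_def n_def by (rule toeplitz_carrier)
  have hT: "adj T = T" unfolding T_def by (rule toeplitz_hermitian[OF c])
  have A: "A \<in> carrier_mat n n" "adj A \<in> carrier_mat n n" unfolding A_def by auto
  have aM: "adj M \<in> carrier_mat n n" using M by simp
  have P: "Pimat p c N \<in> carrier_mat n (2*p)" unfolding n_def by (rule Pimat_carrier)
  note sa = square_algebra[where n=n]
  have cm: "Y * Z \<in> carrier_mat n n" "Y + Z \<in> carrier_mat n n"
    if "Y \<in> carrier_mat n n" "Z \<in> carrier_mat n n" for Y Z :: "complex mat"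
    using that by (auto intro: mult_carrier_mat)
  note cs = M aM T A
  define V where "V = T * adj M"
  have V: "V \<in> carrier_mat n n" unfolding V_def by (intro cm cs)
  have aV: "adj V = M * T" unfolding V_def using adj_mult[OF T aM] hT by simp
  have Vz: "V $$ (d,e) = 0" if "d < e" "e < n" for d e
  proof -
    have "V $$ (d,e) = cnj (adj V $$ (e,d))" using adj_entry[OF V, of e d] that by simp
    then show ?thesis unfolding aV using up[of e d] that by simp
  qed
  define X where "X = M * (A * V)"
  have AV: "A * V \<in> carrier_mat n n" by (intro cm A V)
  have X: "X \<in> carrier_mat n n" unfolding X_def by (intro cm cs V)
  have Xz: "X $$ (a,e) = 0" if ae: "a < n" "e < n" and le: "a div p \<le> e div p" for a e
    unfolding X_def mat_mult_entry[OF M AV ae]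
  proof (rule sum.neutral, rule ballI)
    fix b assume "b \<in> {..<n}"
    then have b: "b < n" by simp
    show "M $$ (a,b) * (A * V) $$ (b,e) = 0"
    proof (cases "b \<le> a")
      case True
      have "(A * V) $$ (b,e) = 0"
        unfolding mat_mult_entry[OF A(1) V b ae(2)]
      proof (rule sum.neutral, rule ballI)
        fix d assume "d \<in> {..<n}"
        then have d: "d < n" by simp
        show "A $$ (b,d) * V $$ (d,e) = 0"
        proof (cases "d < e")
          case True
          then show ?thesis using Vz ae by simp
        next
          case False
          then have "e div p \<le> d div p" by (intro div_le_mono) simp
          moreover have "b div p \<le> a div p" using \<open>b \<le> a\<close> by (rule div_le_mono)
          ultimately have "b div p \<le> d div p" using le by simp
          then show ?thesis unfolding A_def A0mat_entry[OF b d] by (simp add: A0_def)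
        qed
      qed
      then show ?thesis by simp
    qed (use low ae b in auto)
  qed
  have aX: "adj X = M * T * adj A * adj M"
  proof -
    have "adj X = adj (A * V) * adj M" unfolding X_def by (rule adj_mult[OF M AV])
    also have "adj (A * V) = adj V * adj A" by (rule adj_mult[OF A(1) V])
    finally show ?thesis unfolding aV .
  qed
  have "1\<^sub>m n + X + adj X = M * T * adj M + M * (A * V) + M * T * adj A * adj M"
    unfolding aX MTM unfolding X_def ..
  also have "\<dots> = M * (T + A * T + T * adj A) * adj M"
    unfolding V_def by (simp only: sa cm cs)
  also have "T + A * T + T * adj A = Pimat p c N * Jmat p * adj (Pimat p c N)"
    unfolding T_def A_def n_def by (rule toeplitz_displacement[OF c])
  also have "M * (Pimat p c N * Jmat p * adj (Pimat p c N)) * adj M = Bmat p \<beta> n * Jmat p * adj (Bmat p \<beta> n)"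
    unfolding MP[symmetric] by (rule congruence_Jmat[OF M P])
  finally have main: "1\<^sub>m n + X + adj X = Bmat p \<beta> n * Jmat p * adj (Bmat p \<beta> n)" .
  have G: "gram p \<beta> a b = (if a = b then 1 else 0) + X $$ (a,b) + cnj (X $$ (b,a))" if ab: "a < n" "b < n"
      for a b
  proof -
    have "gram p \<beta> a b = Jform p (\<lambda>d. Bmat p \<beta> n $$ (a,d)) (\<lambda>d. Bmat p \<beta> n $$ (b,d))"
      unfolding gram_def using ab by (intro Jform_cong) (auto simp: Bmat_def)
    also have "\<dots> = (Bmat p \<beta> n * Jmat p * adj (Bmat p \<beta> n)) $$ (a,b)"
      using ab by (intro mult_Jmat_adj_entry[symmetric, OF Bmat_carrier Bmat_carrier])
    also have "\<dots> = (if a = b then 1 else 0) + X $$ (a,b) + cnj (X $$ (b,a))"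
      unfolding main[symmetric] using ab X by (simp add: adj_entry[OF X])
    finally show ?thesis .
  qed
  show "gram p \<beta> a b = (if a = b then 1 else 0)" if "a < Suc N*p" "b < Suc N*p" "a div p = b div p" for a b
    using G[of a b] Xz[of a b] Xz[of b a] that unfolding n by simp
  have XL: "X = Lmat p \<beta> n"
  proof (rule eq_matI)
    fix a b assume "a < dim_row (Lmat p \<beta> n)" "b < dim_col (Lmat p \<beta> n)"
    then have ab: "a < n" "b < n" by (auto simp: Lmat_def)
    show "X $$ (a,b) = Lmat p \<beta> n $$ (a,b)"
    proof (cases "b div p < a div p")
      case True
      then have "a \<noteq> b" by auto
      then show ?thesis using G[OF ab] Xz[OF ab(2,1)] True ab by (simp add: Lmat_def)
    next
      case False
      then show ?thesis using Xz[OF ab] ab by (simp add: Lmat_def)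
    qed
  qed (use X in \<open>auto simp: Lmat_def\<close>)
  \<comment> \<open>M^* M is the inverse of T, so X M collapses to M A0, which is the intertwining
    relation.\<close>
  have "X * M = M * A * (T * (adj M * M))"
    unfolding X_def V_def by (simp only: sa cm cs)
  also have "\<dots> = M * A"
    unfolding inverse_of_congruence(3)[OF T M hT MTM] by (rule right_mult_one_mat[OF cm(1)[OF M A(1)]])
  finally show "M * A0mat p (Suc N*p) = Lmat p \<beta> (Suc N*p) * M" unfolding XL A_def n ..
qed

section \<open>Potapov's inequality\<close>

text \<open>With this the limit of the growing Toeplitz forms follows from a one-step recursion, and
  no double series has to be rearranged.\<close>

lemma linear_recurrence_tendsto:
  fixes X y :: "nat \<Rightarrow> complex" and q :: complex
  assumes q: "cmod q < 1" and rec: "\<And>n. X (Suc n) = q * X n + y n" and y: "y \<longlonglongrightarrow> y0"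
  shows "X \<longlonglongrightarrow> y0 / (1 - q)"
proof -
  define w where "w = y0 / (1 - q)"
  define e where "e n = X n - w" for n
  have "1 - q \<noteq> 0" using q by auto
  then have "y0 = (1 - q) * w" by (simp add: w_def)
  then have erec: "e (Suc n) = q * e n + (y n - y0)" for n
    unfolding e_def rec by (simp add: algebra_simps)
  have "e \<longlonglongrightarrow> 0"
  proof (rule LIMSEQ_I)
    fix r :: real assume r: "0 < r"
    \<comment> \<open>The constant is chosen so that |q| r/2 + d = r/2, which lets the bound r/2
      reproduce itself in each step.\<close>
    define d where "d = r / 2 * (1 - cmod q)"
    have d: "0 < d" using r q by (simp add: d_def)
    from LIMSEQ_D[OF y d] obtain n0 where n0: "\<And>n. n \<ge> n0 \<Longrightarrow> cmod (y n - y0) < d" by blast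
    have b: "cmod (e (n0 + k)) \<le> cmod q ^ k * cmod (e n0) + r / 2" for k
    proof (induction k)
      case 0
      then show ?case using r by simp
    next
      case (Suc k)
      have "cmod (e (n0 + Suc k)) \<le> cmod q * cmod (e (n0 + k)) + d"
        using norm_triangle_ineq[of "q * e (n0 + k)" "y (n0 + k) - y0"] n0[of "n0 + k"]
        by (simp add: erec norm_mult)
      also have "\<dots> \<le> cmod q * (cmod q ^ k * cmod (e n0) + r / 2) + d"
        using Suc by (intro add_right_mono mult_left_mono) auto
      also have "\<dots> = cmod q ^ Suc k * cmod (e n0) + r / 2" by (simp add: d_def field_simps)
      finally show ?case .
    qed
    have "(\<lambda>k. cmod q ^ k * cmod (e n0) + r / 2) \<longlonglongrightarrow> 0 * cmod (e n0) + r / 2"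
      using q by (intro tendsto_intros LIMSEQ_realpow_zero) auto
    then have "eventually (\<lambda>k. cmod q ^ k * cmod (e n0) + r / 2 < r) sequentially"
      by (rule order_tendstoD) (use r in simp)
    then obtain k0 where k0: "\<And>k. k \<ge> k0 \<Longrightarrow> cmod q ^ k * cmod (e n0) + r / 2 < r"
      by (auto simp: eventually_sequentially)
    show "\<exists>no. \<forall>n\<ge>no. norm (e n - 0) < r"
    proof (intro exI allI impI)
      fix n assume "n \<ge> n0 + k0"
      then have "n = n0 + (n - n0)" "n - n0 \<ge> k0" by auto
      then show "norm (e n - 0) < r" using b[of "n - n0"] k0[of "n - n0"] by simp
    qed
  qed
  then show ?thesis unfolding e_def w_def by (rule LIM_zero_cancel)
qed

lemma sum_lessThan_add:
  fixes f :: "nat \<Rightarrow> 'a::comm_monoid_add"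
  shows "(\<Sum>a<s+t. f a) = (\<Sum>a<s. f a) + (\<Sum>a<t. f (s + a))"
  by (induction t) (auto simp: add.assoc)

lemma Tent_shift: "0 < p \<Longrightarrow> Tent p c (L*p + a) (L*p + b) = Tent p c a b"
  by (simp add: Tent_def)

lemma pos_def_imp_nonneg: "pos_def A \<Longrightarrow> 0 \<le> Re (qform A f)"
proof (cases "\<exists>a<dim_row A. f a \<noteq> 0")
  case False
  then show ?thesis by (simp add: qform_def)
qed (auto simp: pos_def_def intro: less_imp_le)

definition xform :: "nat \<Rightarrow> (nat \<Rightarrow> complex) \<Rightarrow> complex mat \<Rightarrow> complex" where
  "xform p x A = (\<Sum>i<p. \<Sum>j<p. cnj (x i) * A $$ (i,j) * x j)"

lemma xform_adj: "A \<in> carrier_mat p p \<Longrightarrow> xform p x (adj A) = cnj (xform p x A)"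
  unfolding xform_def cnj_sum by (subst sum.swap) (auto simp: adj_entry algebra_simps intro!: sum.cong)

lemma xform_add: "A \<in> carrier_mat p p \<Longrightarrow> B \<in> carrier_mat p p \<Longrightarrow> xform p x (A + B) = xform p x A + xform p x B"
  unfolding xform_def sum.distrib[symmetric] by (intro sum.cong) (auto simp: algebra_simps)

text \<open>The Toeplitz form at the block vector (z^(L-1) x, ..., z x, x), indexed by the
  exponents. The order of the blocks is thereby reversed, hence s_(k-l) in place of s_(l-k).\<close>

definition pole_form :: "nat \<Rightarrow> (nat \<Rightarrow> complex mat) \<Rightarrow> complex \<Rightarrow> (nat \<Rightarrow> complex) \<Rightarrow> nat \<Rightarrow> complex" where
  "pole_form p c z x L = (\<Sum>k<L. \<Sum>l<L. cnj z ^ k * z ^ l * xform p x (sseq c (int k - int l)))"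

text \<open>Splitting off the row and the column of exponent 0 leaves a copy shifted in both
  indices, which by the Toeplitz structure is |z|^2 times the previous form. The border is a partial
  sum of x^* F(z) x plus its conjugate.\<close>

lemma pole_form_Suc:
  assumes c: "\<And>k. c k \<in> carrier_mat p p"
  shows "pole_form p c z x (Suc L) = of_real ((cmod z)\<^sup>2) * pole_form p c z x L
    + ((\<Sum>l<Suc L. xform p x (c l) * z ^ l) + cnj (\<Sum>l<Suc L. xform p x (c l) * z ^ l))"
proof -
  define Y where "Y r = xform p x (sseq c r)" for r
  have Y0: "Y 0 = xform p x (c 0) + cnj (xform p x (c 0))"
    unfolding Y_def sseq_def using c[of 0] by (simp add: xform_add xform_adj)
  have Yp: "Y (1 + int k) = cnj (xform p x (c (Suc k)))" for k
    unfolding Y_def sseq_def using c[of "Suc k"] by (simp add: xform_adj nat_add_distrib)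
  have Yn: "Y (- 1 - int k) = xform p x (c (Suc k))" for k
    unfolding Y_def sseq_def by (simp add: nat_add_distrib)
  have Yd: "Y (1 + int k - (1 + int l)) = Y (int k - int l)" for k l by simp
  have "pole_form p c z x (Suc L)
      = (\<Sum>l<Suc L. z ^ l * Y (- int l)) + (\<Sum>k<L. \<Sum>l<Suc L. cnj z ^ Suc k * z ^ l * Y (1 + int k - int l))"
    unfolding pole_form_def Y_def[symmetric] sum.lessThan_Suc_shift[of _ L] by (simp add: mult.assoc)
  also have "(\<Sum>l<Suc L. z ^ l * Y (- int l)) = Y 0 + (\<Sum>l<L. xform p x (c (Suc l)) * z ^ Suc l)"
    unfolding sum.lessThan_Suc_shift by (simp add: Yn mult.commute)
  also have "(\<Sum>k<L. \<Sum>l<Suc L. cnj z ^ Suc k * z ^ l * Y (1 + int k - int l))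
    = (\<Sum>k<L. cnj z ^ Suc k * cnj (xform p x (c (Suc k))) + of_real ((cmod z)\<^sup>2) * (\<Sum>l<L. cnj z ^ k * z ^ l
        * Y (int k - int l)))"
  proof (intro sum.cong refl)
    fix k
    have "(\<Sum>l<Suc L. cnj z ^ Suc k * z ^ l * Y (1 + int k - int l))
       = cnj z ^ Suc k * Y (1 + int k) + (\<Sum>l<L. cnj z ^ Suc k * z ^ Suc l * Y (int k - int l))"
      unfolding sum.lessThan_Suc_shift by (simp add: Yd del: power_Suc)
    also have "(\<Sum>l<L. cnj z ^ Suc k * z ^ Suc l * Y (int k - int l))
        = of_real ((cmod z)\<^sup>2) * (\<Sum>l<L. cnj z ^ k * z ^ l * Y (int k - int l))"
      unfolding complex_norm_square sum_distrib_left by (intro sum.cong) (auto simp: algebra_simps)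
    finally show "(\<Sum>l<Suc L. cnj z ^ Suc k * z ^ l * Y (1 + int k - int l))
       = cnj z ^ Suc k * cnj (xform p x (c (Suc k))) + of_real ((cmod z)\<^sup>2) * (\<Sum>l<L. cnj z ^ k * z ^ l
           * Y (int k - int l))"
      unfolding Yp .
  qed
  also have "\<dots> = (\<Sum>k<L. cnj (xform p x (c (Suc k)) * z ^ Suc k)) + of_real ((cmod z)\<^sup>2) * pole_form p c z x L"
    unfolding pole_form_def Y_def[symmetric] sum.distrib sum_distrib_left by (simp add: mult.commute)
  finally show ?thesis
    unfolding sum.lessThan_Suc_shift[of "\<lambda>l. xform p x (c l) * z ^ l"] by (simp add: Y0 cnj_sum)
qed

lemma xform_sums:
  assumes E: "expansion p F c" and z: "cmod z < 1"
  shows "(\<lambda>l. xform p x (c l) * z ^ l) sums xform p x (F z)"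
proof -
  have "(\<lambda>l. \<Sum>i<p. \<Sum>j<p. cnj (x i) * (c l $$ (i,j) * z ^ l) * x j) sums (\<Sum>i<p. \<Sum>j<p. cnj (x i)
      * F z $$ (i,j) * x j)"
    using E z unfolding expansion_def by (intro sums_sum sums_mult sums_mult2) auto
  then show ?thesis unfolding xform_def sum_distrib_right by (simp add: mult_ac)
qed

lemma pole_form_tendsto:
  assumes E: "expansion p F c" and z: "cmod z < 1"
  shows "pole_form p c z x \<longlonglongrightarrow> (xform p x (F z) + cnj (xform p x (F z))) / (1 - of_real ((cmod z)\<^sup>2))"
proof -
  let ?y = "\<lambda>L. (\<Sum>l<Suc L. xform p x (c l) * z ^ l) + cnj (\<Sum>l<Suc L. xform p x (c l) * z ^ l)"
  have q: "cmod (complex_of_real ((cmod z)\<^sup>2)) < 1" using z by (simp add: power_less_one_iff norm_power)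
  have c: "c k \<in> carrier_mat p p" for k using E by (simp add: expansion_def)
  have "(\<lambda>L. \<Sum>l<Suc L. xform p x (c l) * z ^ l) \<longlonglongrightarrow> xform p x (F z)"
    using xform_sums[OF E z, of x] unfolding sums_def by (rule LIMSEQ_Suc)
  then have "?y \<longlonglongrightarrow> xform p x (F z) + cnj (xform p x (F z))"
    by (intro tendsto_add tendsto_cnj)
  then show ?thesis
    by (rule linear_recurrence_tendsto[where X = "pole_form p c z x" and y = ?y, OF q pole_form_Suc[OF c]])
qed

text \<open>The partial sums of \<open>hvec\<close>; these are what the cross terms of a finite
  Toeplitz form produce.\<close>

definition hpart :: "nat \<Rightarrow> (nat \<Rightarrow> complex mat) \<Rightarrow> complex \<Rightarrow> (nat \<Rightarrow> complex) \<Rightarrow> nat \<Rightarrow> nat \<Rightarrow> complex" where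
  "hpart p c z x L a = (\<Sum>j<p. (\<Sum>n<L. c (n + Suc (a div p)) $$ (a mod p, j) * z ^ n) * x j)"

lemma hpart_tendsto:
  assumes E: "expansion p F c" and z: "cmod z < 1" and p: "0 < p"
  shows "(\<lambda>L. hpart p c z x L a) \<longlonglongrightarrow> hvec p c z x a"
  unfolding hpart_def hvec_def Hser_def
  using p by (intro tendsto_sum tendsto_mult tendsto_const summable_LIMSEQ expansion_summable[OF E z]) auto

text \<open>The block Toeplitz form is evaluated on the block vector (z^(L-1) x, ..., z x, x, -g); letting L tend to
  infinity gives the inequality of Potapov for the Caratheodory function.\<close>

lemma toeplitz_form_split:
  fixes z :: complex and x g :: "nat \<Rightarrow> complex"
  assumes c: "\<And>k. c k \<in> carrier_mat p p" and p: "0 < p"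
  defines "f \<equiv> \<lambda>L a. if a < L*p then z ^ (L - Suc (a div p)) * x (a mod p) else - g (a - L*p)"
  shows "(\<Sum>a<(L+m)*p. \<Sum>b<(L+m)*p. cnj (f L a) * Tent p c a b * f L b)
    = pole_form p c z x L - (\<Sum>a<m*p. cnj (g a) * hpart p c z x L a) - cnj (\<Sum>a<m*p. cnj (g a)
        * hpart p c z x L a)
      + (\<Sum>a<m*p. \<Sum>b<m*p. cnj (g a) * Tent p c a b * g b)"
proof -
  let ?T = "Tent p c"
  have f1: "f L (k*p+i) = z ^ (L - Suc k) * x i" if "k < L" "i < p" for k i
  proof -
    have "k*p+i < L*p"
      using that mult_le_mono1[of "Suc k" L p] by simp
    then show ?thesis using that by (simp add: f_def)
  qed
  have f2: "f L (L*p+a) = - g a" for a by (simp add: f_def)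
  have A: "(\<Sum>a<L*p. \<Sum>b<L*p. cnj (f L a) * ?T a b * f L b) = pole_form p c z x L"
  proof -
    have "(\<Sum>a<L*p. \<Sum>b<L*p. cnj (f L a) * ?T a b * f L b)
      = (\<Sum>k<L. \<Sum>i<p. \<Sum>l<L. \<Sum>j<p. cnj (f L (k*p+i)) * ?T (k*p+i) (l*p+j) * f L (l*p+j))"
      unfolding sum_blocks ..
    also have "\<dots> = (\<Sum>k<L. \<Sum>l<L. \<Sum>i<p. \<Sum>j<p. cnj (f L (k*p+i)) * ?T (k*p+i) (l*p+j) * f L (l*p+j))"
      by (intro sum.cong refl sum.swap)
    also have "\<dots> = (\<Sum>k<L. \<Sum>l<L. cnj z ^ (L - Suc k) * z ^ (L - Suc l) * xform p x (sseq c (int l - int k)))"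
    proof (intro sum.cong refl)
      fix k l assume kl: "k \<in> {..<L}" "l \<in> {..<L}"
      have "(\<Sum>i<p. \<Sum>j<p. cnj (f L (k*p+i)) * ?T (k*p+i) (l*p+j) * f L (l*p+j))
        = (\<Sum>i<p. \<Sum>j<p. cnj (z ^ (L - Suc k) * x i) * sseq c (int l - int k) $$ (i,j) * (z ^ (L - Suc l) * x j))"
        using kl by (intro sum.cong refl) (simp add: f1 Tent_def)
      then show "(\<Sum>i<p. \<Sum>j<p. cnj (f L (k*p+i)) * ?T (k*p+i) (l*p+j) * f L (l*p+j))
        = cnj z ^ (L - Suc k) * z ^ (L - Suc l) * xform p x (sseq c (int l - int k))"
        by (simp add: xform_def sum_distrib_left mult_ac)
    qed
    \<comment> \<open>The differences of block indices are rewritten as differences of exponents, so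
      that the reversal k to L - 1 - k leads to \<open>pole_form\<close>.\<close>
    also have "\<dots> = (\<Sum>k<L. \<Sum>l<L. cnj z ^ (L - Suc k) * z ^ (L - Suc l) * xform p x (sseq c (int (L - Suc k)
        - int (L - Suc l))))"
      by (intro sum.cong refl arg_cong[of _ _ "\<lambda>r. _ * xform p x (sseq c r)"]) auto
    also have "\<dots> = (\<Sum>k<L. \<Sum>l<L. cnj z ^ (L - Suc k) * z ^ l * xform p x (sseq c (int (L - Suc k) - int l)))"
      by (intro sum.cong refl sum.nat_diff_reindex)
    also have "\<dots> = pole_form p c z x L"
      unfolding pole_form_def by (rule sum.nat_diff_reindex)
    finally show ?thesis .
  qed
  have hp: "(\<Sum>b<L*p. ?T (L*p+a) b * f L b) = hpart p c z x L a" for a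
  proof -
    have "(\<Sum>b<L*p. ?T (L*p+a) b * f L b) = (\<Sum>k<L. \<Sum>j<p. ?T (L*p+a) (k*p+j) * f L (k*p+j))"
      unfolding sum_blocks ..
    also have "\<dots> = (\<Sum>k<L. \<Sum>j<p. c ((L - Suc k) + Suc (a div p)) $$ (a mod p, j) * z ^ (L - Suc k) * x j)"
    proof (intro sum.cong refl)
      fix k j assume kj: "k \<in> {..<L}" "j \<in> {..<p}"
      \<comment> \<open>Block row L + a div p and block column k are L - k + a div p apart; the
        number is split into the exponent of z and the shift used in \<open>hvec\<close>.\<close>
      then have "int k - int ((L*p+a) div p) < 0" "nat (- (int k - int ((L*p+a) div p)))
          = (L - Suc k) + Suc (a div p)"
        using p by auto
      then show "?T (L*p+a) (k*p+j) * f L (k*p+j)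
          = c ((L - Suc k) + Suc (a div p)) $$ (a mod p, j) * z ^ (L - Suc k) * x j"
        using kj by (simp add: f1 Tent_def sseq_def block_index)
    qed
    also have "\<dots> = (\<Sum>k<L. \<Sum>j<p. c (k + Suc (a div p)) $$ (a mod p, j) * z ^ k * x j)"
      by (rule sum.nat_diff_reindex[of "\<lambda>k. \<Sum>j<p. c (k + Suc (a div p)) $$ (a mod p, j) * z ^ k * x j"])
    also have "\<dots> = hpart p c z x L a"
      unfolding hpart_def sum_distrib_right by (rule sum.swap)
    finally show ?thesis .
  qed
  have C: "(\<Sum>a<m*p. \<Sum>b<L*p. cnj (f L (L*p+a)) * ?T (L*p+a) b * f L b)
      = - (\<Sum>a<m*p. cnj (g a) * hpart p c z x L a)"
    unfolding hp[symmetric] f2 by (simp add: sum_distrib_left sum_negf mult.assoc)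
  have B: "(\<Sum>a<L*p. \<Sum>b<m*p. cnj (f L a) * ?T a (L*p+b) * f L (L*p+b))
      = cnj (- (\<Sum>a<m*p. cnj (g a) * hpart p c z x L a))"
    unfolding C[symmetric] cnj_sum
    by (subst sum.swap) (simp add: Tent_hermitian[OF c p] algebra_simps)
  have D: "(\<Sum>a<m*p. \<Sum>b<m*p. cnj (f L (L*p+a)) * ?T (L*p+a) (L*p+b) * f L (L*p+b))
      = (\<Sum>a<m*p. \<Sum>b<m*p. cnj (g a) * ?T a b * g b)"
    unfolding f2 Tent_shift[OF p] by simp
  have "(\<Sum>a<(L+m)*p. \<Sum>b<(L+m)*p. cnj (f L a) * ?T a b * f L b)
    = (\<Sum>a<L*p. \<Sum>b<L*p. cnj (f L a) * ?T a b * f L b) + (\<Sum>a<L*p. \<Sum>b<m*p. cnj (f L a) * ?T a (L*p+b)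
        * f L (L*p+b))
     + ((\<Sum>a<m*p. \<Sum>b<L*p. cnj (f L (L*p+a)) * ?T (L*p+a) b * f L b)
     + (\<Sum>a<m*p. \<Sum>b<m*p. cnj (f L (L*p+a)) * ?T (L*p+a) (L*p+b) * f L (L*p+b)))"
    unfolding add_mult_distrib sum_lessThan_add sum.distrib by (simp only: add_ac)
  then show ?thesis unfolding A B C D by simp
qed

text \<open>Potapov's inequality before optimization: the best g is T^-1 h. With g left free, no
  inverse takes part in the passage to the limit.\<close>

lemma potapov_inequality:
  assumes E: "expansion p F c" and z: "cmod z < 1" and p: "0 < p" and pd: "\<And>N. pos_def (toeplitz p c N)"
  shows "2 * Re (\<Sum>a<Suc N*p. cnj (g a) * hvec p c z x a)
    \<le> 2 * Re (xform p x (F z)) / (1 - (cmod z)\<^sup>2) + Re (qform (toeplitz p c N) g)"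
proof -
  have c: "c k \<in> carrier_mat p p" for k using E by (simp add: expansion_def)
  let ?n = "Suc N*p"
  define S where "S L = (\<Sum>a<?n. cnj (g a) * hpart p c z x L a)" for L
  define G where "G = (\<Sum>a<?n. \<Sum>b<?n. cnj (g a) * Tent p c a b * g b)"
  have qT: "qform (toeplitz p c M) f = (\<Sum>a<Suc M*p. \<Sum>b<Suc M*p. cnj (f a) * Tent p c a b * f b)" for M f
    unfolding qform_def carrier_matD(1)[OF toeplitz_carrier]
        by (intro sum.cong) (auto simp: toeplitz_entry simp del: mult_Suc)
  have pos: "0 \<le> Re (pole_form p c z x L - S L - cnj (S L) + G)" for L
    using pos_def_imp_nonneg[OF pd, of "L + N"]
    unfolding S_def G_def toeplitz_form_split[OF c p, symmetric] qT by simp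
  have "(\<lambda>L. pole_form p c z x L - S L - cnj (S L) + G) \<longlonglongrightarrow>
     (xform p x (F z) + cnj (xform p x (F z))) / (1 - of_real ((cmod z)\<^sup>2))
      - (\<Sum>a<?n. cnj (g a) * hvec p c z x a) - cnj (\<Sum>a<?n. cnj (g a) * hvec p c z x a) + G"
    unfolding S_def by (intro tendsto_intros tendsto_cnj pole_form_tendsto[OF E z] hpart_tendsto[OF E z p])
  then have "(\<lambda>L. Re (pole_form p c z x L - S L - cnj (S L) + G)) \<longlonglongrightarrow>
     Re ((xform p x (F z) + cnj (xform p x (F z))) / (1 - of_real ((cmod z)\<^sup>2))
      - (\<Sum>a<?n. cnj (g a) * hvec p c z x a) - cnj (\<Sum>a<?n. cnj (g a) * hvec p c z x a) + G)"
    by (rule tendsto_Re)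
  then have "0 \<le> Re ((xform p x (F z) + cnj (xform p x (F z))) / (1 - of_real ((cmod z)\<^sup>2))
      - (\<Sum>a<?n. cnj (g a) * hvec p c z x a) - cnj (\<Sum>a<?n. cnj (g a) * hvec p c z x a) + G)"
    by (rule LIMSEQ_le_const) (use pos in auto)
  moreover have "(xform p x (F z) + cnj (xform p x (F z))) / (1 - of_real ((cmod z)\<^sup>2))
      = of_real (2 * Re (xform p x (F z)) / (1 - (cmod z)\<^sup>2))"
    unfolding complex_add_cnj by simp
  ultimately show ?thesis unfolding qT G_def[symmetric] by (simp del: mult_Suc)
qed

section \<open>The main theorem\<close>

text \<open>Hence the Weyl inequality for t_0 is the Caratheodory condition itself.\<close>

lemma Jform_vinit: "Jnorm p (vinit p A x) = - 2 * Re (xform p x A)"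
proof -
  have "Jform p (vinit p A x) (vinit p A x)
    = (\<Sum>i<p. x i * cnj (- (\<Sum>j<p. A $$ (i,j) * x j))) + (\<Sum>i<p. - (\<Sum>j<p. A $$ (i,j) * x j) * cnj (x i))"
    unfolding Jform_def sum_lessThan_double
    by (intro arg_cong2[of _ _ _ _ "(+)"] sum.cong) (auto simp: vinit_def swap_half_def)
  also have "(\<Sum>i<p. - (\<Sum>j<p. A $$ (i,j) * x j) * cnj (x i)) = - xform p x A"
    unfolding xform_def by (simp add: sum_distrib_left sum_distrib_right sum_negf mult_ac)
  also have "(\<Sum>i<p. x i * cnj (- (\<Sum>j<p. A $$ (i,j) * x j))) = - cnj (xform p x A)"
    unfolding xform_def by (simp add: sum_distrib_left sum_distrib_right sum_negf cnj_sum mult_ac)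
  finally show ?thesis by simp
qed

lemma weyl_congruence:
  assumes p: "0 < p" and adm: "admissible p \<beta>" and w: "is_weyl p \<beta> \<phi>" and E: "expansion p (Ftrans \<phi>) c"
  obtains M where "M \<in> carrier_mat (Suc N*p) (Suc N*p)" "M * toeplitz p c N * adj M = 1\<^sub>m (Suc N*p)"
    "M * Pimat p c N = Bmat p \<beta> (Suc N*p)"
proof -
  have c: "c k \<in> carrier_mat p p" for k using E by (simp add: expansion_def)
  have MP: "Mnv p \<beta> (Suc N*p) * Pimat p c N = Bmat p \<beta> (Suc N*p)"
    using w unfolding is_weyl_iff[OF adm] by (intro weyl_interpolation[OF p adm E]) auto
  show thesis
    by (rule that[OF Mnv_carrier congruence_toeplitz[OF c adm p Mnv_carrier Mnv_intertwines MP] MP])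
qed

lemma weyl_toeplitz_pos_def:
  assumes p: "0 < p" and adm: "admissible p \<beta>" and w: "is_weyl p \<beta> \<phi>" and E: "expansion p (Ftrans \<phi>) c"
  shows "pos_def (toeplitz p c N)"
    "adj (Pimat p c N) * minv (toeplitz p c N) * Pimat p c N = msum (2*p) (\<lambda>k. adj (\<beta> k) * \<beta> k) {..N}"
proof -
  define n where "n = Suc N*p"
  have n: "Suc N*p = n" by (simp only: n_def)
  obtain M where "M \<in> carrier_mat (Suc N*p) (Suc N*p)" "M * toeplitz p c N * adj M = 1\<^sub>m (Suc N*p)"
    "M * Pimat p c N = Bmat p \<beta> (Suc N*p)" using weyl_congruence[OF assms] .
  then have M: "M \<in> carrier_mat n n" and MTM: "M * toeplitz p c N * adj M = 1\<^sub>m n" and MP: "M * Pimat p c N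
      = Bmat p \<beta> n"
    unfolding n by auto
  have c: "c k \<in> carrier_mat p p" for k using E by (simp add: expansion_def)
  have T: "toeplitz p c N \<in> carrier_mat n n" unfolding n_def by (rule toeplitz_carrier)
  have P: "Pimat p c N \<in> carrier_mat n (2*p)" unfolding n_def by (rule Pimat_carrier)
  have aP: "adj (Pimat p c N) \<in> carrier_mat (2*p) n" using P by (rule adj_carrier)
  have aM: "adj M \<in> carrier_mat n n" using M by (rule adj_carrier)
  note inv = inverse_of_congruence[OF T M toeplitz_hermitian[OF c] MTM]
  show "pos_def (toeplitz p c N)" by (rule inv(1))
  have "adj (Pimat p c N) * minv (toeplitz p c N) * Pimat p c N = adj (Pimat p c N) * adj M * M * Pimat p c N"
    unfolding inv(2) assoc_mult_mat[OF aP aM M] ..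
  also have "\<dots> = (adj (Pimat p c N) * adj M) * (M * Pimat p c N)"
    by (rule assoc_mult_mat[OF mult_carrier_mat[OF aP aM] M P])
  also have "\<dots> = adj (M * Pimat p c N) * (M * Pimat p c N)" unfolding adj_mult[OF M P] ..
  also have "\<dots> = msum (2*p) (\<lambda>k. adj (\<beta> k) * \<beta> k) {..N}"
    unfolding MP n_def using adm by (intro Bmat_gram_sum) (simp add: admissible_def)
  finally show "adj (Pimat p c N) * minv (toeplitz p c N) * Pimat p c N
      = msum (2*p) (\<lambda>k. adj (\<beta> k) * \<beta> k) {..N}" .
qed

lemma Ftrans_carrier:
  assumes "\<forall>l\<in>lower_hp. \<phi> l \<in> carrier_mat p p" "cmod z < 1"
  shows "Ftrans \<phi> z \<in> carrier_mat p p"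
  unfolding Ftrans_def using assms mobius_in_lower_hp[of z] by (intro smult_carrier_mat) auto

lemma Ftrans_holomorphic:
  assumes c: "\<forall>l\<in>lower_hp. \<phi> l \<in> carrier_mat p p"
    and h: "\<forall>a<p. \<forall>b<p. (\<lambda>l. \<phi> l $$ (a,b)) holomorphic_on lower_hp" and ab: "a < p" "b < p"
  shows "(\<lambda>z. Ftrans \<phi> z $$ (a,b)) holomorphic_on ball 0 1"
proof -
  have "((\<lambda>l. \<phi> l $$ (a,b)) \<circ> (\<lambda>z. \<i> * (z + 1) / (z - 1))) holomorphic_on ball 0 1"
  proof (rule holomorphic_on_compose_gen)
    show "(\<lambda>z. \<i> * (z + 1) / (z - 1)) holomorphic_on ball 0 1"
      by (intro holomorphic_intros) auto
    show "(\<lambda>l. \<phi> l $$ (a,b)) holomorphic_on lower_hp" using h ab by blast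
    show "(\<lambda>z. \<i> * (z + 1) / (z - 1)) ` ball 0 1 \<subseteq> lower_hp" using mobius_in_lower_hp by auto
  qed
  then have "(\<lambda>z. \<i> * \<phi> (\<i> * (z + 1) / (z - 1)) $$ (a,b)) holomorphic_on ball 0 1"
    unfolding o_def by (intro holomorphic_intros)
  then show ?thesis
  proof (rule holomorphic_transform)
    fix z :: complex assume "z \<in> ball 0 1"
    then have "\<phi> (\<i> * (z + 1) / (z - 1)) \<in> carrier_mat p p" using c mobius_in_lower_hp[of z] by auto
    then show "\<i> * \<phi> (\<i> * (z + 1) / (z - 1)) $$ (a,b) = Ftrans \<phi> z $$ (a,b)"
      unfolding Ftrans_def using ab by simp
  qed
qed

lemma holomorphic_expansion_exists:
  assumes h: "\<And>a b. a < p \<Longrightarrow> b < p \<Longrightarrow> (\<lambda>z. F z $$ (a,b)) holomorphic_on ball 0 1"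
  shows "\<exists>c. expansion p F c"
proof -
  define c where "c k = mat p p (\<lambda>(a,b). (deriv ^^ k) (\<lambda>z. F z $$ (a,b)) 0 / fact k)" for k
  have "expansion p F c" unfolding expansion_def
  proof (intro conjI allI impI ballI)
    show "c k \<in> carrier_mat p p" for k by (simp add: c_def)
    fix z :: complex and a b assume "z \<in> ball 0 1" "a < p" "b < p"
    then show "(\<lambda>k. c k $$ (a,b) * z ^ k) sums (F z $$ (a,b))"
      using holomorphic_power_series[OF h] by (simp add: c_def)
  qed
  then show ?thesis by blast
qed

lemma qform_real_part:
  assumes A: "A \<in> carrier_mat p p"
  shows "qform (A + adj A) x = of_real (2 * Re (xform p x A))"
proof -
  have "A + adj A \<in> carrier_mat p p" using A by simp
  then have d: "dim_row (A + adj A) = p" by (rule carrier_matD(1))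
  have "qform (A + adj A) x = xform p x (A + adj A)" unfolding qform_def xform_def d ..
  also have "\<dots> = xform p x A + cnj (xform p x A)" using A by (simp add: xform_add xform_adj)
  finally show ?thesis by (simp add: complex_add_cnj)
qed

lemma weyl_imp_caratheodory:
  assumes adm: "admissible p \<beta>" and w: "is_weyl p \<beta> \<phi>"
  shows "caratheodory p (Ftrans \<phi>)"
proof -
  note W = w[unfolded is_weyl_iff[OF adm]]
  have F: "Ftrans \<phi> z \<in> carrier_mat p p" if "cmod z < 1" for z
    using Ftrans_carrier[OF _ that] W by blast
  show ?thesis unfolding caratheodory_def
  proof (intro conjI ballI allI impI)
    show "(\<lambda>z. Ftrans \<phi> z $$ (a,b)) holomorphic_on ball 0 1" if "a < p" "b < p" for a b
      using Ftrans_holomorphic[OF _ _ that] W by blast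
    fix z :: complex assume "z \<in> ball 0 1"
    then have z: "cmod z < 1" by simp
    then show "Ftrans \<phi> z \<in> carrier_mat p p" by (rule F)
    have "0 \<le> Re (qform (Ftrans \<phi> z + adj (Ftrans \<phi> z)) x)" for x
    proof -
      have "Jnorm p (tseq p \<beta> z (vinit p (Ftrans \<phi> z) x) 0) \<le> 0"
        using W \<open>z \<in> ball 0 1\<close> by blast
      then show ?thesis unfolding qform_real_part[OF F[OF z]] by (simp add: Jform_vinit)
    qed
    moreover have "herm (Ftrans \<phi> z + adj (Ftrans \<phi> z))"
      unfolding herm_def using F[OF z]
      by (auto simp: adj_def intro!: eq_matI)
    ultimately show "pos_semidef (Ftrans \<phi> z + adj (Ftrans \<phi> z))" unfolding pos_semidef_def by blast
  qed
qed

text \<open>s = -M h satisfies the recursion of the system, and |s|^2 = h^* T^-1 h. So the form at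
  t_(N+1) is |z|^(2N+2) times the difference of the two sides of Potapov's inequality; dropping the
  nonnegative term |s|^2 gives the sign at t_0.\<close>

lemma triangular_factor_weyl:
  assumes p: "0 < p" and adm: "admissible p \<beta>" and E: "expansion p F c" and pd: "\<And>N. pos_def (toeplitz p c N)"
    and z: "cmod z < 1"
    and M: "M \<in> carrier_mat (Suc N*p) (Suc N*p)" and MTM: "M * toeplitz p c N * adj M = 1\<^sub>m (Suc N*p)"
    and MP: "M * Pimat p c N = Bmat p \<beta> (Suc N*p)"
    and MA: "M * A0mat p (Suc N*p) = Lmat p \<beta> (Suc N*p) * M"
  shows "Jnorm p (vinit p (F z) x) \<le> 0"
    "Jnorm p (tseq p \<beta> z (vinit p (F z) x) (Suc N)) \<le> 0"
proof -
  define n where "n = Suc N*p"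
  have n: "Suc N*p = n" by (simp only: n_def)
  have c: "c k \<in> carrier_mat p p" for k using E by (simp add: expansion_def)
  define v where "v = vinit p (F z) x"
  let ?h = "hvec p c z x" and ?T = "toeplitz p c N"
  define s where "s a = - mapp M ?h a" for a
  have es: "z * s a = bval p \<beta> a v + (1 - z) * mapp (Lmat p \<beta> n) s a" if "a < n" for a
  proof -
    have "mapp (Bmat p \<beta> n) v a = bval p \<beta> a v"
      unfolding mapp_def bval_def carrier_matD(2)[OF Bmat_carrier] using that
          by (intro sum.cong) (auto simp: Bmat_def)
    then show ?thesis
      using intertwined_hvec[OF E z M MA, of a x] that unfolding MP n s_def v_def by simp
  qed
  \<comment> \<open>Here s is given beforehand and the relation is proved by induction, without
    division; thus z = 0 is included.\<close>
  have bs: "bval p \<beta> (k*p+i) (tseq p \<beta> z v k) = z ^ Suc k * s (k*p+i)" if "k < Suc N" "i < p" for k i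
    using that
  proof (induction k arbitrary: i rule: less_induct)
    case (less k)
    have a: "k*p+i < n" unfolding n_def using less.prems by (intro block_index_lt) auto
    have t: "tseq p \<beta> z v k = (\<lambda>c. z ^ k * tau p \<beta> z v s k c)"
      using less by (intro tseq_tau) auto
    have "bval p \<beta> (k*p+i) (tseq p \<beta> z v k) = z ^ k * bval p \<beta> (k*p+i) (tau p \<beta> z v s k)"
      unfolding t by (rule bval_scale)
    also have "bval p \<beta> (k*p+i) (tau p \<beta> z v s k) = z * s (k*p+i)"
      unfolding es[OF a] mapp_Lmat[OF a] bval_tau using less.prems by simp
    finally show ?case by simp
  qed
  have J: "Jnorm p (tseq p \<beta> z v (Suc N))
    = (cmod z) ^ (2*Suc N) * (Jnorm p v + (1 - (cmod z)\<^sup>2) * (\<Sum>b<Suc N*p. (cmod (s b))\<^sup>2))"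
    using bs by (intro Jform_tseq_sum[OF adm])
  note M = M[unfolded n] and MTM = MTM[unfolded n]
  have T: "?T \<in> carrier_mat n n" unfolding n_def by (rule toeplitz_carrier)
  have aM: "adj M \<in> carrier_mat n n" using M by (rule adj_carrier)
  have MM: "adj M * M \<in> carrier_mat n n" by (rule mult_carrier_mat[OF aM M])
  note inv = inverse_of_congruence[OF T M toeplitz_hermitian[OF c] MTM]
  \<comment> \<open>The optimal choice g = T^-1 h. Then g^* h = g^* T g = Q, and the inequality for
    2 Q becomes one for Q.\<close>
  define g where "g = mapp (adj M * M) ?h"
  define Q where "Q = (\<Sum>b<n. (cmod (s b))\<^sup>2)"
  have "(\<Sum>a<n. cnj (?h a) * g a) = of_real Q"
  proof -
    have "(\<Sum>a<n. cnj (?h a) * g a) = qform (adj M * M) ?h" unfolding g_def qform_mapp[OF MM] ..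
    also have "\<dots> = qform (adj M * 1\<^sub>m n * M) ?h" by (simp add: right_mult_one_mat[OF aM])
    also have "\<dots> = qform (1\<^sub>m n) (mapp M ?h)" by (rule qform_congruence[OF M]) simp
    finally show ?thesis unfolding qform_one Q_def s_def by simp
  qed
  then have "cnj (\<Sum>a<n. cnj (?h a) * g a) = of_real Q" by simp
  then have gh: "(\<Sum>a<n. cnj (g a) * ?h a) = of_real Q" by (simp add: cnj_sum mult.commute)
  have Tg: "mapp ?T g a = ?h a" if a: "a < n" for a
  proof -
    have "mapp ?T g a = mapp (?T * (adj M * M)) ?h a" unfolding g_def by (rule mapp_mult[symmetric, OF T MM a])
    also have "\<dots> = (\<Sum>b<n. if b = a then ?h b else 0)"
      unfolding inv(3) mapp_def using a by (intro sum.cong) auto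
    finally show ?thesis using a by simp
  qed
  have "qform ?T g = of_real Q"
    unfolding qform_mapp[OF T] gh[symmetric] by (intro sum.cong) (auto simp: Tg)
  then have "Q \<le> 2 * Re (xform p x (F z)) / (1 - (cmod z)\<^sup>2)"
    using potapov_inequality[OF E z p pd, where N=N and g=g and x=x] gh unfolding n by simp
  moreover have q: "0 < 1 - (cmod z)\<^sup>2" using z by (simp add: power_less_one_iff)
  ultimately have "(1 - (cmod z)\<^sup>2) * Q \<le> 2 * Re (xform p x (F z))"
    by (simp add: pos_le_divide_eq mult.commute)
  then have main: "Jnorm p v + (1 - (cmod z)\<^sup>2) * Q \<le> 0"
    unfolding v_def Jform_vinit by simp
  have "0 \<le> Q" unfolding Q_def by (simp add: sum_nonneg)
  then have "0 \<le> (1 - (cmod z)\<^sup>2) * Q" using q by simp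
  then show "Jnorm p (vinit p (F z) x) \<le> 0" using main unfolding v_def by linarith
  show "Jnorm p (tseq p \<beta> z (vinit p (F z) x) (Suc N)) \<le> 0"
    using J main unfolding v_def n Q_def by (simp only: mult_nonneg_nonpos zero_le_power norm_ge_zero)
qed

text \<open>The rows are chosen once and for all orders, so the products with Pi define one sequence
  \<beta>. Its admissibility at index k is read off from the factorization of order N = k.\<close>

lemma positive_toeplitz_factorization:
  assumes p: "0 < p" and c: "\<And>k. c k \<in> carrier_mat p p" and pd: "\<And>N. pos_def (toeplitz p c N)"
  obtains \<beta> where "admissible p \<beta>"
    "\<And>N. \<exists>M. M \<in> carrier_mat (Suc N*p) (Suc N*p) \<and> M * toeplitz p c N * adj M = 1\<^sub>m (Suc N*p) \<and>
      M * Pimat p c N = Bmat p \<beta> (Suc N*p) \<and> M * A0mat p (Suc N*p) = Lmat p \<beta> (Suc N*p) * M"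
proof -
  have "\<forall>a. \<exists>m. (\<forall>b>a. m b = 0) \<and> (\<forall>d<a. (\<Sum>b\<le>a. m b * Tent p c b d) = 0)
    \<and> (\<Sum>d\<le>a. (\<Sum>b\<le>a. m b * Tent p c b d) * cnj (m d)) = 1"
    using triangular_row_exists[OF p c pd] by blast
  then obtain m where "\<forall>a. (\<forall>b>a. m a b = 0) \<and> (\<forall>d<a. (\<Sum>b\<le>a. m a b * Tent p c b d) = 0)
    \<and> (\<Sum>d\<le>a. (\<Sum>b\<le>a. m a b * Tent p c b d) * cnj (m a d)) = 1"
    by (rule choice[THEN exE])
  then have m0: "\<And>a b. b > a \<Longrightarrow> m a b = 0"
    and m1: "\<And>a d. d < a \<Longrightarrow> (\<Sum>b\<le>a. m a b * Tent p c b d) = 0"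
    and m2: "\<And>a. (\<Sum>d\<le>a. (\<Sum>b\<le>a. m a b * Tent p c b d) * cnj (m a d)) = 1"
    by blast+
  define \<beta> where "\<beta> k = mat p (2*p) (\<lambda>(i,e). \<Sum>b\<le>k*p+i. m (k*p+i) b * Pent p c b e)" for k
  have br: "brow p \<beta> a e = (\<Sum>b\<le>a. m a b * Pent p c b e)" if "e < 2*p" for a e
    using that p by (simp add: brow_def \<beta>_def)
  have ext: "(\<Sum>b<n. m a b * f b) = (\<Sum>b\<le>a. m a b * f b)" if "a < n" for a n and f :: "nat \<Rightarrow> complex"
    using sum_extend_zero[of "Suc a" n "\<lambda>b. m a b * f b"] that m0 by (simp add: lessThan_Suc_atMost)
  define Mm where "Mm n = mat n n (\<lambda>(a,b). m a b)" for n
  have M: "Mm n \<in> carrier_mat n n" for n by (simp add: Mm_def)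
  have facts: "Mm (Suc N*p) * toeplitz p c N * adj (Mm (Suc N*p)) = 1\<^sub>m (Suc N*p)"
      "\<And>a d. a < Suc N*p \<Longrightarrow> d < a \<Longrightarrow> (Mm (Suc N*p) * toeplitz p c N) $$ (a,d) = 0"
      "Mm (Suc N*p) * Pimat p c N = Bmat p \<beta> (Suc N*p)" for N
  proof -
    define n where "n = Suc N*p"
    have n: "Suc N*p = n" by (simp only: n_def)
    have T: "toeplitz p c N \<in> carrier_mat n n" unfolding n_def by (rule toeplitz_carrier)
    have P: "Pimat p c N \<in> carrier_mat n (2*p)" unfolding n_def by (rule Pimat_carrier)
    have aM: "adj (Mm n) \<in> carrier_mat n n" using M by (rule adj_carrier)
    have MT: "Mm n * toeplitz p c N \<in> carrier_mat n n" by (rule mult_carrier_mat[OF M T])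
    have X: "Mm n * toeplitz p c N * adj (Mm n) \<in> carrier_mat n n" by (rule mult_carrier_mat[OF MT aM])
    have mt: "(Mm n * toeplitz p c N) $$ (a,d) = (\<Sum>b\<le>a. m a b * Tent p c b d)" if ad: "a < n" "d < n" for a d
    proof -
      have "(Mm n * toeplitz p c N) $$ (a,d) = (\<Sum>b<n. m a b * Tent p c b d)"
        unfolding mat_mult_entry[OF M T ad] using ad
        by (intro sum.cong) (auto simp: Mm_def toeplitz_entry[of _ N p _ c, unfolded n])
      then show ?thesis using ext[OF ad(1)] by simp
    qed
    have me: "(Mm n * toeplitz p c N * adj (Mm n)) $$ (a,b)
        = (\<Sum>d\<le>b. (\<Sum>e\<le>a. m a e * Tent p c e d) * cnj (m b d))"
      if ab: "a < n" "b < n" for a b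
    proof -
      have "(Mm n * toeplitz p c N * adj (Mm n)) $$ (a,b) = (\<Sum>d<n. (\<Sum>e\<le>a. m a e * Tent p c e d) * cnj (m b d))"
        unfolding mat_mult_entry[OF MT aM ab] using ab
        by (intro sum.cong refl) (simp add: mt adj_entry[OF M] Mm_def[THEN arg_cong[of _ _ "\<lambda>A. A $$ _"]] del:
            index_mult_mat(1))
      also have "\<dots> = (\<Sum>d<Suc b. (\<Sum>e\<le>a. m a e * Tent p c e d) * cnj (m b d))"
        using ab m0 by (intro sum_extend_zero) auto
      finally show ?thesis unfolding lessThan_Suc_atMost .
    qed
    \<comment> \<open>M T and M^* are both upper triangular, so the product vanishes below the
      diagonal; above it, hermitian symmetry takes over.\<close>
    have lower: "(Mm n * toeplitz p c N * adj (Mm n)) $$ (a,b) = 0" if "a < n" "b < a" for a b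
      using that by (subst me) (auto intro!: sum.neutral simp: m1)
    have herm: "adj (Mm n * toeplitz p c N * adj (Mm n)) = Mm n * toeplitz p c N * adj (Mm n)"
    proof -
      have "adj (Mm n * toeplitz p c N * adj (Mm n)) = Mm n * adj (Mm n * toeplitz p c N)"
        using adj_mult[OF MT aM] by simp
      also have "adj (Mm n * toeplitz p c N) = toeplitz p c N * adj (Mm n)"
        using adj_mult[OF M T] toeplitz_hermitian[OF c] by simp
      finally show ?thesis using assoc_mult_mat[OF M T aM] by simp
    qed
    show "Mm (Suc N*p) * toeplitz p c N * adj (Mm (Suc N*p)) = 1\<^sub>m (Suc N*p)" unfolding n
    proof (rule eq_matI)
      fix a b assume "a < dim_row (1\<^sub>m n :: complex mat)" "b < dim_col (1\<^sub>m n :: complex mat)"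
      then have ab: "a < n" "b < n" by auto
      consider "b < a" | "a = b" | "a < b" by linarith
      then show "(Mm n * toeplitz p c N * adj (Mm n)) $$ (a,b) = 1\<^sub>m n $$ (a,b)"
      proof cases
        case 1
        then show ?thesis using lower ab by simp
      next
        case 2
        then show ?thesis using me[OF ab] m2 ab by simp
      next
        case 3
        have "(Mm n * toeplitz p c N * adj (Mm n)) $$ (a,b)
            = cnj ((Mm n * toeplitz p c N * adj (Mm n)) $$ (b,a))"
          using adj_entry[OF X, of a b] ab unfolding herm by simp
        then show ?thesis using lower[of b a] 3 ab by simp
      qed
    qed (use X in auto)
    show "(Mm (Suc N*p) * toeplitz p c N) $$ (a,d) = 0" if "a < Suc N*p" "d < a" for a d
      using mt[of a d] m1[of d a] that unfolding n by simp
    show "Mm (Suc N*p) * Pimat p c N = Bmat p \<beta> (Suc N*p)" unfolding n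
    proof (rule eq_matI)
      fix a e assume "a < dim_row (Bmat p \<beta> n)" "e < dim_col (Bmat p \<beta> n)"
      then have ae: "a < n" "e < 2*p" by (auto simp: Bmat_def)
      have "(Mm n * Pimat p c N) $$ (a,e) = (\<Sum>b<n. m a b * Pent p c b e)"
        unfolding mat_mult_entry[OF M P ae] using ae
        by (intro sum.cong) (auto simp: Mm_def Pimat_entry[of _ N p _ c, unfolded n])
      then show "(Mm n * Pimat p c N) $$ (a,e) = Bmat p \<beta> n $$ (a,e)"
        using ext[OF ae(1)] ae by (simp add: Bmat_def br)
    qed (use P in \<open>auto simp: Bmat_def Mm_def\<close>)
  qed
  have low: "Mm n $$ (a,b) = 0" if "a < n" "b < n" "a < b" for n a b using that m0 by (simp add: Mm_def)
  note str = triangular_structure[OF c M low facts(2) facts(1) facts(3)]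
  have adm: "admissible p \<beta>" unfolding admissible_def
  proof (intro allI conjI)
    fix k
    show b: "\<beta> k \<in> carrier_mat p (2*p)" by (simp add: \<beta>_def)
    show "\<beta> k * Jmat p * adj (\<beta> k) = 1\<^sub>m p"
    proof (rule eq_matI)
      fix i j assume "i < dim_row (1\<^sub>m p :: complex mat)" "j < dim_col (1\<^sub>m p :: complex mat)"
      then have ij: "i < p" "j < p" by auto
      have "(\<beta> k * Jmat p * adj (\<beta> k)) $$ (i,j) = gram p \<beta> (k*p+i) (k*p+j)"
        unfolding gram_def mult_Jmat_adj_entry[OF b b ij] using ij
        by (intro Jform_cong) (auto simp: brow_def)
      also have "\<dots> = (if i = j then 1 else 0)"
        using str(1)[where N=k and a="k*p+i"
            and b="k*p+j"] block_index_lt[of k k i p] block_index_lt[of k k j p] ij by simp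
      finally show "(\<beta> k * Jmat p * adj (\<beta> k)) $$ (i,j) = 1\<^sub>m p $$ (i,j)" using ij by simp
    qed (use b in auto)
  qed
  show thesis
  proof (rule that[OF adm])
    fix N
    show "\<exists>M. M \<in> carrier_mat (Suc N*p) (Suc N*p) \<and> M * toeplitz p c N * adj M = 1\<^sub>m (Suc N*p) \<and>
      M * Pimat p c N = Bmat p \<beta> (Suc N*p) \<and> M * A0mat p (Suc N*p) = Lmat p \<beta> (Suc N*p) * M"
      using M facts(1,3) str(2) by blast
  qed
qed

lemma Ftrans_inverse:
  assumes C: "caratheodory p (Ftrans \<phi>)"
  shows "\<forall>l\<in>lower_hp. \<phi> l \<in> carrier_mat p p"
    "\<forall>a<p. \<forall>b<p. (\<lambda>l. \<phi> l $$ (a,b)) holomorphic_on lower_hp"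
proof -
  let ?m = "\<lambda>l. (l + \<i>) / (l - \<i>)"
  have F: "Ftrans \<phi> (?m l) = \<i> \<cdot>\<^sub>m \<phi> l" if "l \<in> lower_hp" for l
    unfolding Ftrans_def mobius_inverse(2)[OF that, symmetric] ..
  have cf: "\<phi> l \<in> carrier_mat p p" if l: "l \<in> lower_hp" for l
  proof -
    have "Ftrans \<phi> (?m l) \<in> carrier_mat p p"
      using C mobius_inverse(1)[OF l] unfolding caratheodory_def by auto
    then have "dim_row (\<i> \<cdot>\<^sub>m \<phi> l) = p" "dim_col (\<i> \<cdot>\<^sub>m \<phi> l) = p"
      unfolding F[OF l] by (rule carrier_matD)+
    then show ?thesis by (intro carrier_matI) simp_all
  qed
  then show "\<forall>l\<in>lower_hp. \<phi> l \<in> carrier_mat p p" by blast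
  show "\<forall>a<p. \<forall>b<p. (\<lambda>l. \<phi> l $$ (a,b)) holomorphic_on lower_hp"
  proof (intro allI impI)
    fix a b assume ab: "a < p" "b < p"
    have "((\<lambda>z. Ftrans \<phi> z $$ (a,b)) \<circ> ?m) holomorphic_on lower_hp"
    proof (rule holomorphic_on_compose_gen)
      show "?m holomorphic_on lower_hp"
        by (intro holomorphic_intros) (auto simp: lower_hp_def)
      show "(\<lambda>z. Ftrans \<phi> z $$ (a,b)) holomorphic_on ball 0 1"
        using C ab unfolding caratheodory_def by blast
      show "?m ` lower_hp \<subseteq> ball 0 1" using mobius_inverse(1) by auto
    qed
    then have "(\<lambda>l. - \<i> * Ftrans \<phi> (?m l) $$ (a,b)) holomorphic_on lower_hp"
      unfolding o_def by (intro holomorphic_intros)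
    then show "(\<lambda>l. \<phi> l $$ (a,b)) holomorphic_on lower_hp"
    proof (rule holomorphic_transform)
      fix l assume l: "l \<in> lower_hp"
      show "- \<i> * Ftrans \<phi> (?m l) $$ (a,b) = \<phi> l $$ (a,b)"
        unfolding F[OF l] using cf[OF l] ab by (simp flip: mult.assoc)
    qed
  qed
qed

lemma positive_toeplitz_imp_weyl:
  assumes p: "0 < p" and E: "expansion p (Ftrans \<phi>) c" and C: "caratheodory p (Ftrans \<phi>)"
    and pd: "\<And>N. pos_def (toeplitz p c N)"
  shows "\<exists>\<beta>. admissible p \<beta> \<and> is_weyl p \<beta> \<phi>"
proof -
  have c: "c k \<in> carrier_mat p p" for k using E by (simp add: expansion_def)
  obtain \<beta> where adm: "admissible p \<beta>"
      and ex: "\<And>N. \<exists>M. M \<in> carrier_mat (Suc N*p) (Suc N*p) \<and> M * toeplitz p c N * adj M = 1\<^sub>m (Suc N*p) \<and>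
      M * Pimat p c N = Bmat p \<beta> (Suc N*p) \<and> M * A0mat p (Suc N*p) = Lmat p \<beta> (Suc N*p) * M"
    by (rule positive_toeplitz_factorization[OF p c pd]) blast
  have "Jnorm p (tseq p \<beta> z (vinit p (Ftrans \<phi> z) x) k) \<le> 0"
    if z: "cmod z < 1" for z x k
  proof (cases k)
    case 0
    then show ?thesis using ex[of 0] triangular_factor_weyl(1)[OF p adm E pd z] by (metis tseq.simps(1))
  next
    case (Suc N)
    then show ?thesis using ex[of N] triangular_factor_weyl(2)[OF p adm E pd z] by metis
  qed
  then have "is_weyl p \<beta> \<phi>" unfolding is_weyl_iff[OF adm] using Ftrans_inverse[OF C] by auto
  then show ?thesis using adm by blast
qed

theorem theorem6p6:
  fixes p :: nat
  assumes "1 \<le> p"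
  shows "(\<forall>\<phi>. (\<exists>\<beta>. admissible p \<beta> \<and> is_weyl p \<beta> \<phi>) \<longleftrightarrow>
            (\<exists>c. expansion p (Ftrans \<phi>) c \<and> caratheodory p (Ftrans \<phi>) \<and>
                 (\<forall>N. pos_def (toeplitz p c N))))
       \<and> (\<forall>\<beta> \<phi> c N. admissible p \<beta> \<longrightarrow> is_weyl p \<beta> \<phi> \<longrightarrow> expansion p (Ftrans \<phi>) c \<longrightarrow>
            (\<exists>S. S \<in> carrier_mat (Suc N * p) (Suc N * p) \<and>
                 Amat p N * S - S * adj (Amat p N) = \<i> \<cdot>\<^sub>m (Pimat p c N * Jmat p * adj (Pimat p c N)) \<and>
                 pos_def S \<and>
                 adj (Pimat p c N) * minv S * Pimat p c N = msum (2*p) (\<lambda>k. adj (\<beta> k) * \<beta> k) {..N} \<and>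
                 (\<forall>S'. S' \<in> carrier_mat (Suc N * p) (Suc N * p) \<and>
                     Amat p N * S' - S' * adj (Amat p N) = \<i> \<cdot>\<^sub>m (Pimat p c N * Jmat p * adj (Pimat p c N))
                     \<longrightarrow> S' = S)))"
proof (intro conjI allI impI)
  have p: "0 < p" using assms by simp
  fix \<phi>
  show "(\<exists>\<beta>. admissible p \<beta> \<and> is_weyl p \<beta> \<phi>) \<longleftrightarrow>
    (\<exists>c. expansion p (Ftrans \<phi>) c \<and> caratheodory p (Ftrans \<phi>) \<and> (\<forall>N. pos_def (toeplitz p c N)))"
  proof
    assume "\<exists>\<beta>. admissible p \<beta> \<and> is_weyl p \<beta> \<phi>"
    then obtain \<beta> where adm: "admissible p \<beta>" and w: "is_weyl p \<beta> \<phi>" by blast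
    have C: "caratheodory p (Ftrans \<phi>)" by (rule weyl_imp_caratheodory[OF adm w])
    then obtain c where E: "expansion p (Ftrans \<phi>) c"
      using holomorphic_expansion_exists[of p "Ftrans \<phi>"] unfolding caratheodory_def by blast
    show "\<exists>c. expansion p (Ftrans \<phi>) c \<and> caratheodory p (Ftrans \<phi>) \<and> (\<forall>N. pos_def (toeplitz p c N))"
      using E C weyl_toeplitz_pos_def(1)[OF p adm w E] by blast
  qed (use positive_toeplitz_imp_weyl[OF p] in blast)
next
  have p: "0 < p" using assms by simp
  fix \<beta> \<phi> c N
  assume adm: "admissible p \<beta>" and w: "is_weyl p \<beta> \<phi>" and E: "expansion p (Ftrans \<phi>) c"
  then have c: "c k \<in> carrier_mat p p" for k by (simp add: expansion_def)
  \<comment> \<open>The identities for N and N - 1 differ by \<beta>(N)^* \<beta>(N), and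
    \<open>Cmat\<close> depends on \<beta>(N) only through this product. As S is determined by the
    Taylor coefficients, this is the sense in which the Weyl function determines the system.\<close>
  show "\<exists>S. S \<in> carrier_mat (Suc N * p) (Suc N * p) \<and>
      Amat p N * S - S * adj (Amat p N) = \<i> \<cdot>\<^sub>m (Pimat p c N * Jmat p * adj (Pimat p c N)) \<and>
      pos_def S \<and>
      adj (Pimat p c N) * minv S * Pimat p c N = msum (2*p) (\<lambda>k. adj (\<beta> k) * \<beta> k) {..N} \<and>
      (\<forall>S'. S' \<in> carrier_mat (Suc N * p) (Suc N * p) \<and>
          Amat p N * S' - S' * adj (Amat p N) = \<i> \<cdot>\<^sub>m (Pimat p c N * Jmat p * adj (Pimat p c N)) \<longrightarrow> S' = S)"
    by (intro exI[of _ "toeplitz p c N"] conjI allI impI toeplitz_carrier toeplitz_sylvester[OF c]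
        weyl_toeplitz_pos_def[OF p adm w E] sylvester_unique[OF c]) auto
qed

end
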